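(* Let $\varepsilon\in(0,1)$ and let $G$ be a graph on $[n]$ with average degree $\bar d$ and maximum degree $\Delta\le\frac{\varepsilon^2 n}{3(\bar d+1)^3}$, presented as an insertion-only edge-arrival stream. The online streaming algorithm CWEI$_1$ (described in the context) maintains at all times an independent set of the graph formed by the edges seen so far, and with probability at least $2/3$ the final reported independent set has size between $(1-\varepsilon)\lambda$ and $(1+\varepsilon)\lambda$, where $\lambda=\sum_{v}\frac{1}{d(v)+1}$ is the Caro–Wei bound of $G$. Its working space is $\mathcal O(\log\varepsilon^{-1}\cdot\log n)$ bits and its update time is $\mathcal O(\log\varepsilon^{-1})$.
   Context: Graphs are simple, undirected, on vertex set $[n]$ with $n$ known; $d(v)$ is the degree, $\bar d$ the average degree, $\Delta$ the maximum degree. In the online streaming model, after each stream item the algorithm must be able to report a valid solution, and its decisions on the solution are irrevocable; the working space used for computation is distinguished from an additional write-only solution space that stores the solution. A family $\mathcal H$ of functions $h:[n]\to[n^3]$ is $\varepsilon$-min-wise if for all $A\subset[n]$, $x\in[n]\setminus A$: $\Pr_{h}[\forall a\in A: h(x)<h(a)]\in[\frac{1-\varepsilon}{|A|+1},\frac{1+\varepsilon}{|A|+1}]$; such a family is realized by an $\mathcal O(\log\varepsilon^{-1})$-wise independent family, storable in $\mathcal O(\log\varepsilon^{-1}\log n)$ bits with evaluation time $\mathcal O(\log\varepsilon^{-1})$. Algorithm CWEI$_1$: pick $h$ uniformly at random from an $\varepsilon$-min-wise family; initialize an $n$-bit array $A$ in the solution space to all true. On each edge $(u,v)$, labelled so that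 $h(u)\le h(v)$, irrevocably set $A[v]$ to false. The reported independent set is the set of indices $i$ with $A[i]$ true.
   Formalization: The size claim fails for some ε-min-wise families; it is proved for k-wise independent ones, k ≥ c·log(2/ε), uniform on [m], n² ≤ m ≤ n³, shown ε-min-wise if G has an edge; O(log ε⁻¹) is read as O(log(2/ε)). *)

theory Defs
  imports "HOL-Probability.Probability" "HOL-Library.Ramsey"
begin

subsection \<open>Graphs, the Caro--Wei bound, and edge streams\<close>

text \<open>
  The vertex set \<open>[n]\<close> is \<open>{..<n}\<close>, and the hash range \<open>[n\<^sup>3]\<close> is \<open>{..<n^3}\<close>.
\<close>

definition simple_graph :: "nat \<Rightarrow> nat set set \<Rightarrow> bool" where
  "simple_graph n E \<longleftrightarrow> E \<subseteq> nsets {..<n} 2"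

definition degree :: "nat set set \<Rightarrow> nat \<Rightarrow> nat" where
  "degree E v = card {e \<in> E. v \<in> e}"

definition max_degree :: "nat \<Rightarrow> nat set set \<Rightarrow> nat" where
  "max_degree n E = Max (degree E ` {..<n})"

definition avg_degree :: "nat \<Rightarrow> nat set set \<Rightarrow> real" where
  "avg_degree n E = (\<Sum>v<n. real (degree E v)) / real n"

definition caro_wei :: "nat \<Rightarrow> nat set set \<Rightarrow> real" where
  "caro_wei n E = (\<Sum>v<n. 1 / (real (degree E v) + 1))"

text \<open>
  A stream item is an ordered pair; the order in which the endpoints of an edge are presented
  is arbitrary. Every edge arrives exactly once.
\<close>

definition edges_of :: "(nat \<times> nat) list \<Rightarrow> nat set set" where
  "edges_of es = (\<lambda>(u, v). {u, v}) ` set es"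

definition edge_stream :: "nat set set \<Rightarrow> (nat \<times> nat) list \<Rightarrow> bool" where
  "edge_stream E es \<longleftrightarrow> distinct (map (\<lambda>(u, v). {u, v}) es) \<and> edges_of es = E"


subsection \<open>Hash families\<close>

text \<open>
  A family is given by a finite nonempty set \<open>S\<close> of seeds and, for every seed \<open>s\<close>, a
  function \<open>h s\<close>; a random member is \<open>h s\<close> for a uniformly random seed \<open>s\<close>. Only the values
  on \<open>{..<n}\<close> matter.
\<close>

definition eps_min_wise ::
  "real \<Rightarrow> nat \<Rightarrow> 's set \<Rightarrow> ('s \<Rightarrow> nat \<Rightarrow> nat) \<Rightarrow> bool" where
  "eps_min_wise \<epsilon> n S h \<longleftrightarrow>
     finite S \<and> S \<noteq> {} \<and>
     (\<forall>s\<in>S. \<forall>x<n. h s x < n ^ 3) \<and>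
     (\<forall>A x. A \<subseteq> {..<n} \<and> x < n \<and> x \<notin> A \<longrightarrow>
        measure_pmf.prob (pmf_of_set S) {s. \<forall>a\<in>A. h s x < h s a}
          \<in> {(1 - \<epsilon>) / (real (card A) + 1) .. (1 + \<epsilon>) / (real (card A) + 1)})"

text \<open>
  \<open>k\<close>-wise independence with values uniform on \<open>{..<m}\<close>. The range size \<open>m\<close> is a parameter
  because families whose values are exactly uniform on \<open>{..<n^3}\<close> are not available with short
  seeds for general \<open>n\<close>; the usual polynomial construction uses a prime \<open>m \<le> n^3\<close>.
\<close>

definition kwise_independent ::
  "nat \<Rightarrow> nat \<Rightarrow> nat \<Rightarrow> 's set \<Rightarrow> ('s \<Rightarrow> nat \<Rightarrow> nat) \<Rightarrow> bool" where
  "kwise_independent k n m S h \<longleftrightarrow>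
     finite S \<and> S \<noteq> {} \<and> 0 < m \<and>
     (\<forall>x<n. map_pmf (\<lambda>s. h s x) (pmf_of_set S) = pmf_of_set {..<m}) \<and>
     (\<forall>X. X \<subseteq> {..<n} \<and> card X \<le> k \<longrightarrow>
        prob_space.indep_vars (measure_pmf (pmf_of_set S))
          (\<lambda>_. count_space UNIV) (\<lambda>x s. h s x) X)"


subsection \<open>The algorithm\<close>

text \<open>
  If both endpoints have the same hash value, either labelling of the edge is admissible; the
  order of presentation decides, and that order is arbitrary in the stream.
\<close>

fun cwei1_step :: "(nat \<Rightarrow> nat) \<Rightarrow> nat \<times> nat \<Rightarrow> bool list \<Rightarrow> bool list" where
  "cwei1_step h (u, v) A = (if h u \<le> h v then A[v := False] else A[u := False])"

definition cwei1 :: "(nat \<Rightarrow> nat) \<Rightarrow> nat \<Rightarrow> (nat \<times> nat) list \<Rightarrow> bool list" where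
  "cwei1 h n es = fold (cwei1_step h) es (replicate n True)"

definition reported :: "bool list \<Rightarrow> nat set" where
  "reported A = {i. i < length A \<and> A ! i}"


subsection \<open>Word RAM with a write-only solution array\<close>

text \<open>
  The working memory is a fixed-length list of words of \<open>w\<close> bits. Operands of instructions
  name memory cells by constant addresses; \<open>Load\<close> and \<open>Store\<close> address indirectly. There are no
  registers outside the working memory (apart from the program counter, which ranges over the
  fixed program). The current stream item is read-only. The solution array is accessed only
  by \<open>Clear\<close>, which irrevocably sets an entry to \<open>False\<close>. Each instruction takes one time unit.
\<close>

datatype ram_op = Add | Sub | Mul | Div | Mod

datatype instr =
    SetConst nat nat        \<comment> \<open>\<open>mem[d] := c\<close>\<close>
  | ReadFst nat             \<comment> \<open>\<open>mem[d] := u\<close> for the current item \<open>(u, v)\<close>\<close>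
  | ReadSnd nat             \<comment> \<open>\<open>mem[d] := v\<close>\<close>
  | Arith ram_op nat nat nat \<comment> \<open>\<open>mem[d] := mem[a] op mem[b]\<close>\<close>
  | Load nat nat            \<comment> \<open>\<open>mem[d] := mem[mem[a]]\<close>\<close>
  | Store nat nat           \<comment> \<open>\<open>mem[mem[d]] := mem[a]\<close>\<close>
  | JumpLe nat nat nat      \<comment> \<open>if \<open>mem[a] \<le> mem[b]\<close> then \<open>goto l\<close>\<close>
  | Clear nat               \<comment> \<open>\<open>solution[mem[a]] := False\<close>\<close>

fun ram_op_val :: "ram_op \<Rightarrow> nat \<Rightarrow> nat \<Rightarrow> nat" where
  "ram_op_val Add x y = x + y"
| "ram_op_val Sub x y = x - y"
| "ram_op_val Mul x y = x * y"
| "ram_op_val Div x y = x div y"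
| "ram_op_val Mod x y = x mod y"

text \<open>Reads outside the memory yield \<open>0\<close>; \<open>list_update\<close> ignores writes outside of it.\<close>

definition rd :: "nat list \<Rightarrow> nat \<Rightarrow> nat" where
  "rd mem a = (if a < length mem then mem ! a else 0)"

definition wr :: "nat \<Rightarrow> nat list \<Rightarrow> nat \<Rightarrow> nat \<Rightarrow> nat list" where
  "wr w mem d x = mem[d := x mod 2 ^ w]"

type_synonym ram_config = "nat \<times> nat list \<times> bool list"

fun ram_exec :: "nat \<Rightarrow> nat \<times> nat \<Rightarrow> instr \<Rightarrow> ram_config \<Rightarrow> ram_config" where
  "ram_exec w e (SetConst d c) (pc, mem, A) = (pc + 1, wr w mem d c, A)"
| "ram_exec w e (ReadFst d) (pc, mem, A) = (pc + 1, wr w mem d (fst e), A)"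
| "ram_exec w e (ReadSnd d) (pc, mem, A) = (pc + 1, wr w mem d (snd e), A)"
| "ram_exec w e (Arith f d a b) (pc, mem, A) =
     (pc + 1, wr w mem d (ram_op_val f (rd mem a) (rd mem b)), A)"
| "ram_exec w e (Load d a) (pc, mem, A) = (pc + 1, wr w mem d (rd mem (rd mem a)), A)"
| "ram_exec w e (Store d a) (pc, mem, A) = (pc + 1, wr w mem (rd mem d) (rd mem a), A)"
| "ram_exec w e (JumpLe a b l) (pc, mem, A) =
     (if rd mem a \<le> rd mem b then l else pc + 1, mem, A)"
| "ram_exec w e (Clear a) (pc, mem, A) = (pc + 1, mem, A[rd mem a := False])"

definition ram_step :: "nat \<Rightarrow> instr list \<Rightarrow> nat \<times> nat \<Rightarrow> ram_config \<Rightarrow> ram_config" where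
  "ram_step w P e cf = (if fst cf < length P then ram_exec w e (P ! fst cf) cf else cf)"

text \<open>
  \<open>ram_stream w P T es (mem, A) (mem', A')\<close>: running \<open>P\<close> once per item of \<open>es\<close>, every run
  halts (that is, leaves the program text) within \<open>T\<close> steps, and the working memory and the
  solution array evolve from \<open>(mem, A)\<close> to \<open>(mem', A')\<close>. Halted configurations are fixed
  points of \<^const>\<open>ram_step\<close>, so the result is unique.
\<close>

fun ram_stream ::
  "nat \<Rightarrow> instr list \<Rightarrow> nat \<Rightarrow> (nat \<times> nat) list \<Rightarrow>
   nat list \<times> bool list \<Rightarrow> nat list \<times> bool list \<Rightarrow> bool" where
  "ram_stream w P T [] st st' \<longleftrightarrow> st' = st"
| "ram_stream w P T (e # es) st st' \<longleftrightarrow>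
     (\<exists>t\<le>T. \<exists>pc st1. (ram_step w P e ^^ t) (0, st) = (pc, st1) \<and> length P \<le> pc \<and>
        ram_stream w P T es st1 st')"

text \<open>
  The program \<open>P\<close>, started with a seed \<open>s \<in> S\<close> as its working memory (parameters, hash
  function and scratch cells together: \<open>cells\<close> words of \<open>w\<close> bits) and with the all-true
  solution array, computes the same solution as \<^const>\<open>cwei1\<close> with hash function \<open>h s\<close> on
  every stream, spending at most \<open>T\<close> steps per item. Prefixes of streams are streams, so the
  solutions agree after every item.
\<close>

definition implements_cwei1 ::
  "instr list \<Rightarrow> nat \<Rightarrow> nat \<Rightarrow> nat \<Rightarrow> nat \<Rightarrow> nat list set \<Rightarrow> (nat list \<Rightarrow> nat \<Rightarrow> nat) \<Rightarrow> bool"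
where
  "implements_cwei1 P w cells T n S h \<longleftrightarrow>
     (\<forall>s\<in>S. length s = cells \<and> (\<forall>x\<in>set s. x < 2 ^ w)) \<and>
     (\<forall>E es. simple_graph n E \<and> edge_stream E es \<longrightarrow>
        (\<forall>s\<in>S. \<exists>mem'. ram_stream w P T es (s, replicate n True) (mem', cwei1 (h s) n es)))"

end

theory Submission
  imports Defs
begin

text \<open>
  Vertex \<open>v\<close> survives iff its hash value is minimal in its neighbourhood, up to ties. Given
  \<open>h v = t\<close>, this means that \<open>Z\<close>, the number of neighbours with a value below \<open>t\<close>, vanishes.
  Let \<open>\<mu>\<close> be the mean of \<open>Z\<close> and \<open>r\<close> of order \<open>log (2 / \<epsilon>)\<close>. For \<open>\<mu> \<le> 4 * r\<close>, inclusion-exclusion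
  truncated after \<open>32 * r\<close> terms shows that limited and full independence agree on \<open>Z = 0\<close> up to
  \<open>2 * (1 / 2) ^ r\<close>. For larger \<open>\<mu>\<close>, split the neighbours into \<open>r\<close> blocks of mean about \<open>\<mu> / r\<close>;
  the product of the squared relative deviations of the blocks has degree \<open>2 * r\<close> and bounds
  the indicator of \<open>Z = 0\<close>, so both probabilities are at most \<open>(2 * r / \<mu>) ^ r\<close>. These bounds are
  summable over \<open>t\<close>, which gives survival probabilities with relative error \<open>O(\<epsilon>\<^sup>2)\<close>. The same
  works for two vertices with disjoint closed neighbourhoods. Hence only
  pairs with a common neighbour contribute to the variance substantially, there are at most
  \<open>\<Delta> * (\<Sum>v. d v)\<close> of them, and Chebyshev's inequality applies.

  The family realising the resource bounds consists of the polynomials of degree less than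
  \<open>min k n\<close> over a prime field, evaluated by Horner's rule; the minimum keeps the coefficients
  addressable by words of length \<open>O(log n)\<close> when \<open>\<epsilon>\<close> is tiny.
\<close>

subsection \<open>A prime between \<open>n\<^sup>2\<close> and \<open>n\<^sup>3\<close>\<close>

text \<open>The obstacle is relative precision. The survival probability of a vertex is about
  \<open>1 / (d v + 1)\<close>, and \<open>d v\<close> is not bounded in terms of
  \<open>\<epsilon>\<close>. An error bound uniform in \<open>t\<close> would, after averaging over
  \<open>t\<close>, only be additive and could swamp this. The bound therefore has to decay in
  \<open>t\<close>, so that only a fraction of order \<open>r / d v\<close> of the values
  contributes; the regime of large \<open>\<mu>\<close> supplies this decay. The relative error must
  be of order \<open>\<epsilon>\<^sup>2\<close>, because the covariances of distant pairs add up to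
  this error times the square of the Caro-Wei bound, while Chebyshev's inequality compares the
  variance with \<open>\<epsilon>\<^sup>2\<close> times that square. The cube of the average degree
  plus one splits likewise: one factor counts pairs with a common neighbour, two come from squaring
  the lower bound for the Caro-Wei sum. Ties shift each survival probability by at most
  \<open>1 / m\<close>, in total \<open>n / m\<close>; a range of at least \<open>n\<^sup>2\<close>
  makes this negligible. No conditional probabilities occur. Every estimate carries a nonnegative
  weight that fixes the values of the one or two vertices under study, at the price of two degrees
  of independence.\<close>

lemma card_filter_eq_sum:
  assumes "finite A"
  shows "card {i \<in> A. P i} = (\<Sum>i\<in>A. of_bool (P i))"
proof -
  have "{i \<in> A. P i} = A \<inter> Collect P" by auto
  thus ?thesis using assms by simp
qed

lemma multiplicity_eq_card:
  fixes p x :: nat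
  assumes p: "prime p" and x: "0 < x" "x < p ^ Suc M"
  shows "multiplicity p x = card {i \<in> {1..M}. p ^ i dvd x}"
proof -
  have iff: "p ^ i dvd x \<longleftrightarrow> i \<le> multiplicity p x" for i
    using x(1) prime_gt_1_nat[OF p] by (intro power_dvd_iff_le_multiplicity) auto
  have "p ^ multiplicity p x \<le> x" using x by (intro dvd_imp_le multiplicity_dvd)
  hence "p ^ multiplicity p x < p ^ Suc M" using x(2) by (rule le_less_trans)
  hence "multiplicity p x < Suc M" by (rule power_less_imp_less_exp[OF prime_gt_1_nat[OF p]])
  hence "multiplicity p x \<le> M" by simp
  have "{i \<in> {1..M}. i \<le> r} = {1..r}" if "r \<le> M" for r
    using that by auto
  from this[OF \<open>multiplicity p x \<le> M\<close>]
  have "{i \<in> {1..M}. p ^ i dvd x} = {1..multiplicity p x}"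
    unfolding iff .
  thus ?thesis by simp
qed

text \<open>Legendre's formula, cut off at \<open>M\<close> because higher powers of
  \<open>p\<close> exceed \<open>k\<close>. In the induction, \<open>k div p ^ i\<close> increases
  by one exactly when \<open>p ^ i\<close> divides the new factor \<open>Suc k\<close>.\<close>

lemma multiplicity_fact:
  fixes p :: nat
  assumes p: "prime p" and k: "k < p ^ Suc M"
  shows "multiplicity p (fact k) = (\<Sum>i=1..M. k div p ^ i)"
  using k
proof (induction k)
  case (Suc k)
  have "multiplicity p (fact (Suc k)) = multiplicity p (Suc k * fact k)" by simp
  also have "\<dots> = multiplicity p (Suc k) + multiplicity p (fact k)"
    using p by (intro prime_elem_multiplicity_mult_distrib) auto
  also have "multiplicity p (Suc k) = (\<Sum>i=1..M. of_bool (p ^ i dvd Suc k))"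
    using multiplicity_eq_card[OF p _ Suc.prems] by (simp only: card_filter_eq_sum finite_atLeastAtMost)
  also have "multiplicity p (fact k) = (\<Sum>i=1..M. k div p ^ i)" using Suc by simp
  also have "(\<Sum>i=1..M. of_bool (p ^ i dvd Suc k)) + (\<Sum>i=1..M. k div p ^ i) =
      (\<Sum>i=1..M. Suc k div p ^ i)"
    unfolding sum.distrib[symmetric]
  proof (intro sum.cong refl)
    fix i
    show "of_bool (p ^ i dvd Suc k) + k div p ^ i = Suc k div p ^ i"
      by (simp only: div_Suc dvd_eq_mod_eq_0) simp
  qed
  finally show ?case .
qed simp

text \<open>By Legendre's formula the exponent of \<open>p\<close> is the sum of the differences of
  \<open>2 * N div p ^ i\<close> and \<open>2 * (N div p ^ i)\<close>. Each difference is 0 or 1,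
  and 0 once \<open>p ^ i\<close> exceeds \<open>2 * N\<close>, so the exponent is at most the
  number of positive \<open>i\<close> with \<open>p ^ i \<le> 2 * N\<close>.\<close>

lemma central_binomial_prime_power_le:
  fixes p :: nat
  assumes p: "prime p" and N: "0 < N"
  shows "p ^ multiplicity p ((2 * N) choose N) \<le> 2 * N"
proof -
  define M where "M = 2 * N"
  have p1: "1 < p" using p prime_gt_1_nat by blast
  have "2 * N < 2 ^ (2 * N)" by (rule less_exp)
  also have "\<dots> \<le> p ^ (2 * N)" using p1 by (intro power_mono) auto
  also have "\<dots> \<le> p ^ Suc M" unfolding M_def using p1 by (intro power_increasing) auto
  finally have M: "2 * N < p ^ Suc M" .
  let ?C = "(2 * N) choose N"
  have "fact N * fact N * ?C = (fact (2 * N) :: nat)"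
    using binomial_fact_lemma[of N "2 * N"] by simp
  hence "multiplicity p (fact N * fact N * ?C) = multiplicity p (fact (2 * N))" by simp
  moreover have "multiplicity p (fact N * fact N * ?C) =
      multiplicity p (fact N) + multiplicity p (fact N) + multiplicity p ?C"
    using p by (simp add: prime_elem_multiplicity_mult_distrib)
  ultimately have "multiplicity p ?C + (\<Sum>i=1..M. 2 * (N div p ^ i)) = (\<Sum>i=1..M. 2 * N div p ^ i)"
    using multiplicity_fact[OF p M] multiplicity_fact[OF p, of N M] M
    by (simp add: sum_distrib_left[symmetric])
  also have "\<dots> \<le> (\<Sum>i=1..M. 2 * (N div p ^ i) + of_bool (p ^ i \<le> 2 * N))"
  proof (intro sum_mono)
    fix i
    let ?d = "p ^ i"
    show "2 * N div ?d \<le> 2 * (N div ?d) + of_bool (?d \<le> 2 * N)"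
    proof (cases "?d \<le> 2 * N")
      case True
      have d: "0 < ?d" using p1 by simp
      have "2 * N = ?d * (2 * (N div ?d)) + 2 * (N mod ?d)"
        using mult_div_mod_eq[of ?d N] by (metis distrib_left mult.left_commute)
      also have "\<dots> < ?d * (2 * (N div ?d)) + ?d * 2" using d by simp
      finally have "2 * N < (2 * (N div ?d) + 2) * ?d" by (simp add: algebra_simps)
      hence "2 * N div ?d < 2 * (N div ?d) + 2" using d by (simp add: div_less_iff_less_mult)
      thus ?thesis using True by simp
    qed simp
  qed
  finally have "multiplicity p ?C \<le> (\<Sum>i=1..M. of_bool (p ^ i \<le> 2 * N))"
    by (simp add: sum.distrib)
  also have "\<dots> = card {i \<in> {1..M}. p ^ i \<le> 2 * N}"
    by (simp only: card_filter_eq_sum finite_atLeastAtMost)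
  finally have le: "multiplicity p ?C \<le> card {i \<in> {1..M}. p ^ i \<le> 2 * N}" .
  show ?thesis
  proof (rule ccontr)
    assume "\<not> ?thesis"
    hence gt: "2 * N < p ^ multiplicity p ?C" by simp
    hence "{i \<in> {1..M}. p ^ i \<le> 2 * N} \<subseteq> {1..<multiplicity p ?C}"
    proof (intro subsetI)
      fix i assume "i \<in> {i \<in> {1..M}. p ^ i \<le> 2 * N}"
      hence "1 \<le> i" "p ^ i < p ^ multiplicity p ?C" using gt by auto
      thus "i \<in> {1..<multiplicity p ?C}"
        using power_less_imp_less_exp[OF p1, of i] by simp
    qed
    from card_mono[OF _ this] have "card {i \<in> {1..M}. p ^ i \<le> 2 * N} \<le> multiplicity p ?C - 1"
      by simp
    hence "multiplicity p ?C = 0" using le by linarith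
    thus False using gt N by simp
  qed
qed

lemma power6_le_two_power: "32 \<le> n \<Longrightarrow> 2 * real n ^ 6 \<le> 2 ^ n"
proof (induction n rule: nat_induct_at_least)
  case (Suc n)
  \<comment> \<open>From 32 on, \<open>n + 1\<close> is at most \<open>33 / 32 * n\<close>, and the
    sixth power of \<open>33 / 32\<close> is below 2.\<close>
  have "2 * real (Suc n) ^ 6 \<le> 2 * (33 / 32 * real n) ^ 6"
    using Suc by (intro mult_left_mono power_mono) auto
  also have "\<dots> \<le> 2 * (2 * real n ^ 6)" by (simp add: power_mult_distrib power_divide)
  also have "\<dots> \<le> 2 * 2 ^ n" using Suc by simp
  finally show ?case by simp
qed simp

text \<open>Erdos's argument with a central binomial coefficient. Without a prime in the gap,
  \<open>(2 * N) choose N\<close> with \<open>2 * N\<close> about \<open>n ^ 3\<close> has only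
  prime factors below \<open>n\<^sup>2\<close>, each contributing at most \<open>n ^ 3\<close>. This
  is too little for a number that is at least \<open>2 ^ N\<close>.\<close>

lemma prime_between_square_and_cube_large:
  fixes n :: nat
  assumes n: "32 \<le> n"
  shows "\<exists>p. prime p \<and> n\<^sup>2 \<le> p \<and> p \<le> n ^ 3"
proof (rule ccontr)
  assume none: "\<not> ?thesis"
  define N where "N = n ^ 3 div 2"
  have "2 ^ 3 \<le> n ^ 3" using n by (intro power_mono) auto
  hence N: "0 < N" "2 * N \<le> n ^ 3" "n ^ 3 \<le> 2 * N + 1" by (auto simp: N_def)
  let ?C = "(2 * N) choose N"
  have C0: "?C \<noteq> 0" by simp
  have small: "p < n\<^sup>2" if "p \<in> prime_factors ?C" for p
  proof -
    have p: "prime p" "p dvd ?C" using that by auto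
    have "?C dvd fact (2 * N)" using binomial_fact_lemma[of N "2 * N"] by (metis dvd_triv_right le_add2 mult_2)
    hence "p dvd fact (2 * N)" using p dvd_trans by blast
    hence "p \<le> n ^ 3" using p N by (simp add: prime_dvd_fact_iff)
    thus ?thesis using none p by (auto simp: not_le)
  qed
  have "?C = (\<Prod>p\<in>prime_factors ?C. p ^ multiplicity p ?C)"
    using prod_prime_factors[OF C0] by simp
  also have "\<dots> \<le> (\<Prod>p\<in>prime_factors ?C. n ^ 3)"
    using central_binomial_prime_power_le N by (intro prod_mono) (auto intro: order_trans)
  also have "\<dots> = (n ^ 3) ^ card (prime_factors ?C)" by simp
  also have "\<dots> \<le> (n ^ 3) ^ n\<^sup>2"
  proof (intro power_increasing)
    have "prime_factors ?C \<subseteq> {..<n\<^sup>2}" using small by blast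
    from card_mono[OF _ this] show "card (prime_factors ?C) \<le> n\<^sup>2" by simp
  qed (use n in auto)
  finally have "real ?C \<le> real ((n ^ 3) ^ n\<^sup>2)" by (rule of_nat_mono)
  hence hi: "real ?C \<le> (real n ^ 3) ^ n\<^sup>2" by simp
  have "(2 :: real) ^ N \<le> real ?C"
    using binomial_ge_n_over_k_pow_k[of N "2 * N", where ?'a = real] N by simp
  from this hi have "2 ^ N \<le> (real n ^ 3) ^ n\<^sup>2" by (rule order_trans)
  \<comment> \<open>Squaring turns \<open>2 ^ N\<close> into \<open>2 ^ (2 * N)\<close>, which
    differs from \<open>2 ^ n ^ 3\<close> by at most the factor 2 lost when halving an odd
    \<open>n ^ 3\<close>.\<close>
  hence "(2 ^ N)\<^sup>2 \<le> ((real n ^ 3) ^ n\<^sup>2)\<^sup>2" by (intro power_mono) auto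
  also have "((real n ^ 3) ^ n\<^sup>2)\<^sup>2 = (real n ^ 6) ^ n\<^sup>2"
    by (simp flip: power_mult add: mult_ac)
  finally have up: "2 ^ (2 * N) \<le> (real n ^ 6) ^ n\<^sup>2"
    by (simp flip: power_mult add: mult_ac)
  have "2 ^ n\<^sup>2 * (real n ^ 6) ^ n\<^sup>2 = (2 * real n ^ 6) ^ n\<^sup>2" by (simp add: power_mult_distrib)
  also have "\<dots> \<le> (2 ^ n) ^ n\<^sup>2" using power6_le_two_power[OF n] by (intro power_mono) auto
  also have "\<dots> = 2 ^ n ^ 3" by (simp flip: power_mult add: power2_eq_square power3_eq_cube)
  also have "\<dots> \<le> 2 ^ (2 * N + 1)" using N by (intro power_increasing) auto
  also have "\<dots> \<le> 2 * (real n ^ 6) ^ n\<^sup>2" using up by simp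
  finally have "2 ^ n\<^sup>2 \<le> (2 :: real)" using n by simp
  moreover have "(2 :: real) ^ 2 \<le> 2 ^ n\<^sup>2"
    using n by (intro power_increasing) (auto simp: power2_eq_square intro: order_trans[of 2 n])
  ultimately show False by simp
qed

lemma prime_by_trial_division:
  fixes p :: nat
  assumes "1 < p" "p < (s + 1)\<^sup>2" "\<And>d. 2 \<le> d \<Longrightarrow> d \<le> s \<Longrightarrow> \<not> d dvd p"
  shows "prime p"
  unfolding prime_nat_iff
proof (intro conjI allI impI)
  fix a assume "a dvd p"
  then obtain b where b: "p = a * b" by blast
  have small: "c = 1" if "c dvd p" "c\<^sup>2 \<le> p" for c
  proof -
    have "c\<^sup>2 < (s + 1)\<^sup>2" using that(2) assms(2) by simp
    hence "c < s + 1" by (rule power_less_imp_less_base) simp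
    moreover have "c \<noteq> 0" using that(1) assms(1) by (cases "c = 0") auto
    ultimately show ?thesis using assms(3)[of c] that(1) by (cases "c = 1") auto
  qed
  have "a\<^sup>2 \<le> p \<or> b\<^sup>2 \<le> p"
    unfolding b power2_eq_square by (cases "a \<le> b") auto
  thus "a = 1 \<or> a = p" using small[of a] small[of b] b by auto
qed (use assms in auto)

lemma prime_between_square_and_cube:
  fixes n :: nat
  assumes n: "2 \<le> n"
  shows "\<exists>p. prime p \<and> n\<^sup>2 \<le> p \<and> p \<le> n ^ 3"
proof -
  \<comment> \<open>One prime \<open>p\<close> serves every \<open>n\<close> between
    \<open>a\<close> and \<open>b\<close> as soon as \<open>b\<^sup>2 \<le> p \<le> a ^ 3\<close>;
    the primes 7, 23, 101 and 1009 cover all \<open>n\<close> below 32.\<close>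
  have range: "n\<^sup>2 \<le> p \<and> p \<le> n ^ 3" if "a \<le> n" "n \<le> b" "b\<^sup>2 \<le> p" "p \<le> a ^ 3" for a b p
    using power_mono[OF that(1), of 3] power_mono[OF that(2), of 2] that by linarith
  consider "n \<le> 2" | "3 \<le> n" "n \<le> 4" | "5 \<le> n" "n \<le> 10" | "11 \<le> n" "n \<le> 31" | "32 \<le> n"
    by linarith
  thus ?thesis
  proof cases
    case 1
    have "prime (7::nat)" by simp
    thus ?thesis using 1 n by (intro exI[of _ 7]) auto
  next
    case 2
    have "prime (23::nat)" by simp
    thus ?thesis using range[of 3 4 23] 2 by (intro exI[of _ 23]) simp
  next
    case 3
    have "prime (101::nat)" by simp
    thus ?thesis using range[of 5 10 101] 3 by (intro exI[of _ 101]) simp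
  next
    case 4
    have "prime (1009::nat)"
    proof (rule prime_by_trial_division[of _ 31])
      fix d :: nat assume "2 \<le> d" "d \<le> 31"
      hence "d \<in> set [2..<32]" unfolding set_upt by simp
      moreover have "\<forall>d\<in>set [2..<32]. \<not> d dvd (1009::nat)" by simp
      ultimately show "\<not> d dvd 1009" by (rule bspec[rotated])
    qed auto
    moreover have "n\<^sup>2 \<le> 1009 \<and> 1009 \<le> n ^ 3" using range[of 11 31 1009] 4 by simp
    ultimately show ?thesis by blast
  next
    case 5
    thus ?thesis by (rule prime_between_square_and_cube_large)
  qed
qed

subsection \<open>Polynomial hash functions\<close>

fun horner_mod :: "nat \<Rightarrow> nat list \<Rightarrow> nat \<Rightarrow> nat" where
  "horner_mod p [] x = 0"
| "horner_mod p (c # cs) x = (horner_mod p cs x * x + c) mod p"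

lemma horner_mod_less: "0 < p \<Longrightarrow> horner_mod p cs x < p"
  by (cases cs) auto

lemma horner_mod_eq_poly:
  "int (horner_mod p cs x) = poly (Poly (map int cs)) (int x) mod int p"
proof (induction cs)
  case (Cons c cs)
  have "int (horner_mod p (c # cs) x) = (int (horner_mod p cs x) * int x + int c) mod int p"
    by (simp add: zmod_int)
  also have "\<dots> = (poly (Poly (map int cs)) (int x) * int x + int c) mod int p"
    unfolding Cons by (metis mod_add_left_eq mod_mult_left_eq)
  finally show ?case by (simp add: algebra_simps)
qed simp

text \<open>A polynomial over a field has fewer roots than its degree bound allows unless it
  vanishes; here the field is the integers modulo \<open>p\<close>, and vanishing is expressed as
  divisibility by the constant \<open>p\<close>. Synthetic division splits off one root at a time.
  The alternative \<open>f = 0\<close> makes the base case \<open>K = 0\<close> trivial.\<close>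

lemma prime_dvd_poly_of_roots:
  fixes f :: "int poly" and X :: "nat set"
  assumes p: "prime p" and X: "X \<subseteq> {..<p}" "K \<le> card X"
    and f: "f = 0 \<or> Polynomial.degree f < K" and roots: "\<And>x. x \<in> X \<Longrightarrow> int p dvd poly f (int x)"
  shows "[:int p:] dvd f"
  using X f roots
proof (induction K arbitrary: f X)
  case (Suc K)
  have fin: "finite X" using Suc.prems finite_subset by blast
  have "X \<noteq> {}" using Suc.prems by auto
  then obtain c where c: "c \<in> X" by blast
  define g where "g = synthetic_div f (int c)"
  have f_eq: "f = [:- int c, 1:] * g + [:poly f (int c):]"
    unfolding g_def by (rule synthetic_div_correct'[symmetric])
  have "[:int p:] dvd g"
  proof (rule Suc.IH)
    show "X - {c} \<subseteq> {..<p}" "K \<le> card (X - {c})"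
      using Suc.prems c fin by auto
    show "g = 0 \<or> Polynomial.degree g < K"
      using Suc.prems(3) synthetic_div_eq_0_iff[of f "int c"] degree_synthetic_div[of f "int c"]
      by (auto simp: g_def)
    fix x assume x: "x \<in> X - {c}"
    have "poly f (int x) = (int x - int c) * poly g (int x) + poly f (int c)"
      by (subst f_eq) (simp add: algebra_simps)
    hence "int p dvd (int x - int c) * poly g (int x)"
      using Suc.prems(4)[of x] Suc.prems(4)[of c] x c by (simp add: dvd_add_left_iff)
    moreover have "\<not> int p dvd int x - int c"
    proof
      assume "int p dvd int x - int c"
      hence "int x mod int p = int c mod int p" by (simp add: mod_eq_dvd_iff)
      moreover have "x < p" "c < p" using x c Suc.prems(1) by auto
      ultimately show False using x by simp
    qed
    ultimately show "int p dvd poly g (int x)"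
      using p by (simp add: prime_dvd_mult_iff)
  qed
  moreover have "[:int p:] dvd [:poly f (int c):]" using Suc.prems(4)[OF c] by simp
  ultimately show ?case by (subst f_eq) (intro dvd_add dvd_mult)
qed simp

text \<open>The difference of the two polynomials has \<open>K\<close> roots modulo \<open>p\<close>
  and degree below \<open>K\<close>, so the coefficients agree modulo \<open>p\<close>; being
  smaller than \<open>p\<close>, they are equal.\<close>

lemma horner_mod_inj:
  assumes p: "prime p" and X: "X \<subseteq> {..<p}" "card X = K"
    and cs: "length cs = K" "set cs \<subseteq> {..<p}" "length cs' = K" "set cs' \<subseteq> {..<p}"
    and eq: "\<And>x. x \<in> X \<Longrightarrow> horner_mod p cs x = horner_mod p cs' x"
  shows "cs = cs'"
proof (rule nth_equalityI)
  show "length cs = length cs'" using cs by simp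
  define f where "f = Poly (map int cs) - Poly (map int cs')"
  have f: "coeff f i = (if i < K then int (cs ! i) - int (cs' ! i) else 0)" for i
    using cs by (simp add: f_def nth_default_def)
  have dvd: "[:int p:] dvd f"
  proof (rule prime_dvd_poly_of_roots[OF p X(1)])
    show "K \<le> card X" using X by simp
    show "f = 0 \<or> Polynomial.degree f < K"
    proof (cases "f = 0")
      case False
      hence "coeff f (Polynomial.degree f) \<noteq> 0" by simp
      thus ?thesis using f[of "Polynomial.degree f"] by (auto split: if_splits)
    qed simp
    fix x assume "x \<in> X"
    hence "int (horner_mod p cs x) = int (horner_mod p cs' x)" using eq by simp
    thus "int p dvd poly f (int x)"
      unfolding horner_mod_eq_poly by (simp add: f_def mod_eq_dvd_iff)
  qed
  fix i assume i: "i < length cs"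
  have "int p dvd int (cs ! i) - int (cs' ! i)"
    using dvd[unfolded const_poly_dvd_iff, rule_format, of i] f[of i] i cs(1) by simp
  hence "int (cs ! i) mod int p = int (cs' ! i) mod int p" by (simp add: mod_eq_dvd_iff)
  moreover have "cs ! i < p" "cs' ! i < p"
    using i cs subsetD[OF cs(2) nth_mem[of i cs]] subsetD[OF cs(4) nth_mem[of i cs']] by simp_all
  ultimately show "cs ! i = cs' ! i" by simp
qed

text \<open>Counting replaces interpolation: evaluation at the points of \<open>X\<close> is
  injective, and both the coefficient lists and the functions on \<open>X\<close> number
  \<open>p ^ K\<close>. A bijection carries the uniform law to the uniform law, which is the product
  law.\<close>

lemma map_pmf_horner_mod:
  assumes p: "prime p" and X: "X \<subseteq> {..<p}" "card X = K"
  shows "map_pmf (\<lambda>cs x. if x \<in> X then horner_mod p cs x else 0)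
      (pmf_of_set {cs. set cs \<subseteq> {..<p} \<and> length cs = K}) =
    Pi_pmf X 0 (\<lambda>_. pmf_of_set {..<p})"
proof -
  let ?C = "{cs. set cs \<subseteq> {..<p} \<and> length cs = K}"
  let ?\<Phi> = "\<lambda>cs x. if x \<in> X then horner_mod p cs x else 0"
  let ?F = "PiE_dflt X 0 (\<lambda>_. {..<p})"
  have p0: "0 < p" using p by (rule prime_gt_0_nat)
  have finX: "finite X" using X finite_subset by blast
  have inj: "inj_on ?\<Phi> ?C"
  proof (rule inj_onI)
    fix cs cs' assume cs: "cs \<in> ?C" "cs' \<in> ?C" and eq: "?\<Phi> cs = ?\<Phi> cs'"
    have "horner_mod p cs x = horner_mod p cs' x" if "x \<in> X" for x
      using fun_cong[OF eq, of x] that by simp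
    thus "cs = cs'" using cs by (intro horner_mod_inj[OF p X]) auto
  qed
  have "?\<Phi> ` ?C = ?F"
  proof (rule card_subset_eq)
    show "finite ?F" using finX by (intro finite_PiE_dflt) auto
    show "?\<Phi> ` ?C \<subseteq> ?F" using p0 by (auto simp: PiE_dflt_def horner_mod_less)
    have "card (?\<Phi> ` ?C) = card ?C" using inj by (rule card_image)
    also have "\<dots> = p ^ K" by (subst card_lists_length_eq) auto
    also have "\<dots> = card ?F" using finX X by (subst card_PiE_dflt) auto
    finally show "card (?\<Phi> ` ?C) = card ?F" .
  qed
  hence "bij_betw ?\<Phi> ?C ?F" using inj by (simp add: bij_betw_def)
  moreover have "finite ?C" by (rule finite_lists_length_eq) simp
  moreover have "replicate K 0 \<in> ?C" using p0 by auto
  ultimately have "map_pmf ?\<Phi> (pmf_of_set ?C) = pmf_of_set ?F"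
    by (intro map_pmf_of_set_bij_betw) blast+
  also have "\<dots> = Pi_pmf X 0 (\<lambda>_. pmf_of_set {..<p})"
    using finX p0 by (intro Pi_pmf_of_set[symmetric]) (auto simp: lessThan_empty_iff)
  finally show ?thesis .
qed

lemma indep_vars_map_pmf:
  assumes "prob_space.indep_vars (measure_pmf (map_pmf g M)) (\<lambda>_. count_space UNIV) X I"
  shows "prob_space.indep_vars (measure_pmf M) (\<lambda>_. count_space UNIV) (\<lambda>i s. X i (g s)) I"
  unfolding prob_space.indep_vars_def2[OF measure_pmf.prob_space_axioms]
    prob_space.indep_sets_def[OF measure_pmf.prob_space_axioms]
proof (intro conjI ballI allI impI)
  fix J A
  assume J: "J \<subseteq> I" "J \<noteq> {}" "finite J"
    and A: "A \<in> (\<Pi> j\<in>J. {(\<lambda>s. X j (g s)) -` B \<inter> space (measure_pmf M) |B. B \<in> sets (count_space UNIV)})"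
  hence "\<forall>j\<in>J. \<exists>B. A j = (\<lambda>s. X j (g s)) -` B" by auto
  then obtain B where B: "\<And>j. j \<in> J \<Longrightarrow> A j = (\<lambda>s. X j (g s)) -` B j" by metis
  have "measure_pmf.prob M (\<Inter>j\<in>J. A j) = measure_pmf.prob (map_pmf g M) (\<Inter>j\<in>J. X j -` B j)"
    using B by (simp add: vimage_INT vimage_def) (intro arg_cong[where f = "measure_pmf.prob M"], auto)
  also have "\<dots> = (\<Prod>j\<in>J. measure_pmf.prob (map_pmf g M) (X j -` B j))"
    using prob_space.indep_varsD[OF measure_pmf.prob_space_axioms assms J(2,3,1), of B] by simp
  also have "\<dots> = (\<Prod>j\<in>J. measure_pmf.prob M (A j))"
    using B by (intro prod.cong) (auto simp: vimage_def)
  finally show "measure_pmf.prob M (\<Inter>j\<in>J. A j) = (\<Prod>j\<in>J. measure_pmf.prob M (A j))" .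
qed auto

text \<open>The prefix \<open>hdr\<close> is there because a seed will be a whole initial memory;
  being constant, it does not influence the law of the coefficients.\<close>

lemma kwise_independent_horner_mod:
  assumes p: "prime p" "n \<le> p" and K: "K = min k n" "1 \<le> K"
  shows "kwise_independent k n p ((@) hdr ` {cs. set cs \<subseteq> {..<p} \<and> length cs = K})
    (\<lambda>s. horner_mod p (drop (length hdr) s))"
proof -
  let ?C = "{cs. set cs \<subseteq> {..<p} \<and> length cs = K}"
  let ?S = "(@) hdr ` ?C"
  let ?h = "\<lambda>s. horner_mod p (drop (length hdr) s)"
  have p0: "0 < p" using p(1) by (rule prime_gt_0_nat)
  have C: "finite ?C" "?C \<noteq> {}"
    using p0 finite_lists_length_eq[of "{..<p}" K] by (auto intro!: exI[of _ "replicate K 0"])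
  have S: "pmf_of_set ?S = map_pmf ((@) hdr) (pmf_of_set ?C)"
    using C by (intro map_pmf_of_set_inj[symmetric]) (auto simp: inj_on_def)
  \<comment> \<open>The exact law is known only for sets of exactly \<open>K\<close> points, so
    smaller sets are enlarged. Inside \<open>{..<n}\<close>, a set of at most \<open>k\<close>
    points never has more than \<open>K = min k n\<close>.\<close>
  have extend: "\<exists>Y. X \<subseteq> Y \<and> Y \<subseteq> {..<n} \<and> card Y = K" if "X \<subseteq> {..<n}" "card X \<le> K" for X
    using exists_subset_between[of X K "{..<n}"] that K by simp
  have law: "map_pmf (\<lambda>s x. if x \<in> Y then ?h s x else 0) (pmf_of_set ?S) =
      Pi_pmf Y 0 (\<lambda>_. pmf_of_set {..<p})" if "Y \<subseteq> {..<n}" "card Y = K" for Y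
  proof -
    have "Y \<subseteq> {..<p}" using that(1) p(2) by auto
    from map_pmf_horner_mod[OF p(1) this that(2)] show ?thesis
      by (simp add: S pmf.map_comp o_def cong del: if_weak_cong)
  qed
  show ?thesis
    unfolding kwise_independent_def
  proof (intro conjI allI impI)
    fix x assume x: "x < n"
    then obtain Y where Y: "{x} \<subseteq> Y" "Y \<subseteq> {..<n}" "card Y = K" using extend[of "{x}"] K by auto
    have finY: "finite Y" using Y finite_subset by blast
    have "map_pmf (\<lambda>s. ?h s x) (pmf_of_set ?S) =
        map_pmf (\<lambda>f. f x) (map_pmf (\<lambda>s x. if x \<in> Y then ?h s x else 0) (pmf_of_set ?S))"
      using Y by (simp add: pmf.map_comp o_def)
    also have "\<dots> = pmf_of_set {..<p}"
      unfolding law[OF Y(2,3)] using Y finY by (subst Pi_pmf_component) auto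
    finally show "map_pmf (\<lambda>s. ?h s x) (pmf_of_set ?S) = pmf_of_set {..<p}" .
  next
    fix X assume X: "X \<subseteq> {..<n} \<and> card X \<le> k"
    hence "card X \<le> K" using K card_mono[of "{..<n}" X] by auto
    then obtain Y where Y: "X \<subseteq> Y" "Y \<subseteq> {..<n}" "card Y = K" using extend[of X] X by auto
    have finY: "finite Y" using Y finite_subset by blast
    have "prob_space.indep_vars (measure_pmf (Pi_pmf Y 0 (\<lambda>_. pmf_of_set {..<p})))
        (\<lambda>_. count_space UNIV) (\<lambda>x f. f x) Y"
      by (rule indep_vars_Pi_pmf[OF finY])
    from indep_vars_map_pmf[OF this[folded law[OF Y(2,3)]]]
    have "prob_space.indep_vars (measure_pmf (pmf_of_set ?S))
        (\<lambda>_. count_space UNIV) (\<lambda>x s. if x \<in> Y then ?h s x else 0) Y" .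
    from prob_space.indep_vars_subset[OF measure_pmf.prob_space_axioms this Y(1)]
    have "prob_space.indep_vars (measure_pmf (pmf_of_set ?S))
        (\<lambda>_. count_space UNIV) (\<lambda>x s. if x \<in> Y then ?h s x else 0) X" .
    also have "?this \<longleftrightarrow> prob_space.indep_vars (measure_pmf (pmf_of_set ?S))
        (\<lambda>_. count_space UNIV) (\<lambda>x s. ?h s x) X"
      using Y(1) by (intro prob_space.indep_vars_cong[OF measure_pmf.prob_space_axioms]) auto
    finally show "prob_space.indep_vars (measure_pmf (pmf_of_set ?S))
        (\<lambda>_. count_space UNIV) (\<lambda>x s. ?h s x) X" .
  qed (use C p0 in auto)
qed

subsection \<open>The program\<close>

text \<open>
  Cells: 0 modulus, 1 end of the coefficients, 2 and 3 the item \<open>(u, v)\<close>, 4 and 5 the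
  hash values of \<open>u\<close> and \<open>v\<close>, 6 index, 7 and 8 the constants 10 and 1, 9 the current coefficient;
  the coefficients start at cell 10. Both polynomials are evaluated in one Horner loop.
\<close>

definition cwei1_program :: "instr list" where
  "cwei1_program =
    [ReadFst 2, ReadSnd 3, SetConst 4 0, SetConst 5 0, SetConst 6 0, Arith Add 6 6 1,
     JumpLe 6 7 16, Arith Sub 6 6 8, Load 9 6,
     Arith Mul 4 4 2, Arith Add 4 4 9, Arith Mod 4 4 0,
     Arith Mul 5 5 3, Arith Add 5 5 9, Arith Mod 5 5 0, JumpLe 8 8 6,
     JumpLe 4 5 19, Clear 2, JumpLe 8 8 20, Clear 3]"

lemma length_program: "length cwei1_program = 20"
  by (simp add: cwei1_program_def)

lemma program_nth:
  "cwei1_program ! 0 = ReadFst 2" "cwei1_program ! Suc 0 = ReadSnd 3" "cwei1_program ! 2 = SetConst 4 0"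
  "cwei1_program ! 3 = SetConst 5 0" "cwei1_program ! 4 = SetConst 6 0" "cwei1_program ! 5 = Arith Add 6 6 1"
  "cwei1_program ! 6 = JumpLe 6 7 16" "cwei1_program ! 7 = Arith Sub 6 6 8" "cwei1_program ! 8 = Load 9 6"
  "cwei1_program ! 9 = Arith Mul 4 4 2" "cwei1_program ! 10 = Arith Add 4 4 9" "cwei1_program ! 11 = Arith Mod 4 4 0"
  "cwei1_program ! 12 = Arith Mul 5 5 3" "cwei1_program ! 13 = Arith Add 5 5 9" "cwei1_program ! 14 = Arith Mod 5 5 0"
  "cwei1_program ! 15 = JumpLe 8 8 6" "cwei1_program ! 16 = JumpLe 4 5 19" "cwei1_program ! 17 = Clear 2"
  "cwei1_program ! 18 = JumpLe 8 8 20" "cwei1_program ! 19 = Clear 3"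
  by (simp_all add: cwei1_program_def)

definition layout ::
  "nat \<Rightarrow> nat \<Rightarrow> nat \<Rightarrow> nat \<Rightarrow> nat \<Rightarrow> nat \<Rightarrow> nat \<Rightarrow> nat \<Rightarrow> nat list \<Rightarrow> nat list" where
  "layout p e u v a b i c cs = [p, e, u, v, a, b, i, 10, 1, c] @ cs"

lemma rd_layout:
  "rd (layout p e u v a b i c cs) 0 = p"
  "rd (layout p e u v a b i c cs) (Suc 0) = e"
  "rd (layout p e u v a b i c cs) 2 = u"
  "rd (layout p e u v a b i c cs) 3 = v"
  "rd (layout p e u v a b i c cs) 4 = a"
  "rd (layout p e u v a b i c cs) 5 = b"
  "rd (layout p e u v a b i c cs) 6 = i"
  "rd (layout p e u v a b i c cs) 7 = 10"
  "rd (layout p e u v a b i c cs) 8 = 1"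
  "rd (layout p e u v a b i c cs) 9 = c"
  by (simp_all add: layout_def rd_def)

lemma rd_layout_coeff:
  "j < length cs \<Longrightarrow> rd (layout p e u v a b i c cs) (10 + j) = cs ! j"
  by (simp add: layout_def rd_def nth_append numeral_eq_Suc)

lemma wr_layout:
  "wr w (layout p e u v a b i c cs) 2 x = layout p e (x mod 2 ^ w) v a b i c cs"
  "wr w (layout p e u v a b i c cs) 3 x = layout p e u (x mod 2 ^ w) a b i c cs"
  "wr w (layout p e u v a b i c cs) 4 x = layout p e u v (x mod 2 ^ w) b i c cs"
  "wr w (layout p e u v a b i c cs) 5 x = layout p e u v a (x mod 2 ^ w) i c cs"
  "wr w (layout p e u v a b i c cs) 6 x = layout p e u v a b (x mod 2 ^ w) c cs"
  "wr w (layout p e u v a b i c cs) 9 x = layout p e u v a b i (x mod 2 ^ w) cs"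
  by (simp_all add: layout_def wr_def numeral_eq_Suc)

lemma funpow_2: "(f ^^ 2) s = f (f s)"
  and funpow_3: "(f ^^ 3) s = f (f (f s))"
  and funpow_6: "(f ^^ 6) s = f (f (f (f (f (f s)))))"
  and funpow_10: "(f ^^ 10) s = f (f (f (f (f (f (f (f (f (f s)))))))))"
  by (simp_all add: numeral_eq_Suc)

context
  fixes w n p :: nat and cs :: "nat list"
  assumes p: "0 < p" and cs: "set cs \<subseteq> {..<p}"
    and word: "n < 2 ^ w" "p * n + p \<le> 2 ^ w" "10 + length cs < 2 ^ w"
begin

lemma horner_body:
  assumes uv: "u < n" "v < n" and j: "j < length cs" and ab: "a < p" "b < p"
  shows "(ram_step w cwei1_program item ^^ 10) (6, layout p e u v a b (10 + Suc j) c cs, A) =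
    (6, layout p e u v ((a * u + cs ! j) mod p) ((b * v + cs ! j) mod p) (10 + j) (cs ! j) cs, A)"
proof -
  have c: "cs ! j < p" using subsetD[OF cs nth_mem[OF j]] by simp
  \<comment> \<open>Every intermediate value, in particular a product plus a coefficient before its
    reduction, fits into a word, so the truncation in \<open>wr\<close> never takes effect.\<close>
  have bound: "x * y + cs ! j < 2 ^ w" if "x < p" "y < n" for x y
  proof -
    have "x * y \<le> p * n" using that by (intro mult_mono) auto
    thus ?thesis using c word(2) by linarith
  qed
  have prod: "x * y < 2 ^ w" if "x < p" "y < n" for x y
    using bound[OF that] by linarith
  have "p \<le> 2 ^ w" using word(2) by linarith
  hence "x mod p < 2 ^ w" for x using mod_less_divisor[OF p, of x] by linarith
  moreover have "cs ! j < 2 ^ w" using c \<open>p \<le> 2 ^ w\<close> by linarith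
  moreover have "10 + j < 2 ^ w" using word(3) j by linarith
  ultimately show ?thesis
    using bound[OF ab(1) uv(1)] bound[OF ab(2) uv(2)] prod[OF ab(1) uv(1)] prod[OF ab(2) uv(2)] j
    unfolding funpow_10
    by (simp add: ram_step_def length_program program_nth rd_layout wr_layout rd_layout_coeff)
qed

text \<open>The coefficients are read from the highest address downwards, as Horner's rule demands;
  the cells 4 and 5 hold the values of the suffix \<open>drop j cs\<close> read so far. Each pass
  costs ten steps, and one more step is the final exit test.\<close>

lemma horner_loop:
  assumes uv: "u < n" "v < n" and j: "j \<le> length cs"
  shows "\<exists>c'. (ram_step w cwei1_program item ^^ (10 * j + 1))
      (6, layout p e u v (horner_mod p (drop j cs) u) (horner_mod p (drop j cs) v) (10 + j) c cs, A) =
    (16, layout p e u v (horner_mod p cs u) (horner_mod p cs v) 10 c' cs, A)"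
  using j
proof (induction j arbitrary: c)
  case 0
  show ?case
    by (intro exI[of _ c]) (simp add: ram_step_def length_program program_nth rd_layout)
next
  case (Suc j)
  let ?f = "ram_step w cwei1_program item"
  let ?s = "\<lambda>j c. (6, layout p e u v (horner_mod p (drop j cs) u) (horner_mod p (drop j cs) v) (10 + j) c cs, A)"
  have drop: "drop j cs = cs ! j # drop (Suc j) cs"
    using Suc.prems by (simp add: Cons_nth_drop_Suc)
  have "(?f ^^ 10) (?s (Suc j) c) = ?s j (cs ! j)"
    unfolding drop horner_mod.simps
    using uv Suc.prems p by (intro horner_body) (auto simp: horner_mod_less)
  moreover have "(?f ^^ (10 * Suc j + 1)) (?s (Suc j) c) = (?f ^^ (10 * j + 1)) ((?f ^^ 10) (?s (Suc j) c))"
    by (simp only: funpow_add[symmetric] comp_apply[symmetric, of "?f ^^ (10 * j + 1)"])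
      (simp add: algebra_simps)
  ultimately show ?case using Suc.IH[of "cs ! j"] Suc.prems by simp
qed

lemma process_item:
  assumes uv: "u < n" "v < n"
  shows "\<exists>t\<le>10 * length cs + 10. \<exists>a' b' i' c'.
    (ram_step w cwei1_program (u, v) ^^ t) (0, layout p (10 + length cs) u0 v0 a b i c cs, A) =
    (20, layout p (10 + length cs) u v a' b' i' c' cs, cwei1_step (horner_mod p cs) (u, v) A)"
proof -
  let ?f = "ram_step w cwei1_program (u, v)"
  let ?e = "10 + length cs"
  let ?hu = "horner_mod p cs u" and ?hv = "horner_mod p cs v"
  have "u < 2 ^ w" "v < 2 ^ w" using uv word(1) by linarith+
  \<comment> \<open>The index starts at the end address: cell 6 is cleared and cell 1 is added to
    it, which amounts to a copy.\<close>
  hence init: "(?f ^^ 6) (0, layout p ?e u0 v0 a b i c cs, A) = (6, layout p ?e u v 0 0 ?e c cs, A)"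
    using word(3) unfolding funpow_6
    by (simp add: ram_step_def length_program program_nth rd_layout wr_layout flip: numeral_2_eq_2)
  have "\<exists>c'. (?f ^^ (10 * length cs + 1)) (6, layout p ?e u v 0 0 ?e c cs, A) =
      (16, layout p ?e u v ?hu ?hv 10 c' cs, A)"
    using horner_loop[OF uv order_refl, of "(u, v)" ?e c A] by simp
  then obtain c' where loop: "(?f ^^ (10 * length cs + 1)) (6, layout p ?e u v 0 0 ?e c cs, A) =
      (16, layout p ?e u v ?hu ?hv 10 c' cs, A)"
    by blast
  \<comment> \<open>If \<open>v\<close> is cleared, the branch is a jump and a \<open>Clear\<close>;
    if \<open>u\<close> is cleared, it is a failed test, a \<open>Clear\<close> and the
    unconditional jump \<open>JumpLe 8 8 20\<close>. With 6 initial steps this gives at most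
    \<open>10 * length cs + 10\<close>.\<close>
  define t where "t = (if ?hu \<le> ?hv then 2 else 3 :: nat)"
  have final: "(?f ^^ t) (16, layout p ?e u v ?hu ?hv 10 c' cs, A) =
      (20, layout p ?e u v ?hu ?hv 10 c' cs, cwei1_step (horner_mod p cs) (u, v) A)"
    by (simp add: t_def funpow_2 funpow_3 ram_step_def length_program program_nth rd_layout)
  have add: "(?f ^^ (t + N + 6)) x = (?f ^^ t) ((?f ^^ N) ((?f ^^ 6) x))" for N x
    by (simp only: funpow_add comp_apply)
  have "(?f ^^ (t + (10 * length cs + 1) + 6)) (0, layout p ?e u0 v0 a b i c cs, A) =
      (20, layout p ?e u v ?hu ?hv 10 c' cs, cwei1_step (horner_mod p cs) (u, v) A)"
    unfolding add init loop final ..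
  moreover have "t + (10 * length cs + 1) + 6 \<le> 10 * length cs + 10" by (simp add: t_def)
  ultimately show ?thesis by blast
qed

text \<open>The scratch cells are arbitrary, since each item starts with the contents left behind by
  its predecessor.\<close>

lemma process_stream:
  assumes "\<And>u v. (u, v) \<in> set es \<Longrightarrow> u < n \<and> v < n"
  shows "\<exists>mem'. ram_stream w cwei1_program (10 * length cs + 10) es
    (layout p (10 + length cs) u0 v0 a b i c cs, A) (mem', fold (cwei1_step (horner_mod p cs)) es A)"
  using assms
proof (induction es arbitrary: u0 v0 a b i c A)
  case (Cons x es)
  obtain u v where x: "x = (u, v)" by (cases x)
  have uv: "u < n" "v < n" using Cons.prems[of u v] x by auto
  obtain t a' b' i' c' where t: "t \<le> 10 * length cs + 10"
    "(ram_step w cwei1_program (u, v) ^^ t) (0, layout p (10 + length cs) u0 v0 a b i c cs, A) =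
      (20, layout p (10 + length cs) u v a' b' i' c' cs, cwei1_step (horner_mod p cs) (u, v) A)"
    using process_item[OF uv] by blast
  obtain mem' where "ram_stream w cwei1_program (10 * length cs + 10) es
      (layout p (10 + length cs) u v a' b' i' c' cs, cwei1_step (horner_mod p cs) (u, v) A)
      (mem', fold (cwei1_step (horner_mod p cs)) es (cwei1_step (horner_mod p cs) (u, v) A))"
    using Cons.IH Cons.prems by (meson list.set_intros(2))
  thus ?case using t unfolding x ram_stream.simps(2) fold_simps length_program by blast
qed simp

end

text \<open>The ten fixed cells of \<open>layout\<close> with all scratch cells zero. The constants
  10 and 1 are part of the seed because comparison and arithmetic take only memory cells as
  operands.\<close>

definition seed_header :: "nat \<Rightarrow> nat \<Rightarrow> nat list" where
  "seed_header p K = [p, 10 + K, 0, 0, 0, 0, 0, 10, 1, 0]"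

lemma implements_program:
  assumes p: "0 < p" and n: "0 < n" and word: "n < 2 ^ w" "p * n + p \<le> 2 ^ w" "10 + K < 2 ^ w"
  shows "implements_cwei1 cwei1_program w (10 + K) (10 * K + 10) n
    ((@) (seed_header p K) ` {cs. set cs \<subseteq> {..<p} \<and> length cs = K})
    (\<lambda>s. horner_mod p (drop (length (seed_header p K)) s))"
  unfolding implements_cwei1_def
proof (intro conjI ballI allI impI)
  fix s assume s: "s \<in> (@) (seed_header p K) ` {cs. set cs \<subseteq> {..<p} \<and> length cs = K}"
  then obtain cs where cs: "s = seed_header p K @ cs" "set cs \<subseteq> {..<p}" "length cs = K" by blast
  show "length s = 10 + K" using cs by (simp add: seed_header_def)
  have "1 * p < p * n + p" using p n by simp
  hence "p < 2 ^ w" using word(2) by linarith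
  show "x < 2 ^ w" if "x \<in> set s" for x
    using that cs word(3) \<open>p < 2 ^ w\<close> by (auto simp: seed_header_def)
next
  fix E es s
  assume E: "simple_graph n E \<and> edge_stream E es"
    and "s \<in> (@) (seed_header p K) ` {cs. set cs \<subseteq> {..<p} \<and> length cs = K}"
  then obtain cs where cs: "s = seed_header p K @ cs" "set cs \<subseteq> {..<p}" "length cs = K" by blast
  have "u < n \<and> v < n" if "(u, v) \<in> set es" for u v
  proof -
    have "{u, v} \<in> E" using E that by (auto simp: edge_stream_def edges_of_def)
    thus ?thesis using E by (auto simp: simple_graph_def nsets_def)
  qed
  hence "\<exists>mem'. ram_stream w cwei1_program (10 * length cs + 10) es
      (layout p (10 + length cs) 0 0 0 0 0 0 cs, replicate n True)
      (mem', fold (cwei1_step (horner_mod p cs)) es (replicate n True))"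
    using p cs word by (intro process_stream) auto
  thus "\<exists>mem'. ram_stream w cwei1_program (10 * K + 10) es (s, replicate n True)
      (mem', cwei1 (horner_mod p (drop (length (seed_header p K)) s)) n es)"
    using cs by (simp add: cwei1_def layout_def seed_header_def)
qed

subsection \<open>Limited against full independence\<close>

definition depends_on :: "'a set \<Rightarrow> (('a \<Rightarrow> 'b) \<Rightarrow> real) \<Rightarrow> bool" where
  "depends_on X F \<longleftrightarrow> (\<forall>h h'. (\<forall>x\<in>X. h x = h' x) \<longrightarrow> F h = F h')"

lemma depends_onD: "depends_on X F \<Longrightarrow> (\<And>x. x \<in> X \<Longrightarrow> h x = h' x) \<Longrightarrow> F h = F h'"
  by (auto simp: depends_on_def)

lemma depends_on_mono: "depends_on X F \<Longrightarrow> X \<subseteq> Y \<Longrightarrow> depends_on Y F"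
  unfolding depends_on_def by blast

lemma depends_on_mult: "depends_on X F \<Longrightarrow> depends_on X G \<Longrightarrow> depends_on X (\<lambda>h. F h * G h)"
  unfolding depends_on_def by metis

lemma depends_on_sum:
  "(\<And>j. j \<in> J \<Longrightarrow> depends_on X (F j)) \<Longrightarrow> depends_on X (\<lambda>h. \<Sum>j\<in>J. F j h)"
  unfolding depends_on_def by (auto intro!: sum.cong)

lemma depends_on_prod:
  "(\<And>j. j \<in> J \<Longrightarrow> depends_on X (F j)) \<Longrightarrow> depends_on X (\<lambda>h. \<Prod>j\<in>J. F j h)"
  unfolding depends_on_def by (auto intro!: prod.cong)

lemma depends_on_coord: "a \<in> X \<Longrightarrow> depends_on X (\<lambda>h. f (h a))"
  unfolding depends_on_def by metis

lemma depends_on_const: "depends_on X (\<lambda>h. c)"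
  by (simp add: depends_on_def)

text \<open>Sums of functions of at most \<open>k\<close> coordinates each, the analogue of
  polynomials of degree at most \<open>k\<close>. \<open>k\<close>-wise independence determines
  their expectations by linearity.\<close>

inductive low_degree :: "'a set \<Rightarrow> nat \<Rightarrow> (('a \<Rightarrow> 'b) \<Rightarrow> real) \<Rightarrow> bool" for I k where
  junta: "X \<subseteq> I \<Longrightarrow> card X \<le> k \<Longrightarrow> depends_on X F \<Longrightarrow> low_degree I k F"
| plus: "low_degree I k F \<Longrightarrow> low_degree I k G \<Longrightarrow> low_degree I k (\<lambda>h. F h + G h)"

lemma low_degree_mono: "low_degree I j F \<Longrightarrow> j \<le> k \<Longrightarrow> low_degree I k F"
  by (induction rule: low_degree.induct) (auto intro: low_degree.intros order_trans)

lemma low_degree_const: "low_degree I k (\<lambda>h. c)"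
  by (rule junta[of "{}"]) (auto simp: depends_on_const)

lemma low_degree_mult:
  assumes "low_degree I j F" "low_degree I k G"
  shows "low_degree I (j + k) (\<lambda>h. F h * G h)"
  using assms
proof (induction rule: low_degree.induct)
  case (junta X F)
  from junta(4) show ?case
  proof (induction rule: low_degree.induct)
    case (junta Y G)
    show ?case
    proof (rule low_degree.junta)
      show "card (X \<union> Y) \<le> j + k"
        using card_Un_le[of X Y] junta \<open>card X \<le> j\<close> by linarith
      show "depends_on (X \<union> Y) (\<lambda>h. F h * G h)"
        using junta \<open>depends_on X F\<close> by (intro depends_on_mult) (auto intro: depends_on_mono)
    qed (use junta \<open>X \<subseteq> I\<close> in auto)
  next
    case (plus G1 G2)
    thus ?case by (simp add: ring_distribs low_degree.plus)
  qed
next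
  case (plus F1 F2)
  thus ?case by (simp add: ring_distribs low_degree.plus)
qed

lemma low_degree_cmult: "low_degree I k F \<Longrightarrow> low_degree I k (\<lambda>h. c * F h)"
  using low_degree_mult[OF low_degree_const[of I 0 c]] by simp

lemma low_degree_sum:
  assumes "\<And>j. j \<in> J \<Longrightarrow> low_degree I k (F j)"
  shows "low_degree I k (\<lambda>h. \<Sum>j\<in>J. F j h)"
proof (cases "finite J")
  case True
  thus ?thesis using assms
    by (induction J) (auto intro: low_degree_const low_degree.plus)
qed (auto intro: low_degree_const)

lemma low_degree_prod:
  assumes "finite J" "\<And>j. j \<in> J \<Longrightarrow> low_degree I k (F j)"
  shows "low_degree I (card J * k) (\<lambda>h. \<Prod>j\<in>J. F j h)"
  using assms by (induction J) (auto intro: low_degree_const low_degree_mult)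

section \<open>Inequalities for truncated inclusion-exclusion and for block splitting\<close>

lemma esym_le_power:
  fixes p :: "'a \<Rightarrow> real"
  assumes "finite A" "\<And>a. a \<in> A \<Longrightarrow> 0 \<le> p a"
  shows "(\<Sum>J | J \<subseteq> A \<and> card J = r. \<Prod>a\<in>J. p a) \<le> (\<Sum>a\<in>A. p a) ^ r / fact r"
  using assms
proof (induction A arbitrary: r)
  case empty
  have "{J. J = {} \<and> card J = r} = (if r = 0 then {{}} else {}::'a set set)" by auto
  thus ?case by simp
next
  case (insert x A)
  show ?case
  proof (cases r)
    case 0
    have "{J. J \<subseteq> insert x A \<and> card J = r} = {{}}"
      using 0 insert(1) by (auto dest!: finite_subset)
    thus ?thesis using 0 by simp
  next
    case (Suc s)
    let ?\<mu> = "\<Sum>a\<in>A. p a"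
    have \<mu>: "0 \<le> ?\<mu>" and px: "0 \<le> p x" using insert by (auto intro: sum_nonneg)
    have split: "{J. J \<subseteq> insert x A \<and> card J = r} =
        {J. J \<subseteq> A \<and> card J = r} \<union> insert x ` {J. J \<subseteq> A \<and> card J = s}"
      (is "?L = ?R")
    proof
      show "?R \<subseteq> ?L"
        using insert Suc by (auto simp: card_insert_if finite_subset)
      show "?L \<subseteq> ?R"
      proof
        fix J assume J: "J \<in> ?L"
        show "J \<in> ?R"
        proof (cases "x \<in> J")
          case True
          hence "J = insert x (J - {x})" "J - {x} \<subseteq> A" "card (J - {x}) = s"
            using J Suc by (auto simp: card_Diff_singleton)
          thus ?thesis by blast
        qed (use J in auto)
      qed
    qed
    have inj: "inj_on (insert x) {J. J \<subseteq> A \<and> card J = s}"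
      using insert(2) by (intro inj_onI) (metis (mono_tags, lifting) insert_ident mem_Collect_eq subsetD)
    have "(\<Sum>J | J \<subseteq> insert x A \<and> card J = r. \<Prod>a\<in>J. p a) =
        (\<Sum>J | J \<subseteq> A \<and> card J = r. \<Prod>a\<in>J. p a) +
        (\<Sum>J\<in>insert x ` {J. J \<subseteq> A \<and> card J = s}. \<Prod>a\<in>J. p a)"
      unfolding split using insert by (intro sum.union_disjoint) auto
    also have "(\<Sum>J\<in>insert x ` {J. J \<subseteq> A \<and> card J = s}. \<Prod>a\<in>J. p a) =
        (\<Sum>J | J \<subseteq> A \<and> card J = s. p x * (\<Prod>a\<in>J. p a))"
      unfolding sum.reindex[OF inj] o_def
    proof (intro sum.cong refl)
      fix J assume "J \<in> {J. J \<subseteq> A \<and> card J = s}"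
      thus "prod p (insert x J) = p x * prod p J"
        using insert finite_subset[of J A] by (subst prod.insert) auto
    qed
    also have "\<dots> = p x * (\<Sum>J | J \<subseteq> A \<and> card J = s. \<Prod>a\<in>J. p a)"
      by (simp add: sum_distrib_left)
    also have "(\<Sum>J | J \<subseteq> A \<and> card J = r. \<Prod>a\<in>J. p a) + \<dots> \<le>
        ?\<mu> ^ r / fact r + p x * (?\<mu> ^ s / fact s)"
      using insert px by (intro add_mono mult_left_mono) auto
    also have "\<dots> = (?\<mu> ^ r + real r * p x * ?\<mu> ^ s) / fact r"
      using Suc by (simp add: field_simps del: of_nat_Suc)
    also have "\<dots> \<le> (p x + ?\<mu>) ^ r / fact r"
    proof (intro divide_right_mono)
      \<comment> \<open>Splitting the subsets by membership of \<open>x\<close> yields precisely the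
        first two terms of the binomial expansion of \<open>(p x + ?\<mu>) ^ r\<close>; the
        remaining terms are nonnegative.\<close>
      have "(\<Sum>i\<in>{0, 1}. real (r choose i) * p x ^ i * ?\<mu> ^ (r - i)) \<le>
          (\<Sum>i\<le>r. real (r choose i) * p x ^ i * ?\<mu> ^ (r - i))"
        using Suc \<mu> px by (intro sum_mono2) auto
      moreover have "(\<Sum>i\<in>{0, 1}. real (r choose i) * p x ^ i * ?\<mu> ^ (r - i)) =
          ?\<mu> ^ r + real r * p x * ?\<mu> ^ s"
        using Suc by simp
      ultimately show "?\<mu> ^ r + real r * p x * ?\<mu> ^ s \<le> (p x + ?\<mu>) ^ r"
        by (simp only: binomial_ring)
    qed auto
    finally show ?thesis using insert by simp
  qed
qed

text \<open>Bonferroni's inequality. For \<open>z = Suc y\<close> the partial alternating sum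
  telescopes to a binomial coefficient of \<open>y\<close>, up to sign, by Pascal's rule.\<close>

lemma alternating_choose_error:
  "\<bar>of_bool (z = 0) - (\<Sum>j<r. (-1) ^ j * real (z choose j))\<bar> \<le> real (z choose r)"
proof (cases r)
  case (Suc s)
  show ?thesis
  proof (cases z)
    case 0
    have "(\<Sum>j<r. (-1) ^ j * real (0 choose j)) = 1"
      unfolding Suc by (induction s) auto
    thus ?thesis using 0 by simp
  next
    case z: (Suc y)
    have "(\<Sum>j<Suc s. (-1) ^ j * real (Suc y choose j)) = (-1) ^ s * real (y choose s)"
      by (induction s) (auto simp: algebra_simps)
    moreover have "real (y choose s) \<le> real (Suc y choose Suc s)" by simp
    ultimately show ?thesis using Suc z by (simp add: abs_mult)
  qed
qed auto

text \<open>A weak form of Stirling's formula: the left side divided by \<open>fact n\<close> is a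
  single term of the series of \<open>exp n\<close>.\<close>

lemma power_self_le_fact: "real n ^ n \<le> 3 ^ n * fact n"
proof -
  have "real n ^ n / fact n \<le> (\<Sum>i. real n ^ i /\<^sub>R fact i)"
    using sum_le_suminf[OF summable_exp_generic[of "real n"], of "{n}"]
    by (simp add: divide_inverse mult_ac)
  also have "\<dots> = exp (real n)" by (simp add: exp_def)
  also have "\<dots> = exp 1 ^ n" using exp_of_nat_mult[of n "1 :: real"] by simp
  also have "\<dots> \<le> 3 ^ n" using exp_le by (intro power_mono) auto
  finally show ?thesis by (simp add: field_simps)
qed

text \<open>Elements are added one by one; the first sum to reach \<open>s\<close> overshoots by at
  most the last summand.\<close>

lemma subset_with_sum_between:
  fixes p :: "'a \<Rightarrow> real"
  assumes "finite A" "\<And>a. a \<in> A \<Longrightarrow> 0 \<le> p a \<and> p a \<le> 1" "0 \<le> s" "s \<le> sum p A"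
  shows "\<exists>B\<subseteq>A. s \<le> sum p B \<and> sum p B \<le> s + 1"
  using assms
proof (induction A)
  case (insert x A)
  show ?case
  proof (cases "s \<le> sum p A")
    case True
    thus ?thesis using insert by blast
  next
    case False
    have "p x \<le> 1" using insert by blast
    hence "sum p (insert x A) \<le> s + 1" using False insert.hyps by simp
    thus ?thesis using insert by blast
  qed
qed auto

text \<open>Greedy choice: each block uses up at most \<open>s + 1\<close> of the total, so a total
  of \<open>r * (s + 1)\<close> suffices for \<open>r\<close> blocks.\<close>

lemma disjoint_blocks:
  fixes p :: "'a \<Rightarrow> real"
  assumes "finite A" "\<And>a. a \<in> A \<Longrightarrow> 0 \<le> p a \<and> p a \<le> 1" "0 \<le> s"
    "real r * (s + 1) \<le> sum p A"
  shows "\<exists>B. (\<forall>i<r. B i \<subseteq> A \<and> s \<le> sum p (B i)) \<and> disjoint_family_on B {..<r}"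
  using assms
proof (induction r arbitrary: A)
  case 0
  thus ?case by (auto simp: disjoint_family_on_def)
next
  case (Suc r)
  have "0 \<le> real r * (s + 1)" "real (Suc r) * (s + 1) = s + 1 + real r * (s + 1)"
    using Suc by (auto simp: algebra_simps)
  hence "s \<le> sum p A" using Suc by linarith
  then obtain C where C: "C \<subseteq> A" "s \<le> sum p C" "sum p C \<le> s + 1"
    using subset_with_sum_between[of A p s] Suc.prems by metis
  have "sum p (A - C) = sum p A - sum p C"
    using C Suc by (simp add: sum_diff)
  hence "real r * (s + 1) \<le> sum p (A - C)"
    using C Suc by (simp add: algebra_simps)
  then obtain B where B: "\<forall>i<r. B i \<subseteq> A - C \<and> s \<le> sum p (B i)" "disjoint_family_on B {..<r}"
    using Suc.IH[of "A - C"] Suc.prems by auto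
  show ?case
  proof (intro exI[of _ "B(r := C)"] conjI)
    show "\<forall>i<Suc r. (B(r := C)) i \<subseteq> A \<and> s \<le> sum p ((B(r := C)) i)"
      using B(1) C by (simp add: less_Suc_eq) blast
    show "disjoint_family_on (B(r := C)) {..<Suc r}"
    proof (unfold disjoint_family_on_def, intro ballI impI)
      fix i j assume ij: "i \<in> {..<Suc r}" "j \<in> {..<Suc r}" "i \<noteq> j"
      have sub: "B l \<inter> C = {}" if "l < r" for l using B(1) that by blast
      have dis: "B i \<inter> B j = {}" if "i < r" "j < r"
        using B(2) ij that by (simp add: disjoint_family_on_def)
      show "(B(r := C)) i \<inter> (B(r := C)) j = {}"
        using ij dis sub[of i] sub[of j] by (auto simp: less_Suc_eq)
    qed
  qed
qed

section \<open>Comparison of a limited law with an independent one\<close>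

abbreviation expect :: "'a pmf \<Rightarrow> ('a \<Rightarrow> real) \<Rightarrow> real" where
  "expect q F \<equiv> measure_pmf.expectation q F"

text \<open>\<open>q\<close> is the law under limited independence, \<open>u\<close> the fully
  independent reference. Only two properties are retained: agreement on functions of at most
  \<open>k\<close> coordinates, and multiplicativity of \<open>u\<close> over disjoint sets of
  coordinates. Finite supports dispose of all integrability conditions.\<close>

locale kwise_agree =
  fixes I :: "'a set" and q u :: "('a \<Rightarrow> 'b) pmf" and k :: nat
  assumes finite_I: "finite I"
    and finite_q: "finite (set_pmf q)"
    and finite_u: "finite (set_pmf u)"
    and agree_junta:
      "X \<subseteq> I \<Longrightarrow> card X \<le> k \<Longrightarrow> depends_on X F \<Longrightarrow> expect q F = expect u F"
    and u_mult: "X \<subseteq> I \<Longrightarrow> Y \<subseteq> I \<Longrightarrow> X \<inter> Y = {} \<Longrightarrow> depends_on X F \<Longrightarrow> depends_on Y G \<Longrightarrow>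
      expect u (\<lambda>h. F h * G h) = expect u F * expect u G"
begin

text \<open>The reference law is a special case of a limited law, so the bounds proved for
  \<open>q\<close> apply to \<open>u\<close> as well.\<close>

lemma kwise_agree_self: "kwise_agree I u u j"
  using finite_I finite_u u_mult by unfold_locales auto

lemma integrable_q [simp, intro]: "integrable (measure_pmf q) (F :: _ \<Rightarrow> real)"
  by (rule integrable_measure_pmf_finite[OF finite_q])

lemma integrable_u [simp, intro]: "integrable (measure_pmf u) (F :: _ \<Rightarrow> real)"
  by (rule integrable_measure_pmf_finite[OF finite_u])

lemma agree_low_degree: "low_degree I k F \<Longrightarrow> expect q F = expect u F"
proof (induction rule: low_degree.induct)
  case (junta X F)
  thus ?case using agree_junta by blast
next
  case (plus F G)
  thus ?case by (simp add: Bochner_Integration.integral_add)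
qed

lemma expect_u_prod:
  assumes "finite J" "\<And>j. j \<in> J \<Longrightarrow> X j \<subseteq> I" "disjoint_family_on X J"
    "\<And>j. j \<in> J \<Longrightarrow> depends_on (X j) (F j)"
  shows "expect u (\<lambda>h. \<Prod>j\<in>J. F j h) = (\<Prod>j\<in>J. expect u (F j))"
  using assms
proof (induction J)
  case (insert i J)
  have "expect u (\<lambda>h. F i h * (\<Prod>j\<in>J. F j h)) = expect u (F i) * expect u (\<lambda>h. \<Prod>j\<in>J. F j h)"
  proof (rule u_mult[of "X i" "\<Union>j\<in>J. X j"])
    show "X i \<inter> (\<Union>j\<in>J. X j) = {}"
      using insert.hyps insert.prems(2) by (fastforce simp: disjoint_family_on_def)
    show "depends_on (\<Union>j\<in>J. X j) (\<lambda>h. \<Prod>j\<in>J. F j h)"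
      by (rule depends_on_prod, rule depends_on_mono[OF insert.prems(3)]) auto
    show "X i \<subseteq> I" "(\<Union>j\<in>J. X j) \<subseteq> I"
      using insert.prems(1) by auto
    show "depends_on (X i) (F i)" by (rule insert.prems(3)) auto
  qed
  moreover have "disjoint_family_on X J"
    using insert.prems(2) by (auto simp: disjoint_family_on_def)
  moreover have "expect u (\<lambda>h. \<Prod>j\<in>J. F j h) = (\<Prod>j\<in>J. expect u (F j))"
    using insert.IH insert.prems calculation by (simp add: disjoint_family_on_def)
  ultimately show ?case using insert.hyps by simp
qed simp

lemma expect_nonneg: "(\<And>h. 0 \<le> F h) \<Longrightarrow> 0 \<le> expect p F"
  by (rule integral_nonneg_AE) auto

end

text \<open>In the application \<open>A\<close> consists of neighbours, \<open>B a\<close> of the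
  values by which the neighbour \<open>a\<close> destroys minimality, and \<open>V\<close> of the
  one or two vertices whose values are prescribed by the indicator \<open>G\<close>. As
  \<open>G\<close> reads at most two coordinates, it raises degrees by at most 2.\<close>

locale hits = kwise_agree I q u k
  for I :: "'a set" and q u :: "('a \<Rightarrow> 'b) pmf" and k :: nat +
  fixes A :: "'a set" and B :: "'a \<Rightarrow> 'b set" and V :: "'a set" and G :: "('a \<Rightarrow> 'b) \<Rightarrow> real"
  assumes A: "A \<subseteq> I" and V: "V \<subseteq> I" "V \<inter> A = {}" "card V \<le> 2"
    and G: "depends_on V G" "\<And>h. 0 \<le> G h"
begin

definition hit :: "'a \<Rightarrow> ('a \<Rightarrow> 'b) \<Rightarrow> real" where
  "hit a h = of_bool (h a \<in> B a)"

definition hitp :: "'a \<Rightarrow> real" where "hitp a = expect u (hit a)"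

definition mean :: real where "mean = (\<Sum>a\<in>A. hitp a)"

definition miss :: "('a \<Rightarrow> 'b) \<Rightarrow> real" where "miss h = of_bool (\<forall>a\<in>A. h a \<notin> B a)"

definition count :: "('a \<Rightarrow> 'b) \<Rightarrow> nat" where "count h = card {a \<in> A. h a \<in> B a}"

lemma finite_A: "finite A"
  using A finite_I finite_subset by blast

lemma hit_01: "0 \<le> hit a h" "hit a h \<le> 1"
  by (auto simp: hit_def)

lemma hitp_01: "0 \<le> hitp a" "hitp a \<le> 1"
  unfolding hitp_def
  by (auto intro!: expect_nonneg hit_01 measure_pmf.integral_le_const simp: hit_01)

lemma depends_hit: "a \<in> X \<Longrightarrow> depends_on X (hit a)"
  unfolding hit_def by (rule depends_on_coord)

text \<open>Both sides count the \<open>j\<close>-subsets of \<open>A\<close> that are hit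
  completely. The right side exhibits this as a function of degree \<open>j\<close>.\<close>

lemma choose_count:
  "real (count h choose j) = (\<Sum>J | J \<subseteq> A \<and> card J = j. \<Prod>a\<in>J. hit a h)"
proof -
  let ?H = "{a \<in> A. h a \<in> B a}"
  have "(\<Sum>J | J \<subseteq> A \<and> card J = j. \<Prod>a\<in>J. hit a h) =
      (\<Sum>J | J \<subseteq> A \<and> card J = j. of_bool (J \<subseteq> ?H))"
  proof (intro sum.cong refl)
    fix J assume J: "J \<in> {J. J \<subseteq> A \<and> card J = j}"
    hence "finite J" using finite_A finite_subset by blast
    show "(\<Prod>a\<in>J. hit a h) = of_bool (J \<subseteq> ?H)"
    proof (cases "J \<subseteq> ?H")
      case True
      hence "(\<Prod>a\<in>J. hit a h) = (\<Prod>a\<in>J. 1)"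
        by (intro prod.cong) (auto simp: hit_def)
      thus ?thesis using True by simp
    next
      case False
      then obtain a where "a \<in> J" "hit a h = 0" using J by (auto simp: hit_def)
      hence "(\<Prod>a\<in>J. hit a h) = 0"
        using \<open>finite J\<close> by (intro prod_zero) blast+
      thus ?thesis using False by simp
    qed
  qed
  also have "\<dots> = real (card ({J. J \<subseteq> A \<and> card J = j} \<inter> {J. J \<subseteq> ?H}))"
    using finite_A by (simp add: sum_of_bool_eq)
  also have "{J. J \<subseteq> A \<and> card J = j} \<inter> {J. J \<subseteq> ?H} = {J. J \<subseteq> ?H \<and> card J = j}" by auto
  also have "card \<dots> = count h choose j"
    unfolding count_def using finite_A by (intro n_subsets) auto
  finally show ?thesis by simp
qed

lemma miss_count: "miss h = of_bool (count h = 0)"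
  using finite_A by (auto simp: miss_def count_def)

lemma low_degree_G: "low_degree I 2 G"
  using V G by (intro low_degree.junta)

lemma low_degree_choose: "low_degree I j (\<lambda>h. real (count h choose j))"
  unfolding choose_count
proof (rule low_degree_sum)
  fix J assume "J \<in> {J. J \<subseteq> A \<and> card J = j}"
  thus "low_degree I j (\<lambda>h. \<Prod>a\<in>J. hit a h)"
    using A by (intro low_degree.junta[of J] depends_on_prod depends_hit) auto
qed

lemma expect_choose_le:
  "expect u (\<lambda>h. real (count h choose j)) \<le> mean ^ j / fact j"
proof -
  have "expect u (\<lambda>h. real (count h choose j)) =
      (\<Sum>J | J \<subseteq> A \<and> card J = j. expect u (\<lambda>h. \<Prod>a\<in>J. hit a h))"
    unfolding choose_count by (rule Bochner_Integration.integral_sum) auto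
  also have "\<dots> = (\<Sum>J | J \<subseteq> A \<and> card J = j. \<Prod>a\<in>J. hitp a)"
  proof (intro sum.cong refl)
    fix J assume J: "J \<in> {J. J \<subseteq> A \<and> card J = j}"
    show "expect u (\<lambda>h. \<Prod>a\<in>J. hit a h) = (\<Prod>a\<in>J. hitp a)"
      unfolding hitp_def using J A finite_A
      by (intro expect_u_prod[where X = "\<lambda>a. {a}"])
        (auto simp: disjoint_family_on_def intro: finite_subset depends_hit)
  qed
  also have "\<dots> \<le> mean ^ j / fact j"
    unfolding mean_def using finite_A hitp_01 by (intro esym_le_power) auto
  finally show ?thesis .
qed

lemma expect_u_G_mult:
  assumes "depends_on A F"
  shows "expect u (\<lambda>h. G h * F h) = expect u G * expect u F"
  using assms V A G by (intro u_mult[of V A]) auto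

lemma depends_choose: "depends_on A (\<lambda>h. real (count h choose j))"
  unfolding choose_count by (intro depends_on_sum depends_on_prod depends_hit) auto

lemma depends_miss: "depends_on A miss"
  unfolding depends_on_def miss_def by (auto simp: of_bool_def)

text \<open>The truncated alternating sum has degree below \<open>r\<close>, so with the weight both
  laws give it the same expectation. What remains are two truncation errors, one for each law; both
  are bounded by the expectation of the same binomial coefficient, on which the laws agree as
  well.\<close>

lemma bonferroni_error:
  assumes "r + 2 \<le> k"
  shows "\<bar>expect q (\<lambda>h. G h * miss h) - expect u (\<lambda>h. G h * miss h)\<bar>
    \<le> expect u G * (2 * mean ^ r / fact r)"
proof -
  define P where "P h = (\<Sum>j<r. (-1) ^ j * real (count h choose j))" for h
  have agree: "expect q (\<lambda>h. G h * F h) = expect u (\<lambda>h. G h * F h)" if "low_degree I r F" for F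
  proof -
    have "low_degree I (2 + r) (\<lambda>h. G h * F h)"
      by (intro low_degree_mult low_degree_G that)
    thus ?thesis using assms by (intro agree_low_degree) (auto elim: low_degree_mono)
  qed
  have lowP: "low_degree I r P"
    unfolding P_def
    by (intro low_degree_sum low_degree_cmult low_degree_mono[OF low_degree_choose]) auto
  have C: "expect u (\<lambda>h. G h * real (count h choose r)) \<le> expect u G * (mean ^ r / fact r)"
    unfolding expect_u_G_mult[OF depends_choose]
    using G by (intro mult_left_mono expect_choose_le expect_nonneg)
  have pt: "\<bar>G h * miss h - G h * P h\<bar> \<le> G h * real (count h choose r)" for h
  proof -
    have "\<bar>G h * miss h - G h * P h\<bar> = G h * \<bar>miss h - P h\<bar>"
      using G(2)[of h] by (simp add: abs_mult flip: right_diff_distrib)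
    also have "\<dots> \<le> G h * real (count h choose r)"
      unfolding miss_count P_def using G(2)[of h]
      by (intro mult_left_mono alternating_choose_error)
    finally show ?thesis .
  qed
  have err: "\<bar>expect p (\<lambda>h. G h * miss h) - expect p (\<lambda>h. G h * P h)\<bar>
      \<le> expect p (\<lambda>h. G h * real (count h choose r))" if fin: "finite (set_pmf p)" for p
  proof -
    have int: "integrable (measure_pmf p) F" for F :: "_ \<Rightarrow> real"
      using fin by (rule integrable_measure_pmf_finite)
    have "\<bar>expect p (\<lambda>h. G h * miss h) - expect p (\<lambda>h. G h * P h)\<bar> =
        \<bar>expect p (\<lambda>h. G h * miss h - G h * P h)\<bar>"
      by (subst Bochner_Integration.integral_diff) (auto intro: int)
    also have "\<dots> \<le> expect p (\<lambda>h. \<bar>G h * miss h - G h * P h\<bar>)"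
      by (rule integral_abs_bound)
    also have "\<dots> \<le> expect p (\<lambda>h. G h * real (count h choose r))"
      by (intro integral_mono int pt)
    finally show ?thesis .
  qed
  have "expect q (\<lambda>h. G h * P h) = expect u (\<lambda>h. G h * P h)"
    by (rule agree[OF lowP])
  moreover have "expect q (\<lambda>h. G h * real (count h choose r)) =
      expect u (\<lambda>h. G h * real (count h choose r))"
    by (rule agree[OF low_degree_choose])
  ultimately have "\<bar>expect q (\<lambda>h. G h * miss h) - expect u (\<lambda>h. G h * miss h)\<bar>
      \<le> 2 * expect u (\<lambda>h. G h * real (count h choose r))"
    using err[OF finite_q] err[OF finite_u] by linarith
  also have "\<dots> \<le> 2 * (expect u G * (mean ^ r / fact r))"
    using C by simp
  finally show ?thesis by (simp add: mult_ac)
qed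

text \<open>Independence removes the mixed terms, and the variance of an indicator is at most its
  mean.\<close>

lemma variance_block:
  assumes "C \<subseteq> A"
  shows "expect u (\<lambda>h. (\<Sum>a\<in>C. hit a h - hitp a)\<^sup>2) \<le> (\<Sum>a\<in>C. hitp a)"
proof -
  have C: "finite C" "C \<subseteq> I" using assms finite_A A finite_subset by auto
  have "expect u (\<lambda>h. (\<Sum>a\<in>C. hit a h - hitp a)\<^sup>2) =
      expect u (\<lambda>h. \<Sum>a\<in>C. \<Sum>b\<in>C. (hit a h - hitp a) * (hit b h - hitp b))"
    by (simp add: power2_eq_square sum_product)
  also have "\<dots> = (\<Sum>a\<in>C. \<Sum>b\<in>C. expect u (\<lambda>h. (hit a h - hitp a) * (hit b h - hitp b)))"
    by (simp add: Bochner_Integration.integral_sum)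
  also have "\<dots> = (\<Sum>a\<in>C. \<Sum>b\<in>C. if b = a then expect u (\<lambda>h. (hit a h - hitp a)\<^sup>2) else 0)"
  proof (intro sum.cong refl)
    fix a b assume ab: "a \<in> C" "b \<in> C"
    show "expect u (\<lambda>h. (hit a h - hitp a) * (hit b h - hitp b)) =
        (if b = a then expect u (\<lambda>h. (hit a h - hitp a)\<^sup>2) else 0)"
    proof (cases "a = b")
      case False
      have "expect u (\<lambda>h. (hit a h - hitp a) * (hit b h - hitp b)) =
          expect u (\<lambda>h. hit a h - hitp a) * expect u (\<lambda>h. hit b h - hitp b)"
        using ab C False unfolding hit_def
        by (intro u_mult[of "{a}" "{b}"]) (auto simp: depends_on_def)
      thus ?thesis using False by (simp add: hitp_def)
    qed (simp add: power2_eq_square)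
  qed
  also have "\<dots> = (\<Sum>a\<in>C. expect u (\<lambda>h. (hit a h - hitp a)\<^sup>2))"
    using C by simp
  also have "\<dots> \<le> (\<Sum>a\<in>C. hitp a)"
  proof (intro sum_mono)
    fix a
    have "(\<lambda>h. (hit a h - hitp a)\<^sup>2) = (\<lambda>h. hit a h - 2 * hitp a * hit a h + (hitp a)\<^sup>2)"
      by (auto simp: hit_def power2_eq_square algebra_simps fun_eq_iff)
    hence "expect u (\<lambda>h. (hit a h - hitp a)\<^sup>2) = hitp a - 2 * hitp a * hitp a + (hitp a)\<^sup>2"
      by (simp add: hitp_def)
    also have "\<dots> \<le> hitp a" by (simp add: power2_eq_square)
    finally show "expect u (\<lambda>h. (hit a h - hitp a)\<^sup>2) \<le> hitp a" .
  qed
  finally show ?thesis .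
qed

text \<open>
  Missing all of \<open>A\<close> forces each of \<open>r\<close> disjoint blocks to deviate from its mean by the full
  mean; the product of the normalised squared deviations has degree only \<open>2 * r\<close>.
\<close>

lemma tail_bound:
  assumes "2 * r + 2 \<le> k" "0 < r" "2 * real r \<le> mean"
  shows "expect q (\<lambda>h. G h * miss h) \<le> expect u G * (2 * real r / mean) ^ r"
proof -
  \<comment> \<open>Blocks of sum at least \<open>s\<close> need
    \<open>r * (s + 1) = mean / 2 + r\<close> in total, which is available because
    \<open>mean\<close> is at least \<open>2 * r\<close>.\<close>
  define s where "s = mean / (2 * real r)"
  have s: "1 \<le> s" using assms by (simp add: s_def field_simps)
  have "real r * (s + 1) = mean / 2 + real r" using assms by (simp add: s_def field_simps)
  hence "real r * (s + 1) \<le> (\<Sum>a\<in>A. hitp a)" using assms by (simp add: mean_def)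
  then obtain C where C: "\<And>i. i < r \<Longrightarrow> C i \<subseteq> A \<and> s \<le> (\<Sum>a\<in>C i. hitp a)"
    and disj: "disjoint_family_on C {..<r}"
    using disjoint_blocks[of A hitp s r] finite_A hitp_01 s by auto
  define M where "M i = (\<Sum>a\<in>C i. hitp a)" for i
  have M: "s \<le> M i" "0 < M i" if "i < r" for i using C[OF that] s by (auto simp: M_def)
  define Q where "Q i h = (\<Sum>a\<in>C i. hit a h - hitp a)\<^sup>2 / (M i)\<^sup>2" for i h
  have Q0: "0 \<le> Q i h" for i h by (simp add: Q_def)
  have lowQ: "low_degree I 2 (Q i)" if i: "i < r" for i
  proof -
    have "low_degree I 1 (\<lambda>h. \<Sum>a\<in>C i. hit a h - hitp a)"
      using C[OF i] A unfolding hit_def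
      by (intro low_degree_sum low_degree.junta[of "{_}"]) (auto simp: depends_on_def)
    from low_degree_cmult[OF low_degree_mult[OF this this], of "1 / (M i)\<^sup>2"]
    show ?thesis by (simp add: Q_def[abs_def] power2_eq_square eval_nat_numeral)
  qed
  have depQ: "depends_on (C i) (Q i)" for i
    unfolding depends_on_def Q_def hit_def by (auto intro!: sum.cong)
  have "expect q (\<lambda>h. G h * miss h) \<le> expect q (\<lambda>h. G h * (\<Prod>i<r. Q i h))"
  proof (intro integral_mono integrable_q mult_left_mono G)
    fix h
    show "miss h \<le> (\<Prod>i<r. Q i h)"
    proof (cases "\<forall>a\<in>A. h a \<notin> B a")
      case True
      have "Q i h = 1" if i: "i < r" for i
      proof -
        have "(\<Sum>a\<in>C i. hit a h - hitp a) = (\<Sum>a\<in>C i. - hitp a)"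
          using C[OF i] True by (intro sum.cong) (auto simp: hit_def)
        thus ?thesis using M[OF i] by (simp add: Q_def M_def sum_negf)
      qed
      thus ?thesis using True by (simp add: miss_def)
    qed (auto simp: miss_def intro!: prod_nonneg Q0)
  qed
  also have "\<dots> = expect u (\<lambda>h. G h * (\<Prod>i<r. Q i h))"
  proof (rule agree_low_degree)
    have "low_degree I (2 + card {..<r} * 2) (\<lambda>h. G h * (\<Prod>i<r. Q i h))"
      using lowQ by (intro low_degree_mult low_degree_prod low_degree_G) auto
    thus "low_degree I k (\<lambda>h. G h * (\<Prod>i<r. Q i h))"
      using assms by (auto elim: low_degree_mono)
  qed
  also have "\<dots> = expect u G * expect u (\<lambda>h. \<Prod>i<r. Q i h)"
    using C depQ by (intro expect_u_G_mult depends_on_prod) (blast intro: depends_on_mono)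
  also have "expect u (\<lambda>h. \<Prod>i<r. Q i h) = (\<Prod>i<r. expect u (Q i))"
    using C A disj by (intro expect_u_prod[where X = C] depQ) auto
  also have "expect u G * \<dots> \<le> expect u G * (\<Prod>i<r. 2 * real r / mean)"
  proof (intro mult_left_mono prod_mono conjI expect_nonneg Q0 G)
    fix i assume "i \<in> {..<r}"
    hence i: "i < r" by simp
    \<comment> \<open>Variance over squared mean is at most one over the mean, as in Chebyshev's
      inequality.\<close>
    have "expect u (Q i) \<le> M i / (M i)\<^sup>2"
      unfolding Q_def using C[OF i] variance_block[of "C i"]
      by (auto intro: divide_right_mono simp: M_def)
    also have "\<dots> = 1 / M i" using M[OF i] by (simp add: power2_eq_square)
    also have "\<dots> \<le> 1 / s" using M[OF i] s by (intro divide_left_mono) auto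
    also have "\<dots> = 2 * real r / mean" by (simp add: s_def)
    finally show "expect u (Q i) \<le> 2 * real r / mean" .
  qed
  finally show ?thesis by simp
qed

text \<open>Inclusion-exclusion for \<open>mean\<close> up to \<open>4 * r\<close>, where the last
  factor is 1, and the block bound beyond. The exponent 4 is chosen so that for two vertices the
  factor splits into two squares, each summable over the value of one vertex.\<close>

lemma miss_error:
  assumes "4 \<le> r" "32 * r + 2 \<le> k"
  shows "\<bar>expect q (\<lambda>h. G h * miss h) - expect u (\<lambda>h. G h * miss h)\<bar>
    \<le> expect u G * (2 * (1 / 2) ^ r * (4 * real r / max (4 * real r) mean) ^ 4)"
proof (cases "mean \<le> 4 * real r")
  case True
  \<comment> \<open>Truncation after \<open>32 * r\<close> terms makes the base
    \<open>4 * r * 3 / R\<close> equal to \<open>3 / 8\<close>, where the 3 comes from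
    \<open>power_self_le_fact\<close>.\<close>
  define R where "R = 32 * r"
  have "0 \<le> mean" unfolding mean_def by (intro sum_nonneg hitp_01)
  hence "mean ^ R / fact R \<le> (4 * real r) ^ R / fact R"
    using True by (intro divide_right_mono power_mono) auto
  also have "\<dots> \<le> (4 * real r) ^ R * (3 ^ R / real R ^ R)"
  proof -
    have "0 < real R ^ R" using assms by (simp add: R_def)
    hence "1 / fact R \<le> 3 ^ R / real R ^ R"
      using power_self_le_fact[of R] by (simp add: field_simps)
    from mult_left_mono[OF this, of "(4 * real r) ^ R"] show ?thesis by simp
  qed
  also have "\<dots> = (4 * real r * 3 / real R) ^ R"
    by (simp only: power_divide power_mult_distrib times_divide_eq_right)
  also have "\<dots> = (3 / 8) ^ R" using assms by (simp add: R_def)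
  also have "\<dots> \<le> (1 / 2) ^ R" by (intro power_mono) auto
  also have "\<dots> \<le> (1 / 2) ^ r" by (intro power_decreasing) (auto simp: R_def)
  finally have "expect u G * (2 * mean ^ R / fact R) \<le> expect u G * (2 * (1 / 2) ^ r)"
    using G by (intro mult_left_mono expect_nonneg) auto
  moreover have "4 * real r / max (4 * real r) mean = 1" using True assms by simp
  ultimately show ?thesis
    using bonferroni_error[of R] assms by (simp add: R_def)
next
  case False
  \<comment> \<open>In this regime both expectations are small, so each law is bounded on its own
    and no cancellation is used.\<close>
  interpret self: hits I u u k A B V G
    using kwise_agree_self[of k] A V G unfolding hits_def hits_axioms_def by blast
  have mean_eq: "self.mean = mean" and miss_eq: "self.miss = miss"
    by (simp_all add: self.mean_def mean_def self.hitp_def hitp_def self.hit_def hit_def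
        self.miss_def miss_def fun_eq_iff)
  have "2 * real r \<le> mean" "0 < r" "2 * r + 2 \<le> k" using False assms by auto
  hence "expect q (\<lambda>h. G h * miss h) \<le> expect u G * (2 * real r / mean) ^ r"
    "expect u (\<lambda>h. G h * miss h) \<le> expect u G * (2 * real r / mean) ^ r"
    using tail_bound[of r] self.tail_bound[of r] mean_eq miss_eq by auto
  moreover have "0 \<le> expect q (\<lambda>h. G h * miss h)" "0 \<le> expect u (\<lambda>h. G h * miss h)"
    using G by (auto intro!: expect_nonneg simp: miss_def)
  ultimately have "\<bar>expect q (\<lambda>h. G h * miss h) - expect u (\<lambda>h. G h * miss h)\<bar>
      \<le> expect u G * (2 * real r / mean) ^ r"
    by linarith
  \<comment> \<open>One half of the base pays for \<open>(1 / 2) ^ r\<close>; the rest is at most 1,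
    so its exponent may be lowered from \<open>r\<close> to 4.\<close>
  also have "2 * real r / mean = (1 / 2) * (4 * real r / mean)" by simp
  also have "((1 / 2) * (4 * real r / mean)) ^ r = (1 / 2) ^ r * (4 * real r / mean) ^ r"
    by (rule power_mult_distrib)
  also have "\<dots> \<le> (2 * (1 / 2) ^ r) * (4 * real r / mean) ^ 4"
    using False assms by (intro mult_mono power_decreasing) auto
  also have "mean = max (4 * real r) mean" using False by simp
  finally show ?thesis using G by (simp add: mult_left_mono expect_nonneg)
qed

end

section \<open>Hash families as laws on functions\<close>

definition uniform_hash :: "nat \<Rightarrow> nat \<Rightarrow> (nat \<Rightarrow> nat) pmf" where
  "uniform_hash n m = Pi_pmf {..<n} 0 (\<lambda>_. pmf_of_set {..<m})"

text \<open>Values outside \<open>{..<n}\<close> are set to 0, the default of the product law, since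
  a hash family is unconstrained there.\<close>

definition hash_law :: "nat \<Rightarrow> 's set \<Rightarrow> ('s \<Rightarrow> nat \<Rightarrow> nat) \<Rightarrow> (nat \<Rightarrow> nat) pmf" where
  "hash_law n S h = map_pmf (\<lambda>s x. if x < n then h s x else 0) (pmf_of_set S)"

lemma finite_uniform_hash: "0 < m \<Longrightarrow> finite (set_pmf (uniform_hash n m))"
  unfolding uniform_hash_def
  by (rule finite_subset[OF set_Pi_pmf_subset'])
    (auto intro!: finite_PiE_dflt simp: lessThan_empty_iff)

lemma expect_pair_pmf:
  assumes "finite (set_pmf p)" "finite (set_pmf p')"
  shows "expect (pair_pmf p p') (\<lambda>(x, y). F x * G y) = expect p F * expect p' G"
proof -
  have "expect (pair_pmf p p') (\<lambda>(x, y). F x * G y) =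
      (\<Sum>z\<in>set_pmf p \<times> set_pmf p'. (case z of (x, y) \<Rightarrow> F x * G y) * pmf (pair_pmf p p') z)"
    using assms by (subst integral_measure_pmf[of "set_pmf p \<times> set_pmf p'"]) (auto simp: mult_ac)
  also have "\<dots> = (\<Sum>x\<in>set_pmf p. \<Sum>y\<in>set_pmf p'. (pmf p x * F x) * (pmf p' y * G y))"
    unfolding sum.cartesian_product by (intro sum.cong) (auto simp: pmf_pair)
  also have "\<dots> = (\<Sum>x\<in>set_pmf p. pmf p x * F x) * (\<Sum>y\<in>set_pmf p'. pmf p' y * G y)"
    by (simp add: sum_product)
  also have "\<dots> = expect p F * expect p' G"
    using assms by (simp add: integral_measure_pmf[of "set_pmf p"] integral_measure_pmf[of "set_pmf p'"])
  finally show ?thesis .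
qed

text \<open>The product law is an independent pair of its parts on \<open>X\<close> and on the
  complement of \<open>X\<close>; \<open>F\<close> reads only the first part and \<open>G\<close>
  only the second.\<close>

lemma uniform_hash_mult:
  assumes "0 < m" "X \<subseteq> {..<n}" "Y \<subseteq> {..<n}" "X \<inter> Y = {}" "depends_on X F" "depends_on Y G"
  shows "expect (uniform_hash n m) (\<lambda>h. F h * G h) =
    expect (uniform_hash n m) F * expect (uniform_hash n m) G"
proof -
  let ?p = "\<lambda>_::nat. pmf_of_set {..<m}"
  let ?Y = "{..<n} - X"
  let ?P = "Pi_pmf X 0 ?p" and ?Q = "Pi_pmf ?Y 0 ?p"
  let ?c = "\<lambda>fg x. if x \<in> X then fst fg x else snd fg x :: nat"
  have finX: "finite X" using assms(2) finite_subset by blast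
  have "X \<union> ?Y = {..<n}" using assms(2) by auto
  hence eq: "uniform_hash n m = map_pmf ?c (pair_pmf ?P ?Q)"
    unfolding uniform_hash_def using Pi_pmf_union[of X ?Y 0 ?p] finX by (auto simp: case_prod_beta')
  have fin: "finite (set_pmf (Pi_pmf Z 0 ?p))" if "finite Z" for Z
    using that assms(1)
    by (intro finite_subset[OF set_Pi_pmf_subset'[OF that]])
      (auto intro!: finite_PiE_dflt simp: lessThan_empty_iff)
  have F: "F (?c fg) = F (fst fg)" for fg
    by (rule depends_onD[OF assms(5)]) auto
  have G: "G (?c fg) = G (snd fg)" for fg
    by (rule depends_onD[OF assms(6)]) (use assms(4) in auto)
  have "expect (uniform_hash n m) (\<lambda>h. F h * G h) =
      expect (pair_pmf ?P ?Q) (\<lambda>(f, g). F f * G g)"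
    unfolding eq integral_map_pmf F G by (simp only: case_prod_beta')
  also have "\<dots> = expect ?P F * expect ?Q G"
    using fin finX by (intro expect_pair_pmf) auto
  also have "expect ?P F = expect (map_pmf fst (pair_pmf ?P ?Q)) F"
    by (simp only: map_fst_pair_pmf)
  also have "\<dots> = expect (uniform_hash n m) F"
    unfolding eq integral_map_pmf F ..
  also have "expect ?Q G = expect (map_pmf snd (pair_pmf ?P ?Q)) G"
    by (simp only: map_snd_pair_pmf)
  also have "\<dots> = expect (uniform_hash n m) G"
    unfolding eq integral_map_pmf G ..
  finally show ?thesis .
qed

lemma restricted_law:
  assumes kw: "kwise_independent k n m S h" and X: "X \<subseteq> {..<n}" "card X \<le> k"
  shows "map_pmf (\<lambda>s x. if x \<in> X then h s x else 0) (pmf_of_set S) =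
    Pi_pmf X 0 (\<lambda>_. pmf_of_set {..<m})"
proof (rule pmf_eqI)
  fix f :: "nat \<Rightarrow> nat"
  let ?M = "measure_pmf (pmf_of_set S)"
  have finX: "finite X" using X finite_subset by blast
  have indep: "prob_space.indep_vars ?M (\<lambda>_. count_space UNIV) (\<lambda>x s. h s x) X"
    and law: "\<And>x. x < n \<Longrightarrow> map_pmf (\<lambda>s. h s x) (pmf_of_set S) = pmf_of_set {..<m}"
    using kw X by (auto simp: kwise_independent_def)
  show "pmf (map_pmf (\<lambda>s x. if x \<in> X then h s x else 0) (pmf_of_set S)) f =
      pmf (Pi_pmf X 0 (\<lambda>_. pmf_of_set {..<m})) f"
  proof (cases "\<forall>x. x \<notin> X \<longrightarrow> f x = 0")
    case True
    have "pmf (map_pmf (\<lambda>s x. if x \<in> X then h s x else 0) (pmf_of_set S)) f =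
        measure_pmf.prob (pmf_of_set S) {s. \<forall>x\<in>X. h s x = f x}"
      using True by (simp add: pmf_map vimage_def fun_eq_iff)
        (intro arg_cong[where f = "measure_pmf.prob _"], auto)
    also have "\<dots> = (\<Prod>x\<in>X. pmf (pmf_of_set {..<m}) (f x))"
    proof (cases "X = {}")
      case False
      have "{s. \<forall>x\<in>X. h s x = f x} = (\<Inter>x\<in>X. (\<lambda>s. h s x) -` {f x} \<inter> space ?M)"
        using False by auto
      hence "measure_pmf.prob (pmf_of_set S) {s. \<forall>x\<in>X. h s x = f x} =
          (\<Prod>x\<in>X. measure_pmf.prob (pmf_of_set S) ((\<lambda>s. h s x) -` {f x} \<inter> space ?M))"
        using prob_space.indep_varsD[OF measure_pmf.prob_space_axioms indep False finX] by simp
      also have "\<dots> = (\<Prod>x\<in>X. pmf (map_pmf (\<lambda>s. h s x) (pmf_of_set S)) (f x))"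
        by (simp add: pmf_map)
      also have "\<dots> = (\<Prod>x\<in>X. pmf (pmf_of_set {..<m}) (f x))"
        using law X by (intro prod.cong) auto
      finally show ?thesis .
    qed simp
    also have "\<dots> = pmf (Pi_pmf X 0 (\<lambda>_. pmf_of_set {..<m})) f"
      using True finX by (simp add: pmf_Pi')
    finally show ?thesis .
  next
    case False
    hence "f \<notin> set_pmf (map_pmf (\<lambda>s x. if x \<in> X then h s x else 0) (pmf_of_set S))"
      by auto
    hence "pmf (map_pmf (\<lambda>s x. if x \<in> X then h s x else 0) (pmf_of_set S)) f = 0"
      by (simp only: set_pmf_iff not_not)
    thus ?thesis using False finX by (auto simp: pmf_Pi)
  qed
qed

text \<open>A function of the coordinates in \<open>X\<close> factors through restriction to
  \<open>X\<close>, and under both laws this restriction has the same product law.\<close>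

lemma kwise_agree_hash_law:
  assumes kw: "kwise_independent k n m S h"
  shows "kwise_agree {..<n} (hash_law n S h) (uniform_hash n m) k"
proof
  have m: "0 < m" and S: "finite S" "S \<noteq> {}" using kw by (auto simp: kwise_independent_def)
  show "finite (set_pmf (hash_law n S h))" using S by (simp add: hash_law_def)
  show "finite (set_pmf (uniform_hash n m))" using m by (rule finite_uniform_hash)
  fix X and F :: "(nat \<Rightarrow> nat) \<Rightarrow> real" assume X: "X \<subseteq> {..<n}"
  {
    assume "card X \<le> k" "depends_on X F"
    let ?r = "\<lambda>f x. if x \<in> X then f x else 0 :: nat"
    have F: "F h = F (?r h)" for h
      by (rule depends_onD[OF \<open>depends_on X F\<close>]) auto
    have "map_pmf ?r (hash_law n S h) =
        map_pmf (\<lambda>s x. if x \<in> X then h s x else 0) (pmf_of_set S)"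
      using X unfolding hash_law_def by (auto simp: pmf.map_comp o_def fun_eq_iff intro!: map_pmf_cong)
    also have "\<dots> = Pi_pmf X 0 (\<lambda>_. pmf_of_set {..<m})"
      using restricted_law[OF kw X \<open>card X \<le> k\<close>] .
    also have "\<dots> = map_pmf ?r (uniform_hash n m)"
      unfolding uniform_hash_def using X by (intro Pi_pmf_subset) auto
    finally have "expect (map_pmf ?r (hash_law n S h)) F = expect (map_pmf ?r (uniform_hash n m)) F"
      by simp
    thus "expect (hash_law n S h) F = expect (uniform_hash n m) F"
      by (simp add: F[symmetric])
  }
  show "expect (uniform_hash n m) (\<lambda>h. F h * G h) =
      expect (uniform_hash n m) F * expect (uniform_hash n m) G"
    if "Y \<subseteq> {..<n}" "X \<inter> Y = {}" "depends_on X F" "depends_on Y G" for Y G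
    using uniform_hash_mult[OF m X that] .
qed auto

lemma uniform_hash_prob:
  assumes "0 < m" "x < n"
  shows "expect (uniform_hash n m) (\<lambda>h. of_bool (h x \<in> B)) = real (card (B \<inter> {..<m})) / real m"
proof -
  have "expect (uniform_hash n m) (\<lambda>h. of_bool (h x \<in> B)) =
      expect (map_pmf (\<lambda>h. h x) (uniform_hash n m)) (\<lambda>t. of_bool (t \<in> B))"
    by simp
  also have "map_pmf (\<lambda>h. h x) (uniform_hash n m) = pmf_of_set {..<m}"
    unfolding uniform_hash_def using assms by (subst Pi_pmf_component) auto
  also have "expect (pmf_of_set {..<m}) (\<lambda>t. of_bool (t \<in> B)) = real (card (B \<inter> {..<m})) / real m"
    using assms by (subst integral_pmf_of_set) (auto simp: lessThan_empty_iff sum_of_bool_eq Int_commute)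
  finally show ?thesis .
qed

section \<open>Summation over the hash value of the vertex\<close>

definition decay :: "real \<Rightarrow> real \<Rightarrow> real" where
  "decay L y = (L / max L y)\<^sup>2"

lemma decay_nonneg: "0 \<le> decay L y"
  by (simp add: decay_def)

text \<open>Up to \<open>q = L * m / d\<close> the summands are 1, beyond that they fall like
  \<open>q\<^sup>2 / t\<^sup>2\<close>, so the sum is of order \<open>q\<close> and the average of
  order \<open>L / d\<close>. This is where an additive error becomes a relative one. The maximum in
  \<open>decay\<close> makes its value at \<open>t = 0\<close> equal to 1.\<close>

lemma sum_decay:
  assumes L: "1 \<le> L" and d: "1 \<le> d" "d \<le> m"
  shows "(\<Sum>t<m. decay L (real d * real t / real m)) / real m \<le> 12 * L / (real d + 1)"
proof -
  define q where "q = L * real m / real d"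
  have "1 * real d \<le> L * real m" using assms by (intro mult_mono) auto
  hence q: "1 \<le> q" using d by (simp add: q_def field_simps)
  have bound: "decay L (real d * real t / real m) \<le> 6 * q\<^sup>2 * (1 / (q + real t) - 1 / (q + real (Suc t)))"
    for t
  proof -
    have pos: "0 < max q (real t)" using q by auto
    have "L / max L (real d * real t / real m) = q / max q (real t)"
      using assms by (simp add: q_def max_def field_simps)
    hence "decay L (real d * real t / real m) = q\<^sup>2 / (max q (real t))\<^sup>2"
      by (simp add: decay_def power_divide)
    also have "\<dots> \<le> q\<^sup>2 * (6 / ((q + real t) * (q + real (Suc t))))"
    proof -
      \<comment> \<open>As \<open>q\<close> is at least 1, the factors are at most two and three
        times the maximum. The comparison sequence then telescopes.\<close>
      have "(q + real t) * (q + real (Suc t)) \<le> (2 * max q (real t)) * (3 * max q (real t))"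
        using q by (intro mult_mono) auto
      hence "1 / (max q (real t))\<^sup>2 \<le> 6 / ((q + real t) * (q + real (Suc t)))"
        using q pos divide_left_mono[of "(q + real t) * (q + real (Suc t))" "6 * (max q (real t))\<^sup>2" 6]
        by (simp add: power2_eq_square mult_ac)
      from mult_left_mono[OF this, of "q\<^sup>2"] show ?thesis by simp
    qed
    also have "\<dots> = 6 * q\<^sup>2 * (1 / (q + real t) - 1 / (q + real (Suc t)))"
      using q by (simp add: field_simps)
    finally show ?thesis .
  qed
  have "(\<Sum>t<m. decay L (real d * real t / real m)) \<le>
      (\<Sum>t<m. 6 * q\<^sup>2 * (1 / (q + real t) - 1 / (q + real (Suc t))))"
    by (intro sum_mono bound)
  also have "\<dots> = 6 * q\<^sup>2 * (1 / q - 1 / (q + real m))"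
    unfolding sum_distrib_left[symmetric]
    using sum_lessThan_telescope'[of "\<lambda>t. 1 / (q + real t)" m] by simp
  also have "\<dots> \<le> 6 * q\<^sup>2 * (1 / q)" using q by (intro mult_left_mono) auto
  also have "\<dots> = 6 * q" using q by (simp add: power2_eq_square)
  finally have "(\<Sum>t<m. decay L (real d * real t / real m)) / real m \<le> 6 * q / real m"
    by (intro divide_right_mono) auto
  also have "\<dots> = 6 * L / real d" using d by (simp add: q_def)
  also have "\<dots> \<le> 12 * L / (real d + 1)"
    using d L by (simp add: field_simps)
  finally show ?thesis .
qed

text \<open>Lower and upper Riemann sums for the integral of \<open>y ^ d\<close>. The difference of
  two consecutive powers \<open>d + 1\<close> is a sum of \<open>d + 1\<close> products lying
  between \<open>y ^ d\<close> and \<open>(y + 1) ^ d\<close>.\<close>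

lemma power_sum_bounds:
  "real (d + 1) * (\<Sum>t<m. real t ^ d) \<le> real m ^ (d + 1)"
  "real m ^ (d + 1) \<le> real (d + 1) * (\<Sum>t<m. real (Suc t) ^ d)"
proof -
  have step: "real (d + 1) * y ^ d \<le> (y + 1) ^ (d + 1) - y ^ (d + 1)"
    "(y + 1) ^ (d + 1) - y ^ (d + 1) \<le> real (d + 1) * (y + 1) ^ d" if y: "0 \<le> y" for y :: real
  proof -
    have eq: "(y + 1) ^ (d + 1) - y ^ (d + 1) = (\<Sum>i<Suc d. y ^ (d - i) * (y + 1) ^ i)"
      using power_diff_sumr2[of "y + 1" "Suc d" y] by simp
    have lo: "y ^ d \<le> y ^ (d - i) * (y + 1) ^ i" and hi: "y ^ (d - i) * (y + 1) ^ i \<le> (y + 1) ^ d"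
      if "i < Suc d" for i
    proof -
      have "y ^ (d - i) * y ^ i \<le> y ^ (d - i) * (y + 1) ^ i"
        using y by (intro mult_left_mono power_mono) auto
      thus "y ^ d \<le> y ^ (d - i) * (y + 1) ^ i" using that by (simp flip: power_add)
      have "y ^ (d - i) * (y + 1) ^ i \<le> (y + 1) ^ (d - i) * (y + 1) ^ i"
        using y by (intro mult_right_mono power_mono) auto
      thus "y ^ (d - i) * (y + 1) ^ i \<le> (y + 1) ^ d" using that by (simp flip: power_add)
    qed
    show "real (d + 1) * y ^ d \<le> (y + 1) ^ (d + 1) - y ^ (d + 1)"
    proof -
      have "(\<Sum>i<Suc d. y ^ d) \<le> (\<Sum>i<Suc d. y ^ (d - i) * (y + 1) ^ i)"
        by (intro sum_mono lo) auto
      thus ?thesis unfolding eq by (simp only: sum_constant card_lessThan Suc_eq_plus1)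
    qed
    show "(y + 1) ^ (d + 1) - y ^ (d + 1) \<le> real (d + 1) * (y + 1) ^ d"
    proof -
      have "(\<Sum>i<Suc d. y ^ (d - i) * (y + 1) ^ i) \<le> (\<Sum>i<Suc d. (y + 1) ^ d)"
        by (intro sum_mono hi) auto
      thus ?thesis unfolding eq by (simp only: sum_constant card_lessThan Suc_eq_plus1)
    qed
  qed
  show "real (d + 1) * (\<Sum>t<m. real t ^ d) \<le> real m ^ (d + 1)"
  proof (induction m)
    case (Suc m)
    thus ?case using step(1)[of "real m"]
      unfolding sum.lessThan_Suc distrib_left of_nat_Suc by (simp add: add.commute)
  qed simp
  show "real m ^ (d + 1) \<le> real (d + 1) * (\<Sum>t<m. real (Suc t) ^ d)"
  proof (induction m)
    case (Suc m)
    thus ?case using step(2)[of "real m"]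
      unfolding sum.lessThan_Suc distrib_left of_nat_Suc by (simp add: add.commute)
  qed simp
qed

subsection \<open>Local minima under limited independence\<close>

text \<open>
  \<open>st a\<close> tells whether a tie with \<open>a\<close> destroys the minimality of \<open>x\<close>.
\<close>

definition local_min :: "nat \<Rightarrow> nat set \<Rightarrow> (nat \<Rightarrow> bool) \<Rightarrow> (nat \<Rightarrow> nat) \<Rightarrow> bool" where
  "local_min x A st h \<longleftrightarrow> (\<forall>a\<in>A. if st a then h x < h a else h x \<le> h a)"

definition below :: "bool \<Rightarrow> nat \<Rightarrow> nat set" where
  "below b t = (if b then {..t} else {..<t})"

lemma local_min_iff_below: "local_min x A st h \<longleftrightarrow> (\<forall>a\<in>A. h a \<notin> below (st a) (h x))"
  by (auto simp: local_min_def below_def)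

lemma depends_on_local_min: "depends_on (insert x A) (\<lambda>h. of_bool (local_min x A st h))"
  unfolding depends_on_def
proof (intro allI impI)
  fix h h' :: "nat \<Rightarrow> nat" assume "\<forall>a\<in>insert x A. h a = h' a"
  hence "local_min x A st h \<longleftrightarrow> local_min x A st h'"
    unfolding local_min_def by (intro ball_cong) auto
  thus "(of_bool (local_min x A st h) :: real) = of_bool (local_min x A st h')" by simp
qed

lemma card_below:
  assumes "t < m"
  shows "real t / real m \<le> real (card (below b t \<inter> {..<m})) / real m"
    "real (card (below b t \<inter> {..<m})) / real m \<le> (real t + 1) / real m"
proof -
  have "below b t \<inter> {..<m} = below b t" using assms by (auto simp: below_def)
  hence "card (below b t \<inter> {..<m}) = (if b then Suc t else t)" by (simp add: below_def)
  thus "real t / real m \<le> real (card (below b t \<inter> {..<m})) / real m"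
    "real (card (below b t \<inter> {..<m})) / real m \<le> (real t + 1) / real m"
    by (auto intro!: divide_right_mono)
qed

lemma sum_of_bool_eq_lessThan: "(t :: nat) < m \<Longrightarrow> (\<Sum>i<m. of_bool (t = i) * f i) = (f t :: real)"
proof -
  assume "t < m"
  have "(\<Sum>i<m. of_bool (t = i) * f i) = (\<Sum>i<m. if t = i then f i else 0)"
    by (intro sum.cong) auto
  thus ?thesis using \<open>t < m\<close> sum.delta'[of "{..<m}" t f] by simp
qed

locale hash_family = kwise_agree "{..<n}" q "uniform_hash n m" k
  for n m k :: nat and q :: "(nat \<Rightarrow> nat) pmf" +
  assumes m_pos: "0 < m"
    and q_range: "h \<in> set_pmf q \<Longrightarrow> x < n \<Longrightarrow> h x < m"
begin

abbreviation "u \<equiv> uniform_hash n m"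

lemma u_range: "h \<in> set_pmf u \<Longrightarrow> x < n \<Longrightarrow> h x < m"
  using m_pos set_Pi_pmf_subset'[of "{..<n}" 0 "\<lambda>_. pmf_of_set {..<m}"]
  by (auto simp: uniform_hash_def PiE_dflt_def lessThan_empty_iff)

lemma expect_split:
  assumes "x < n" "\<And>h. h \<in> set_pmf p \<Longrightarrow> h x < m" "finite (set_pmf p)"
  shows "expect p F = (\<Sum>t<m. expect p (\<lambda>h. of_bool (h x = t) * F h))"
proof -
  have "expect p F = expect p (\<lambda>h. \<Sum>t<m. of_bool (h x = t) * F h)"
    using assms(2) by (intro integral_cong_AE AE_pmfI) (auto simp: sum_of_bool_eq_lessThan)
  also have "\<dots> = (\<Sum>t<m. expect p (\<lambda>h. of_bool (h x = t) * F h))"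
    by (intro Bochner_Integration.integral_sum integrable_measure_pmf_finite assms)
  finally show ?thesis .
qed

lemma expect_q_split: "x < n \<Longrightarrow> expect q F = (\<Sum>t<m. expect q (\<lambda>h. of_bool (h x = t) * F h))"
  by (intro expect_split q_range finite_q)

lemma expect_u_split: "x < n \<Longrightarrow> expect u F = (\<Sum>t<m. expect u (\<lambda>h. of_bool (h x = t) * F h))"
  by (intro expect_split u_range finite_u)

lemma expect_u_point:
  assumes "x < n" "t < m"
  shows "expect u (\<lambda>h. of_bool (h x = t)) = 1 / real m"
  using uniform_hash_prob[OF m_pos assms(1), of "{t}"] assms(2) by simp

lemma expect_u_point2:
  assumes "x < n" "t < m" "y < n" "t' < m" "x \<noteq> y"
  shows "expect u (\<lambda>h. of_bool (h x = t) * of_bool (h y = t')) = 1 / real m * (1 / real m)"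
proof -
  have "expect u (\<lambda>h. of_bool (h x = t) * of_bool (h y = t')) =
      expect u (\<lambda>h. of_bool (h x = t)) * expect u (\<lambda>h. of_bool (h y = t'))"
    using assms by (intro u_mult[of "{x}" "{y}"]) (auto simp: depends_on_def)
  thus ?thesis unfolding expect_u_point[OF assms(1,2)] expect_u_point[OF assms(3,4)] .
qed

text \<open>The event is split by the value \<open>t\<close> of \<open>x\<close>. The mean number of
  smaller neighbours is at least \<open>card A * t / m\<close>, so the errors of the single values
  are dominated by \<open>decay\<close> and summable. The constant is \<open>12 * 4 * r\<close>; of
  the exponent 4 only 2 is spent here.\<close>

lemma local_min_error:
  assumes x: "x < n" "x \<notin> A" and sub: "A \<subseteq> {..<n}" "A \<noteq> {}" and nm: "n \<le> m"
    and r: "4 \<le> r" "32 * r + 2 \<le> k"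
  shows "\<bar>expect q (\<lambda>h. of_bool (local_min x A st h)) - expect u (\<lambda>h. of_bool (local_min x A st h))\<bar>
    \<le> 2 * (1 / 2) ^ r * (48 * real r / (real (card A) + 1))"
proof -
  have finA: "finite A" using sub finite_subset by blast
  have d: "1 \<le> card A" "card A \<le> m"
    using sub finA card_mono[of "{..<n}" A] nm by (auto simp: Suc_le_eq card_gt_0_iff)
  have m: "0 < m" by (rule m_pos)
  let ?L = "4 * real r"
  have step: "\<bar>expect q (\<lambda>h. of_bool (h x = t) * of_bool (local_min x A st h)) -
      expect u (\<lambda>h. of_bool (h x = t) * of_bool (local_min x A st h))\<bar>
      \<le> 2 * (1 / 2) ^ r * (decay ?L (real (card A) * real t / real m) / real m)" if t: "t < m" for t
  proof -
    interpret hits "{..<n}" q u k A "\<lambda>a. below (st a) t" "{x}" "\<lambda>h. of_bool (h x = t)"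
      using sub x by unfold_locales (auto simp: depends_on_def)
    have eq: "of_bool (h x = t) * of_bool (local_min x A st h) = of_bool (h x = t) * miss h" for h
      by (auto simp: miss_def local_min_iff_below)
    have "hitp a \<ge> real t / real m" if "a \<in> A" for a
      using that sub t card_below(1)[of t m "st a"] m
      unfolding hitp_def hit_def by (subst uniform_hash_prob) auto
    hence "(\<Sum>a\<in>A. real t / real m) \<le> mean" unfolding mean_def by (intro sum_mono)
    hence mean: "real (card A) * real t / real m \<le> mean" by simp
    have "(?L / max ?L mean) ^ 4 \<le> (?L / max ?L (real (card A) * real t / real m)) ^ 2"
    proof -
      have "(?L / max ?L mean) ^ 4 \<le> (?L / max ?L mean) ^ 2"
        using r by (intro power_decreasing) auto
      also have "\<dots> \<le> (?L / max ?L (real (card A) * real t / real m)) ^ 2"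
        using r mean by (intro power_mono divide_left_mono) auto
      finally show ?thesis .
    qed
    hence dec: "(?L / max ?L mean) ^ 4 \<le> decay ?L (real (card A) * real t / real m)"
      by (simp add: decay_def)
    have "\<bar>expect q (\<lambda>h. of_bool (h x = t) * miss h) - expect u (\<lambda>h. of_bool (h x = t) * miss h)\<bar>
        \<le> expect u (\<lambda>h. of_bool (h x = t)) * (2 * (1 / 2) ^ r * (?L / max ?L mean) ^ 4)"
      using r by (rule miss_error)
    also have "\<dots> \<le> 1 / real m * (2 * (1 / 2) ^ r * decay ?L (real (card A) * real t / real m))"
      unfolding expect_u_point[OF x(1) t] by (intro mult_left_mono dec) auto
    finally show ?thesis unfolding eq by simp
  qed
  have "\<bar>expect q (\<lambda>h. of_bool (local_min x A st h)) - expect u (\<lambda>h. of_bool (local_min x A st h))\<bar>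
      \<le> (\<Sum>t<m. \<bar>expect q (\<lambda>h. of_bool (h x = t) * of_bool (local_min x A st h)) -
        expect u (\<lambda>h. of_bool (h x = t) * of_bool (local_min x A st h))\<bar>)"
    unfolding expect_q_split[OF x(1), of "\<lambda>h. of_bool (local_min x A st h)"]
      expect_u_split[OF x(1), of "\<lambda>h. of_bool (local_min x A st h)"] sum_subtractf[symmetric]
    by (rule sum_abs)
  also have "\<dots> \<le> (\<Sum>t<m. 2 * (1 / 2) ^ r * (decay ?L (real (card A) * real t / real m) / real m))"
    by (intro sum_mono step) auto
  also have "\<dots> = 2 * (1 / 2) ^ r * ((\<Sum>t<m. decay ?L (real (card A) * real t / real m)) / real m)"
    by (simp add: sum_distrib_left sum_divide_distrib)
  also have "\<dots> \<le> 2 * (1 / 2) ^ r * (12 * ?L / (real (card A) + 1))"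
    using r d by (intro mult_left_mono sum_decay) auto
  finally show ?thesis by simp
qed

text \<open>The mean over the union dominates the means over \<open>A\<close> and over
  \<open>A'\<close>. The fourth power is therefore bounded by a product of two \<open>decay\<close>
  terms, one in each hash value, and the double sum factors. Disjointness of \<open>A\<close> and
  \<open>A'\<close> gives every neighbour a single forbidden set.\<close>

lemma local_min_pair_error:
  assumes x: "x < n" "y < n" "x \<noteq> y" "x \<notin> A \<union> A'" "y \<notin> A \<union> A'"
    and sub: "A \<subseteq> {..<n}" "A \<noteq> {}" "A' \<subseteq> {..<n}" "A' \<noteq> {}" "A \<inter> A' = {}" and nm: "n \<le> m"
    and r: "4 \<le> r" "32 * r + 2 \<le> k"
  shows "\<bar>expect q (\<lambda>h. of_bool (local_min x A st h) * of_bool (local_min y A' st' h)) -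
      expect u (\<lambda>h. of_bool (local_min x A st h) * of_bool (local_min y A' st' h))\<bar>
    \<le> 2 * (1 / 2) ^ r * ((48 * real r / (real (card A) + 1)) * (48 * real r / (real (card A') + 1)))"
proof -
  have finA: "finite A" "finite A'" using sub finite_subset by blast+
  have d: "1 \<le> card A" "card A \<le> m" "1 \<le> card A'" "card A' \<le> m"
    using sub finA card_mono[of "{..<n}" A] card_mono[of "{..<n}" A'] nm
    by (auto simp: Suc_le_eq card_gt_0_iff)
  have m: "0 < m" by (rule m_pos)
  let ?L = "4 * real r"
  let ?W = "\<lambda>h. of_bool (local_min x A st h) * of_bool (local_min y A' st' h) :: real"
  let ?F = "\<lambda>t t' h. of_bool (h y = t') * (of_bool (h x = t) * ?W h)"
  let ?y = "\<lambda>t. real (card A) * real t / real m" and ?y' = "\<lambda>t. real (card A') * real t / real m"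
  have step: "\<bar>expect q (?F t t') - expect u (?F t t')\<bar>
      \<le> 2 * (1 / 2) ^ r * ((decay ?L (?y t) / real m) * (decay ?L (?y' t') / real m))"
    if t: "t < m" "t' < m" for t t'
  proof -
    define B where "B a = (if a \<in> A then below (st a) t else below (st' a) t')" for a
    define g :: "(nat \<Rightarrow> nat) \<Rightarrow> real" where "g h = of_bool (h x = t) * of_bool (h y = t')" for h
    interpret hits "{..<n}" q u k "A \<union> A'" B "{x, y}" g
      using sub x by unfold_locales (auto simp: g_def depends_on_def)
    have "(\<forall>a\<in>A \<union> A'. h a \<notin> B a) \<longleftrightarrow>
        (\<forall>a\<in>A. h a \<notin> below (st a) t) \<and> (\<forall>a\<in>A'. h a \<notin> below (st' a) t')" for h
      using sub(5) by (auto simp: B_def)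
    hence eq: "?F t t' h = g h * miss h" for h
      by (auto simp: miss_def local_min_iff_below g_def)
    have ge: "real t / real m \<le> hitp a" if "a \<in> A" for a
      using that sub t card_below(1)[of t m "st a"] m
      unfolding hitp_def hit_def by (subst uniform_hash_prob) (auto simp: B_def)
    have ge': "real t' / real m \<le> hitp a" if "a \<in> A'" for a
      using that sub t card_below(1)[of t' m "st' a"] m
      unfolding hitp_def hit_def by (subst uniform_hash_prob) (auto simp: B_def)
    have mean: "mean = (\<Sum>a\<in>A. hitp a) + (\<Sum>a\<in>A'. hitp a)"
      unfolding mean_def using finA sub by (intro sum.union_disjoint) auto
    have "0 \<le> (\<Sum>a\<in>A. hitp a)" "0 \<le> (\<Sum>a\<in>A'. hitp a)" by (auto intro: sum_nonneg hitp_01)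
    moreover have "(\<Sum>a\<in>A. real t / real m) \<le> (\<Sum>a\<in>A. hitp a)"
      "(\<Sum>a\<in>A'. real t' / real m) \<le> (\<Sum>a\<in>A'. hitp a)"
      by (rule sum_mono, erule ge, rule sum_mono, erule ge')
    ultimately have means: "?y t \<le> mean" "?y' t' \<le> mean" unfolding mean by simp_all
    have le: "?L / max ?L mean \<le> ?L / max ?L (?y t)" "?L / max ?L mean \<le> ?L / max ?L (?y' t')"
      using r means by (auto intro!: divide_left_mono mult_pos_pos simp: less_max_iff_disj)
    have "(?L / max ?L mean) ^ 4 = (?L / max ?L mean)\<^sup>2 * (?L / max ?L mean)\<^sup>2"
      by (simp flip: power_add)
    also have "\<dots> \<le> decay ?L (?y t) * decay ?L (?y' t')"
      unfolding decay_def using le r by (intro mult_mono power_mono) auto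
    finally have dec: "(?L / max ?L mean) ^ 4 \<le> decay ?L (?y t) * decay ?L (?y' t')" .
    have "\<bar>expect q (\<lambda>h. g h * miss h) - expect u (\<lambda>h. g h * miss h)\<bar>
        \<le> expect u g * (2 * (1 / 2) ^ r * (?L / max ?L mean) ^ 4)"
      using r by (rule miss_error)
    also have "expect u g = 1 / real m * (1 / real m)"
      unfolding g_def using x t by (intro expect_u_point2) auto
    also have "1 / real m * (1 / real m) * (2 * (1 / 2) ^ r * (?L / max ?L mean) ^ 4) \<le>
        1 / real m * (1 / real m) * (2 * (1 / 2) ^ r * (decay ?L (?y t) * decay ?L (?y' t')))"
      by (intro mult_left_mono dec) auto
    finally show ?thesis unfolding eq by (simp add: mult_ac)
  qed
  have split: "expect p ?W = (\<Sum>t<m. \<Sum>t'<m. expect p (?F t t'))"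
    if "finite (set_pmf p)" "\<And>h x. h \<in> set_pmf p \<Longrightarrow> x < n \<Longrightarrow> h x < m" for p
  proof -
    have "expect p ?W = (\<Sum>t<m. expect p (\<lambda>h. of_bool (h x = t) * ?W h))"
      using x that by (intro expect_split) auto
    also have "\<dots> = (\<Sum>t<m. \<Sum>t'<m. expect p (?F t t'))"
      using x that by (intro sum.cong expect_split) auto
    finally show ?thesis .
  qed
  have "\<bar>expect q ?W - expect u ?W\<bar> =
      \<bar>\<Sum>t<m. \<Sum>t'<m. expect q (?F t t') - expect u (?F t t')\<bar>"
  proof -
    have "expect q ?W = (\<Sum>t<m. \<Sum>t'<m. expect q (?F t t'))"
      by (intro split finite_q q_range)
    moreover have "expect u ?W = (\<Sum>t<m. \<Sum>t'<m. expect u (?F t t'))"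
      by (intro split finite_u u_range)
    ultimately show ?thesis by (simp only: sum_subtractf)
  qed
  also have "\<dots> \<le> (\<Sum>t<m. \<Sum>t'<m. \<bar>expect q (?F t t') - expect u (?F t t')\<bar>)"
    by (rule order_trans[OF sum_abs sum_mono[OF sum_abs]])
  also have "\<dots> \<le> (\<Sum>t<m. \<Sum>t'<m. 2 * (1 / 2) ^ r *
      ((decay ?L (?y t) / real m) * (decay ?L (?y' t') / real m)))"
    by (intro sum_mono step) auto
  also have "\<dots> = 2 * (1 / 2) ^ r *
      (((\<Sum>t<m. decay ?L (?y t)) / real m) * ((\<Sum>t'<m. decay ?L (?y' t')) / real m))"
    by (simp only: sum_divide_distrib sum_product sum_distrib_left[symmetric])
  also have "\<dots> \<le> 2 * (1 / 2) ^ r *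
      ((12 * ?L / (real (card A) + 1)) * (12 * ?L / (real (card A') + 1)))"
    using r d
    by (intro mult_left_mono mult_mono sum_decay) (auto intro!: divide_nonneg_nonneg sum_nonneg decay_nonneg)
  finally show ?thesis by simp
qed

text \<open>Given the value \<open>t\<close>, the survival probability lies between the powers
  \<open>d\<close> of \<open>1 - (t + 1) / m\<close> and \<open>1 - t / m\<close>, however ties are
  resolved. Summing over \<open>t\<close> gives lower and upper Riemann sums for
  \<open>1 / (d + 1)\<close>, which differ by at most \<open>1 / m\<close>.\<close>

lemma uniform_local_min:
  assumes x: "x < n" "x \<notin> A" and sub: "A \<subseteq> {..<n}"
  shows "\<bar>expect u (\<lambda>h. of_bool (local_min x A st h)) - 1 / (real (card A) + 1)\<bar> \<le> 1 / real m"
proof -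
  define d where "d = card A"
  have m: "0 < m" by (rule m_pos)
  have finA: "finite A" using sub finite_subset by blast
  let ?E = "\<lambda>t. expect u (\<lambda>h. of_bool (h x = t) * of_bool (local_min x A st h))"
  have E: "1 / real m * ((real m - real (Suc t)) / real m) ^ d \<le> ?E t"
    "?E t \<le> 1 / real m * ((real m - real t) / real m) ^ d" if t: "t < m" for t
  proof -
    interpret hits "{..<n}" u u k A "\<lambda>a. below (st a) t" "{x}" "\<lambda>h. of_bool (h x = t)"
      using kwise_agree_self[of k] sub x unfolding hits_def hits_axioms_def
      by (auto simp: depends_on_def)
    have eq: "of_bool (h x = t) * of_bool (local_min x A st h) = of_bool (h x = t) * miss h" for h
      by (auto simp: miss_def local_min_iff_below)
    have miss_prod: "miss h = (\<Prod>a\<in>A. 1 - hit a h)" for h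
    proof (cases "\<forall>a\<in>A. h a \<notin> below (st a) t")
      case False
      hence "\<exists>a\<in>A. 1 - hit a h = 0" by (auto simp: hit_def)
      hence "(\<Prod>a\<in>A. 1 - hit a h) = 0" using finA by (intro prod_zero)
      thus ?thesis using False by (simp add: miss_def)
    qed (auto simp: miss_def hit_def)
    have "?E t = 1 / real m * expect u miss"
      unfolding eq expect_u_G_mult[OF depends_miss] expect_u_point[OF x(1) t] ..
    also have "expect u miss = (\<Prod>a\<in>A. expect u (\<lambda>h. 1 - hit a h))"
      unfolding miss_prod using sub finA
      by (intro expect_u_prod[where X = "\<lambda>a. {a}"])
        (auto simp: disjoint_family_on_def depends_on_def hit_def)
    also have "\<dots> = (\<Prod>a\<in>A. 1 - hitp a)" by (simp add: hitp_def)
    finally have E: "?E t = 1 / real m * (\<Prod>a\<in>A. 1 - hitp a)" .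
    have hp: "(real m - real (Suc t)) / real m \<le> 1 - hitp a" "1 - hitp a \<le> (real m - real t) / real m"
      if "a \<in> A" for a
    proof -
      have "a < n" using that sub by auto
      hence "hitp a = real (card (below (st a) t \<inter> {..<m})) / real m"
        unfolding hitp_def hit_def using m by (intro uniform_hash_prob)
      thus "(real m - real (Suc t)) / real m \<le> 1 - hitp a" "1 - hitp a \<le> (real m - real t) / real m"
        using card_below[OF t, of "st a"] m by (simp_all add: diff_divide_distrib add.commute)
    qed
    have "(\<Prod>a\<in>A. (real m - real (Suc t)) / real m) \<le> (\<Prod>a\<in>A. 1 - hitp a)"
      using t hp by (intro prod_mono) auto
    thus "1 / real m * ((real m - real (Suc t)) / real m) ^ d \<le> ?E t"
      unfolding E d_def by (intro mult_left_mono) auto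
    have "(\<Prod>a\<in>A. 1 - hitp a) \<le> (\<Prod>a\<in>A. (real m - real t) / real m)"
      using hp hitp_01 by (intro prod_mono) auto
    thus "?E t \<le> 1 / real m * ((real m - real t) / real m) ^ d"
      unfolding E d_def by (intro mult_left_mono) auto
  qed
  have tot: "expect u (\<lambda>h. of_bool (local_min x A st h)) = (\<Sum>t<m. ?E t)"
    using x by (intro expect_u_split) auto
  define lo where "lo = (\<Sum>t<m. real t ^ d)"
  define hi where "hi = (\<Sum>t<m. real (Suc t) ^ d)"
  have "(\<Sum>t<m. 1 / real m * ((real m - real (Suc t)) / real m) ^ d) =
      (\<Sum>t<m. real (m - Suc t) ^ d) / real m ^ (d + 1)"
    unfolding sum_divide_distrib
    by (intro sum.cong) (auto simp: of_nat_diff power_divide)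
  also have "(\<Sum>t<m. real (m - Suc t) ^ d) = lo"
    unfolding lo_def by (rule sum.nat_diff_reindex)
  finally have "lo / real m ^ (d + 1) = (\<Sum>t<m. 1 / real m * ((real m - real (Suc t)) / real m) ^ d)" ..
  also have "\<dots> \<le> (\<Sum>t<m. ?E t)" by (intro sum_mono E) auto
  finally have L: "lo / real m ^ (d + 1) \<le> expect u (\<lambda>h. of_bool (local_min x A st h))"
    by (simp only: tot)
  have "(\<Sum>t<m. 1 / real m * ((real m - real t) / real m) ^ d) =
      (\<Sum>t<m. real (Suc (m - Suc t)) ^ d) / real m ^ (d + 1)"
    unfolding sum_divide_distrib
    by (intro sum.cong) (auto simp: of_nat_diff power_divide Suc_diff_Suc)
  also have "(\<Sum>t<m. real (Suc (m - Suc t)) ^ d) = hi"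
    unfolding hi_def by (rule sum.nat_diff_reindex)
  finally have hi_eq: "(\<Sum>t<m. 1 / real m * ((real m - real t) / real m) ^ d) = hi / real m ^ (d + 1)" .
  have "(\<Sum>t<m. ?E t) \<le> (\<Sum>t<m. 1 / real m * ((real m - real t) / real m) ^ d)"
    by (intro sum_mono E) auto
  hence H: "expect u (\<lambda>h. of_bool (local_min x A st h)) \<le> hi / real m ^ (d + 1)"
    by (simp only: tot hi_eq)
  have M: "0 < real m ^ (d + 1)" using m by simp
  have "lo / real m ^ (d + 1) \<le> 1 / (real d + 1)" "1 / (real d + 1) \<le> hi / real m ^ (d + 1)"
    using power_sum_bounds(1)[of d m] power_sum_bounds(2)[of m d] M by (simp_all add: lo_def hi_def field_simps)
  moreover have "hi / real m ^ (d + 1) - lo / real m ^ (d + 1) \<le> 1 / real m"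
  proof -
    \<comment> \<open>For \<open>d = 0\<close> the last term is 1 and the difference vanishes;
      dropping it covers both cases.\<close>
    have "hi - lo = real m ^ d - 0 ^ d"
      unfolding hi_def lo_def sum_subtractf[symmetric]
      using sum_lessThan_telescope[of "\<lambda>t. real t ^ d" m] by simp
    also have "\<dots> \<le> real m ^ d" by simp
    finally have "(hi - lo) / real m ^ (d + 1) \<le> real m ^ d / real m ^ (d + 1)"
      using M by (intro divide_right_mono) auto
    thus ?thesis using m by (simp add: diff_divide_distrib)
  qed
  ultimately show ?thesis using L H unfolding d_def by linarith
qed

lemma uniform_local_min_pair:
  assumes x: "x < n" "y < n" "x \<noteq> y" "x \<notin> A'" "y \<notin> A"
    and sub: "A \<subseteq> {..<n}" "A' \<subseteq> {..<n}" "A \<inter> A' = {}"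
  shows "expect u (\<lambda>h. of_bool (local_min x A st h) * of_bool (local_min y A' st' h)) =
    expect u (\<lambda>h. of_bool (local_min x A st h)) * expect u (\<lambda>h. of_bool (local_min y A' st' h))"
  using assms by (intro u_mult[of "insert x A" "insert y A'"] depends_on_local_min) auto

end

subsection \<open>Concentration of the solution size\<close>

definition nbrs :: "nat set set \<Rightarrow> nat \<Rightarrow> nat set" where
  "nbrs E v = {a. {a, v} \<in> E}"

context
  fixes n E assumes E: "simple_graph n E"
begin

lemma edge_bounds: "{a, v} \<in> E \<Longrightarrow> a < n \<and> v < n \<and> a \<noteq> v"
  using E by (auto simp: simple_graph_def nsets_def)

lemma nbrs_subset: "nbrs E v \<subseteq> {..<n} - {v}"
  using edge_bounds by (auto simp: nbrs_def)

lemma finite_nbrs: "finite (nbrs E v)"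
  using nbrs_subset finite_subset by blast

lemma nbrs_commute: "a \<in> nbrs E v \<longleftrightarrow> v \<in> nbrs E a"
  by (simp add: nbrs_def insert_commute)

lemma degree_eq_card_nbrs: "degree E v = card (nbrs E v)"
proof -
  have "{e \<in> E. v \<in> e} = (\<lambda>a. {a, v}) ` nbrs E v"
  proof (intro equalityI subsetI)
    fix e assume e: "e \<in> {e \<in> E. v \<in> e}"
    hence "card e = 2" using E by (auto simp: simple_graph_def nsets_def)
    then obtain x y where "e = {x, y}" by (auto simp: card_2_iff)
    thus "e \<in> (\<lambda>a. {a, v}) ` nbrs E v"
      using e by (auto simp: nbrs_def insert_commute)
  qed (auto simp: nbrs_def)
  moreover have "inj_on (\<lambda>a. {a, v}) (nbrs E v)"
    by (auto simp: inj_on_def doubleton_eq_iff)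
  ultimately show ?thesis by (simp add: degree_def card_image)
qed

lemma degree_less: "v < n \<Longrightarrow> degree E v < n"
  using card_mono[OF _ nbrs_subset[of v]] by (simp add: degree_eq_card_nbrs)

lemma nbrs_nonempty:
  assumes "E \<noteq> {}"
  shows "\<exists>v<n. nbrs E v \<noteq> {}"
proof -
  obtain e where "e \<in> E" using assms by blast
  moreover from this have "card e = 2" using E by (auto simp: simple_graph_def nsets_def)
  then obtain x y where "e = {x, y}" by (auto simp: card_2_iff)
  ultimately have "x \<in> nbrs E y" "y < n" using edge_bounds by (auto simp: nbrs_def)
  thus ?thesis by blast
qed

lemma degree_le_max: "v < n \<Longrightarrow> degree E v \<le> max_degree n E"
  unfolding max_degree_def by (intro Max_ge) auto

lemma max_degree_pos:
  assumes "E \<noteq> {}"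
  shows "1 \<le> max_degree n E"
proof -
  obtain v where v: "v < n" "nbrs E v \<noteq> {}" using nbrs_nonempty[OF assms] by blast
  hence "1 \<le> degree E v"
    using finite_nbrs by (simp add: degree_eq_card_nbrs Suc_le_eq card_gt_0_iff)
  thus ?thesis using degree_le_max[OF v(1)] by linarith
qed

text \<open>Pairs are charged to a common neighbour \<open>a\<close>, which accounts for the square
  of its degree. Pairs with \<open>v = w\<close> are included, so the diagonal of the variance is
  covered too.\<close>

lemma sum_common_nbrs_le:
  "(\<Sum>v<n. \<Sum>w<n. of_bool (nbrs E v \<inter> nbrs E w \<noteq> {})) \<le>
    real (max_degree n E) * (\<Sum>a<n. real (degree E a))"
proof -
  have "(\<Sum>v<n. \<Sum>w<n. of_bool (nbrs E v \<inter> nbrs E w \<noteq> {})) \<le>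
      (\<Sum>v<n. \<Sum>w<n. \<Sum>a<n. of_bool (v \<in> nbrs E a) * of_bool (w \<in> nbrs E a) :: real)"
  proof (intro sum_mono)
    fix v w
    show "of_bool (nbrs E v \<inter> nbrs E w \<noteq> {}) \<le>
        (\<Sum>a<n. of_bool (v \<in> nbrs E a) * of_bool (w \<in> nbrs E a) :: real)"
    proof (cases "nbrs E v \<inter> nbrs E w = {}")
      case False
      then obtain a where a: "a \<in> nbrs E v" "a \<in> nbrs E w" by blast
      hence "a < n" using nbrs_subset by blast
      hence "(\<Sum>a\<in>{a}. of_bool (v \<in> nbrs E a) * of_bool (w \<in> nbrs E a) :: real) \<le>
          (\<Sum>a<n. of_bool (v \<in> nbrs E a) * of_bool (w \<in> nbrs E a))"
        by (intro sum_mono2) auto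
      thus ?thesis using a nbrs_commute by (simp add: False)
    qed (auto intro: sum_nonneg)
  qed
  also have "\<dots> = (\<Sum>v<n. \<Sum>a<n. \<Sum>w<n. of_bool (v \<in> nbrs E a) * of_bool (w \<in> nbrs E a))"
    by (intro sum.cong sum.swap refl)
  also have "\<dots> = (\<Sum>a<n. \<Sum>v<n. \<Sum>w<n. of_bool (v \<in> nbrs E a) * of_bool (w \<in> nbrs E a))"
    by (rule sum.swap)
  also have "\<dots> = (\<Sum>a<n. (\<Sum>v<n. of_bool (v \<in> nbrs E a)) * (\<Sum>w<n. of_bool (w \<in> nbrs E a)))"
    by (simp only: sum_product)
  also have "\<dots> = (\<Sum>a<n. real (degree E a) * real (degree E a))"
  proof (intro sum.cong refl)
    fix a
    have "{..<n} \<inter> {v. v \<in> nbrs E a} = nbrs E a" using nbrs_subset by auto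
    thus "(\<Sum>v<n. of_bool (v \<in> nbrs E a)) * (\<Sum>w<n. of_bool (w \<in> nbrs E a)) =
        real (degree E a) * real (degree E a)"
      by (simp add: sum_of_bool_eq degree_eq_card_nbrs)
  qed
  also have "\<dots> \<le> (\<Sum>a<n. real (max_degree n E) * real (degree E a))"
    using degree_le_max by (intro sum_mono mult_right_mono) auto
  finally show ?thesis by (simp add: sum_distrib_left)
qed

text \<open>Jensen's inequality for the reciprocal, obtained by summing its tangent line at the mean
  \<open>D\<close>.\<close>

lemma caro_wei_ge:
  assumes "0 < n"
  shows "real n / (avg_degree n E + 1) \<le> caro_wei n E"
proof -
  define D where "D = avg_degree n E + 1"
  have D: "0 < D" using assms by (auto simp: D_def avg_degree_def intro!: add_nonneg_pos sum_nonneg divide_nonneg_nonneg)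
  have total: "(\<Sum>v<n. real (degree E v) + 1) = real n * D"
    using assms by (simp add: D_def avg_degree_def sum.distrib field_simps)
  have tangent: "2 / D - (real (degree E v) + 1) / D\<^sup>2 \<le> 1 / (real (degree E v) + 1)" for v
  proof -
    let ?x = "real (degree E v) + 1"
    have "0 \<le> (D - ?x)\<^sup>2 / (?x * D\<^sup>2)" by simp
    also have "\<dots> = 1 / ?x - (2 / D - ?x / D\<^sup>2)"
      using D by (simp add: field_simps power2_eq_square)
    finally show ?thesis by simp
  qed
  have "(\<Sum>v<n. 2 / D - (real (degree E v) + 1) / D\<^sup>2) = 2 * real n / D - (real n * D) / D\<^sup>2"
    by (simp only: sum_subtractf sum_divide_distrib[symmetric] total) simp
  also have "\<dots> = real n / D" using D by (simp add: power2_eq_square field_simps)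
  finally have "real n / D = (\<Sum>v<n. 2 / D - (real (degree E v) + 1) / D\<^sup>2)" ..
  also have "\<dots> \<le> caro_wei n E"
    unfolding caro_wei_def by (intro sum_mono tangent)
  finally show ?thesis by (simp add: D_def)
qed

text \<open>An edge makes the maximum degree at least 1, which turns the degree hypothesis into a
  lower bound on \<open>n\<close>. This makes the tie error negligible.\<close>

lemma vertex_count_ge:
  assumes "E \<noteq> {}" "real (max_degree n E) \<le> \<epsilon>\<^sup>2 * real n / (3 * (avg_degree n E + 1) ^ 3)"
  shows "3 \<le> \<epsilon>\<^sup>2 * real n"
proof -
  let ?D = "avg_degree n E + 1"
  have D: "1 \<le> ?D" by (simp add: avg_degree_def sum_nonneg)
  hence "3 * 1 \<le> 3 * ?D ^ 3" by (intro mult_left_mono) auto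
  moreover have "1 \<le> \<epsilon>\<^sup>2 * real n / (3 * ?D ^ 3)"
    using assms(2) max_degree_pos[OF assms(1)] by linarith
  hence "3 * ?D ^ 3 \<le> \<epsilon>\<^sup>2 * real n" using D by (simp add: le_divide_eq)
  ultimately show ?thesis by linarith
qed

end

text \<open>Chebyshev's inequality. The bias takes a tenth of the permitted deviation; the variance
  is at most 0.196 times its square, and \<open>0.196 / 0.81\<close> is below
  \<open>1 / 3\<close>.\<close>

lemma (in hash_family) size_concentration:
  fixes st :: "nat \<Rightarrow> nat \<Rightarrow> bool" and E :: "nat set set"
  defines "W \<equiv> \<lambda>v h. of_bool (local_min v (nbrs E v) (st v) h) :: real"
  defines "X \<equiv> \<lambda>h. \<Sum>v<n. W v h"
  assumes E: "simple_graph n E" "E \<noteq> {}"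
    and exclusive: "\<And>v w h. {v, w} \<in> E \<Longrightarrow> W v h * W w h = 0"
    and eps: "0 < \<epsilon>" "\<epsilon> < 1"
    and deg: "real (max_degree n E) \<le> \<epsilon>\<^sup>2 * real n / (3 * (avg_degree n E + 1) ^ 3)"
    and nm: "n\<^sup>2 \<le> m"
    and r: "4 \<le> r" "32 * r + 2 \<le> k"
    and \<delta>: "2 * (1 / 2) ^ r * (48 * real r)\<^sup>2 \<le> \<epsilon>\<^sup>2 / 1000"
  shows "measure_pmf.prob q
    {h. X h \<in> {(1 - \<epsilon>) * caro_wei n E .. (1 + \<epsilon>) * caro_wei n E}} \<ge> 2 / 3"
proof -
  define \<delta> where "\<delta> = 2 * (1 / 2) ^ r * (48 * real r)\<^sup>2"
  define a where "a v = 1 / (real (degree E v) + 1)" for v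
  define cw where "cw = caro_wei n E"
  define D where "D = avg_degree n E + 1"
  define \<Delta> where "\<Delta> = real (max_degree n E)"
  define f where "f v = expect q (W v)" for v
  define e where "e v = expect u (W v)" for v
  note nbrs_sub = nbrs_subset[OF E(1)]
  have \<delta>01: "0 \<le> \<delta>" "\<delta> \<le> \<epsilon>\<^sup>2 / 1000" using \<delta> by (auto simp: \<delta>_def)
  have eps2: "\<epsilon>\<^sup>2 \<le> \<epsilon>" "\<epsilon>\<^sup>2 \<le> 1" "0 < \<epsilon>\<^sup>2"
    using eps by (auto simp: power2_eq_square mult_le_one)
  have cw_sum: "cw = (\<Sum>v<n. a v)" by (simp add: cw_def caro_wei_def a_def)
  have \<Delta>: "1 \<le> \<Delta>" using max_degree_pos[OF E] by (simp add: \<Delta>_def)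
  have D: "1 \<le> D" by (simp add: D_def avg_degree_def sum_nonneg)
  have deg': "3 * \<Delta> * D ^ 3 \<le> \<epsilon>\<^sup>2 * real n"
    using deg D by (simp add: \<Delta>_def D_def field_simps)
  have n3: "3 \<le> \<epsilon>\<^sup>2 * real n" by (rule vertex_count_ge[OF E deg])
  hence "n \<noteq> 0" by (cases "n = 0") auto
  moreover have "\<epsilon>\<^sup>2 < 1" using power_strict_mono[of \<epsilon> 1 2] eps by simp
  ultimately have "\<epsilon>\<^sup>2 * real n < 1 * real n" by (intro mult_strict_right_mono) auto
  hence n: "4 \<le> n" using n3 by simp
  have m16: "16 \<le> m" using nm power_mono[of 4 n 2] n by simp
  have nm': "n \<le> m" using nm n power2_nat_le_imp_le order_trans by blast
  have minv: "1 / real m \<le> 1 / (real n)\<^sup>2"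
  proof (rule divide_left_mono)
    show "(real n)\<^sup>2 \<le> real m" using nm by (simp flip: of_nat_power)
    show "0 < real m * (real n)\<^sup>2" using n m16 by simp
  qed simp
  have a01: "0 < a v" "a v \<le> 1" for v by (auto simp: a_def)
  \<comment> \<open>The tie error never exceeds the main term, so \<open>e v\<close> is at most
    \<open>2 * a v\<close>.\<close>
  have a_ge: "1 / real m \<le> a v" if "v < n" for v
    using degree_less[OF E(1) that] nm' n unfolding a_def by (intro divide_left_mono) auto
  have W01: "0 \<le> W v h" "W v h \<le> 1" for v h by (auto simp: W_def)
  have f01: "0 \<le> f v" for v unfolding f_def by (intro expect_nonneg W01)
  have W_isolated: "W v = (\<lambda>_. 1)" if "nbrs E v = {}" for v
    using that by (simp add: W_def local_min_def)
  have fe: "\<bar>f v - e v\<bar> \<le> \<delta> * a v" if v: "v < n" "nbrs E v \<noteq> {}" for v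
  proof -
    have "\<bar>f v - e v\<bar> \<le> 2 * (1 / 2) ^ r * (48 * real r / (real (card (nbrs E v)) + 1))"
      unfolding f_def e_def W_def using v nbrs_sub[of v] nm' r by (intro local_min_error) auto
    also have "\<dots> = (2 * (1 / 2) ^ r * (48 * real r)) * a v"
      by (simp add: a_def degree_eq_card_nbrs[OF E(1)])
    also have "\<dots> \<le> \<delta> * a v"
      unfolding \<delta>_def using a01(1)[of v] r
      by (intro mult_right_mono mult_left_mono self_le_power) auto
    finally show ?thesis .
  qed
  have ea: "\<bar>e v - a v\<bar> \<le> 1 / real m" if v: "v < n" for v
    unfolding e_def W_def a_def degree_eq_card_nbrs[OF E(1)]
    using v nbrs_sub[of v] by (intro uniform_local_min) auto
  have fa: "\<bar>f v - a v\<bar> \<le> \<delta> * a v + 1 / real m" if "v < n" for v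
  proof (cases "nbrs E v = {}")
    case True
    hence "f v = 1" "a v = 1"
      by (simp_all add: f_def W_isolated a_def degree_eq_card_nbrs[OF E(1)])
    thus ?thesis using \<delta>01 by simp
  next
    case False
    thus ?thesis using fe[OF that] ea[OF that] by linarith
  qed
  define cov where "cov v w = expect q (\<lambda>h. W v h * W w h) - f v * f w" for v w
  \<comment> \<open>Isolated vertices have constant indicators; adjacent vertices never survive
    together, so their covariance is not positive; a common neighbour, which includes
    \<open>v = w\<close>, is charged the trivial bound; all remaining pairs have disjoint closed
    neighbourhoods and are nearly independent.\<close>
  have cov_le: "cov v w \<le> 57 / 100 * of_bool (nbrs E v \<inter> nbrs E w \<noteq> {}) + 6 * \<delta> * (a v * a w)"
    if vw: "v < n" "w < n" for v w
  proof -
    have aa: "0 \<le> 6 * \<delta> * (a v * a w)" using a01 \<delta>01 by (simp add: less_imp_le)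
    consider "nbrs E v = {} \<or> nbrs E w = {}" | "w \<in> nbrs E v"
      | "nbrs E v \<inter> nbrs E w \<noteq> {}"
      | "nbrs E v \<noteq> {}" "nbrs E w \<noteq> {}" "w \<notin> nbrs E v" "nbrs E v \<inter> nbrs E w = {}"
      by blast
    thus ?thesis
    proof cases
      case 1
      hence "cov v w = 0" by (auto simp: cov_def f_def W_isolated)
      thus ?thesis using 1 aa by auto
    next
      case 2
      hence "(\<lambda>h. W v h * W w h) = (\<lambda>_. 0)"
        using exclusive[of v w] by (simp only: nbrs_def insert_commute mem_Collect_eq)
      hence "cov v w \<le> 0" using f01 by (simp add: cov_def)
      moreover have "0 \<le> 57 / 100 * (of_bool (nbrs E v \<inter> nbrs E w \<noteq> {}) :: real)" by simp
      ultimately show ?thesis using aa by linarith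
    next
      case 3
      have "1 \<le> degree E v"
        using 3 finite_nbrs[OF E(1), of v] by (auto simp: degree_eq_card_nbrs[OF E(1)] Suc_le_eq card_gt_0_iff)
      hence av: "a v \<le> 1 / 2" by (simp add: a_def field_simps)
      have "expect q (\<lambda>h. W v h * W w h) \<le> f v"
        unfolding f_def using W01 by (intro integral_mono) (auto simp: mult_left_le)
      moreover have "0 \<le> f v * f w" using f01 by simp
      ultimately have "cov v w \<le> f v" by (simp add: cov_def)
      also have "\<dots> \<le> a v + \<delta> * a v + 1 / real m" using fa[OF vw(1)] by linarith
      \<comment> \<open>A non-isolated vertex survives with probability about one half at most. The
        saving over the trivial bound 1 is needed for the final constant.\<close>
      also have "\<dots> \<le> 1 / 2 + 1 / 1000 * 1 + 1 / 16"
        using av \<delta>01 eps2 a01[of v] m16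
        by (intro add_mono mult_mono divide_left_mono) auto
      also have "\<dots> \<le> 57 / 100" by simp
      finally show ?thesis using 3 aa by simp
    next
      case 4
      have ne: "v \<noteq> w" using 4 by blast
      have "v \<notin> nbrs E w" using 4 nbrs_commute[OF E(1)] by blast
      hence x: "v \<notin> nbrs E v \<union> nbrs E w" "w \<notin> nbrs E v \<union> nbrs E w"
        using 4 nbrs_sub by blast+
      have sub: "nbrs E v \<subseteq> {..<n}" "nbrs E w \<subseteq> {..<n}" using nbrs_sub by blast+
      have uu: "expect u (\<lambda>h. W v h * W w h) = e v * e w"
        unfolding W_def e_def using vw ne x sub 4 by (intro uniform_local_min_pair) auto
      have "\<bar>expect q (\<lambda>h. W v h * W w h) - expect u (\<lambda>h. W v h * W w h)\<bar> \<le>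
          2 * (1 / 2) ^ r * ((48 * real r / (real (card (nbrs E v)) + 1)) *
            (48 * real r / (real (card (nbrs E w)) + 1)))"
        unfolding W_def using vw ne x sub 4 nm' r by (intro local_min_pair_error) auto
      also have "\<dots> = \<delta> * (a v * a w)"
        by (simp add: \<delta>_def a_def degree_eq_card_nbrs[OF E(1)] power2_eq_square)
      finally have 1: "expect q (\<lambda>h. W v h * W w h) \<le> e v * e w + \<delta> * (a v * a w)"
        using uu by linarith
      have ew: "\<bar>e w\<bar> \<le> 2 * a w" using ea[OF vw(2)] a_ge[OF vw(2)] a01[of w] by linarith
      have "\<bar>e v\<bar> \<le> 2 * a v" using ea[OF vw(1)] a_ge[OF vw(1)] a01[of v] by linarith
      moreover have "\<delta> * a v \<le> 1 * a v"
        using \<delta>01 eps2 a01[of v] by (intro mult_right_mono) auto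
      ultimately have fv: "\<bar>f v\<bar> \<le> 3 * a v" using fe[OF vw(1) 4(1)] by linarith
      have "e v * e w - f v * f w = (e v - f v) * e w + f v * (e w - f w)"
        by (simp add: algebra_simps)
      also have "\<dots> \<le> \<bar>f v - e v\<bar> * \<bar>e w\<bar> + \<bar>f v\<bar> * \<bar>f w - e w\<bar>"
        using abs_ge_self[of "(e v - f v) * e w"] abs_ge_self[of "f v * (e w - f w)"]
        by (simp add: abs_mult abs_minus_commute)
      also have "\<dots> \<le> (\<delta> * a v) * (2 * a w) + (3 * a v) * (\<delta> * a w)"
        using fe[OF vw(1) 4(1)] fe[OF vw(2) 4(2)] ew fv a01 \<delta>01
        by (intro add_mono mult_mono) (auto intro: less_imp_le mult_nonneg_nonneg)
      also have "\<dots> = 5 * \<delta> * (a v * a w)" by simp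
      finally have "cov v w \<le> 6 * \<delta> * (a v * a w)" using 1 by (simp add: cov_def)
      thus ?thesis using 4 by simp
    qed
  qed
  define \<mu> where "\<mu> = expect q X"
  have \<mu>_sum: "\<mu> = (\<Sum>v<n. f v)"
    unfolding \<mu>_def X_def f_def by (rule Bochner_Integration.integral_sum) auto
  have "expect q (\<lambda>h. (X h - \<mu>)\<^sup>2) = expect q (\<lambda>h. X h * X h) - \<mu> * \<mu>"
    using measure_pmf.variance_eq[of q X] by (simp add: \<mu>_def power2_eq_square)
  also have "expect q (\<lambda>h. X h * X h) = (\<Sum>v<n. \<Sum>w<n. expect q (\<lambda>h. W v h * W w h))"
    unfolding X_def sum_product by (simp add: Bochner_Integration.integral_sum)
  also have "\<dots> - \<mu> * \<mu> = (\<Sum>v<n. \<Sum>w<n. cov v w)"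
    by (simp add: \<mu>_sum sum_product cov_def sum_subtractf)
  also have "\<dots> \<le> (\<Sum>v<n. \<Sum>w<n. 57 / 100 * of_bool (nbrs E v \<inter> nbrs E w \<noteq> {}) + 6 * \<delta> * (a v * a w))"
    by (intro sum_mono cov_le) auto
  also have "\<dots> = 57 / 100 * (\<Sum>v<n. \<Sum>w<n. of_bool (nbrs E v \<inter> nbrs E w \<noteq> {})) + 6 * \<delta> * (cw * cw)"
    by (simp only: sum.distrib sum_distrib_left[symmetric] cw_sum sum_product)
  also have "(\<Sum>v<n. \<Sum>w<n. of_bool (nbrs E v \<inter> nbrs E w \<noteq> {})) \<le> \<Delta> * (\<Sum>v<n. real (degree E v))"
    unfolding \<Delta>_def by (rule sum_common_nbrs_le[OF E(1)])
  \<comment> \<open>Here \<open>D\<close> is the average degree plus one, and the surplus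
    \<open>n\<close> is given away.\<close>
  also have "(\<Sum>v<n. real (degree E v)) \<le> real n * D"
    using n by (simp add: D_def avg_degree_def field_simps)
  finally have var: "expect q (\<lambda>h. (X h - \<mu>)\<^sup>2) \<le> 57 / 100 * (\<Delta> * (real n * D)) + 6 * \<delta> * (cw * cw)"
    using \<Delta> by simp
  have cw_ge: "real n / D \<le> cw"
    unfolding D_def cw_def using n by (intro caro_wei_ge[OF E(1)]) auto
  have "0 < real n / D" using n D by simp
  hence cw_pos: "0 < cw" using cw_ge by linarith
  \<comment> \<open>One factor \<open>D\<close> belongs to the degree sum; the other two turn
    \<open>n\<close> into \<open>n / D\<close>, the lower bound of the Caro-Wei sum, after
    squaring.\<close>
  have key: "3 * (\<Delta> * (real n * D)) \<le> (\<epsilon> * cw)\<^sup>2"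
  proof -
    have "3 * (\<Delta> * (real n * D)) = (3 * \<Delta> * D ^ 3) * (real n / D\<^sup>2)"
      using D by (simp add: field_simps power2_eq_square power3_eq_cube)
    also have "\<dots> \<le> (\<epsilon>\<^sup>2 * real n) * (real n / D\<^sup>2)"
      by (intro mult_right_mono deg') auto
    also have "\<dots> = \<epsilon>\<^sup>2 * (real n / D)\<^sup>2" by (simp add: power2_eq_square)
    also have "\<dots> \<le> \<epsilon>\<^sup>2 * cw\<^sup>2"
      using cw_ge D by (intro mult_left_mono power_mono) auto
    finally show ?thesis by (simp add: power_mult_distrib)
  qed
  have "6 * \<delta> * (cw * cw) \<le> 6 * (\<epsilon>\<^sup>2 / 1000) * (cw * cw)"
    using \<delta>01 by (intro mult_right_mono mult_left_mono) auto
  also have "\<dots> = 6 / 1000 * (\<epsilon> * cw)\<^sup>2" by (simp add: power2_eq_square)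
  finally have var': "expect q (\<lambda>h. (X h - \<mu>)\<^sup>2) \<le> 196 / 1000 * (\<epsilon> * cw)\<^sup>2"
    using var key by linarith
  \<comment> \<open>This lets the permitted deviation absorb the additive tie error, which is at
    most \<open>1 / n\<close> in total.\<close>
  have eps_cw: "3 \<le> \<epsilon> * cw"
  proof -
    have "1 * (4 * 1) \<le> \<Delta> * (real n * D)" using \<Delta> n D by (intro mult_mono) auto
    hence "3\<^sup>2 \<le> (\<epsilon> * cw)\<^sup>2" using key by simp
    thus ?thesis using eps cw_pos by (intro power2_le_imp_le[of 3]) auto
  qed
  have bias: "\<bar>\<mu> - cw\<bar> \<le> 1 / 10 * (\<epsilon> * cw)"
  proof -
    have "\<bar>\<mu> - cw\<bar> \<le> (\<Sum>v<n. \<bar>f v - a v\<bar>)"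
      unfolding \<mu>_sum cw_sum sum_subtractf[symmetric] by (rule sum_abs)
    also have "\<dots> \<le> (\<Sum>v<n. \<delta> * a v + 1 / real m)" by (intro sum_mono fa) auto
    also have "\<dots> = \<delta> * cw + real n * (1 / real m)"
      by (simp add: sum.distrib cw_sum sum_distrib_left)
    also have "real n * (1 / real m) \<le> real n * (1 / (real n)\<^sup>2)"
      by (intro mult_left_mono minv) auto
    also have "\<dots> = 1 / real n" using n by (simp add: power2_eq_square)
    also have "1 / real n \<le> 1 / 4" using n by (intro divide_left_mono) auto
    also have "\<delta> * cw \<le> (\<epsilon> / 1000) * cw"
      using \<delta>01 eps2 cw_pos by (intro mult_right_mono) auto
    finally show ?thesis using eps_cw by simp
  qed
  have pos: "0 < 9 / 10 * (\<epsilon> * cw)" using eps_cw by simp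
  have "measure_pmf.prob q {h \<in> space (measure_pmf q). \<bar>X h - expect q X\<bar> \<ge> 9 / 10 * (\<epsilon> * cw)}
      \<le> expect q (\<lambda>h. (X h - expect q X)\<^sup>2) / (9 / 10 * (\<epsilon> * cw))\<^sup>2"
    using pos by (intro measure_pmf.Chebyshev_inequality) auto
  also have "\<dots> \<le> 196 / 1000 * (\<epsilon> * cw)\<^sup>2 / (9 / 10 * (\<epsilon> * cw))\<^sup>2"
    using var' by (intro divide_right_mono) (auto simp: \<mu>_def)
  also have "\<dots> \<le> 1 / 3" using eps_cw by (simp add: power2_eq_square)
  finally have bad: "measure_pmf.prob q {h. \<bar>X h - \<mu>\<bar> \<ge> 9 / 10 * (\<epsilon> * cw)} \<le> 1 / 3"
    by (simp add: \<mu>_def)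
  have "1 - measure_pmf.prob q {h. \<bar>X h - \<mu>\<bar> \<ge> 9 / 10 * (\<epsilon> * cw)} =
      measure_pmf.prob q (- {h. \<bar>X h - \<mu>\<bar> \<ge> 9 / 10 * (\<epsilon> * cw)})"
    using measure_pmf.prob_compl[of "{h. \<bar>X h - \<mu>\<bar> \<ge> 9 / 10 * (\<epsilon> * cw)}" q]
    by (simp add: Compl_eq_Diff_UNIV)
  also have "\<dots> \<le> measure_pmf.prob q {h. X h \<in> {(1 - \<epsilon>) * cw .. (1 + \<epsilon>) * cw}}"
  proof (intro measure_pmf.finite_measure_mono subsetI)
    fix h assume "h \<in> - {h. \<bar>X h - \<mu>\<bar> \<ge> 9 / 10 * (\<epsilon> * cw)}"
    hence "\<bar>X h - \<mu>\<bar> < 9 / 10 * (\<epsilon> * cw)" by auto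
    hence "\<bar>X h - cw\<bar> \<le> \<epsilon> * cw" using bias by linarith
    thus "h \<in> {h. X h \<in> {(1 - \<epsilon>) * cw .. (1 + \<epsilon>) * cw}}"
      by (auto simp: abs_le_iff algebra_simps)
  qed auto
  finally show ?thesis using bad by (simp add: cw_def)
qed

subsection \<open>The reported set\<close>

lemma length_cwei1_step [simp]: "length (cwei1_step h e A) = length A"
  by (cases e) auto

lemma length_fold_cwei1_step [simp]: "length (fold (cwei1_step h) es A) = length A"
  by (induction es arbitrary: A) auto

lemma nth_fold_cwei1_step:
  assumes "i < length A"
  shows "fold (cwei1_step h) es A ! i \<longleftrightarrow>
    A ! i \<and> (\<forall>(u, v)\<in>set es. (h u \<le> h v \<longrightarrow> i \<noteq> v) \<and> (h v < h u \<longrightarrow> i \<noteq> u))"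
  using assms
proof (induction es arbitrary: A)
  case (Cons e es)
  obtain u v where e: "e = (u, v)" by (cases e)
  have "A[j := False] ! i \<longleftrightarrow> A ! i \<and> i \<noteq> j" for j
    using Cons.prems by (cases "i = j") auto
  thus ?case using Cons by (auto simp: e)
qed simp

lemma reported_cwei1:
  "reported (cwei1 h n es) =
    {i. i < n \<and> (\<forall>(u, v)\<in>set es. (h u \<le> h v \<longrightarrow> i \<noteq> v) \<and> (h v < h u \<longrightarrow> i \<noteq> u))}"
proof -
  have "fold (cwei1_step h) es (replicate n True) ! i \<longleftrightarrow>
      (\<forall>(u, v)\<in>set es. (h u \<le> h v \<longrightarrow> i \<noteq> v) \<and> (h v < h u \<longrightarrow> i \<noteq> u))" if "i < n" for i
    using nth_fold_cwei1_step[of i "replicate n True" h es] that by simp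
  thus ?thesis by (auto simp: reported_def cwei1_def)
qed

text \<open>Each edge clears one of its endpoints, and cleared entries stay cleared. Nothing is
  assumed about the hash function, so ties and collisions do no harm.\<close>

lemma indep_reported: "indep (reported (cwei1 h n es)) (edges_of es)"
  unfolding indep_def
proof (intro ballI impI notI)
  fix x y
  assume x: "x \<in> reported (cwei1 h n es)" and y: "y \<in> reported (cwei1 h n es)"
    and "{x, y} \<in> edges_of es"
  then obtain u v where uv: "(u, v) \<in> set es" "{x, y} = {u, v}"
    by (auto simp: edges_of_def)
  hence "u \<in> {x, y}" "v \<in> {x, y}" by auto
  hence "u \<in> reported (cwei1 h n es)" "v \<in> reported (cwei1 h n es)" using x y by auto
  thus False using uv(1) unfolding reported_cwei1 by (cases "h u \<le> h v") auto
qed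

text \<open>On a tie the second component of the stream item is cleared, so a tie with
  \<open>a\<close> is fatal for \<open>v\<close> exactly if the edge arrives as
  \<open>(a, v)\<close>.\<close>

lemma mem_reported_iff_local_min:
  assumes "edges_of es = E"
  shows "v \<in> reported (cwei1 h n es) \<longleftrightarrow>
    v < n \<and> local_min v (nbrs E v) (\<lambda>a. (a, v) \<in> set es) h"
proof -
  have mem: "a \<in> nbrs E v \<longleftrightarrow> (a, v) \<in> set es \<or> (v, a) \<in> set es" for a
    unfolding assms[symmetric] by (force simp: nbrs_def edges_of_def doubleton_eq_iff)
  have "(\<forall>(x, y)\<in>set es. (h x \<le> h y \<longrightarrow> v \<noteq> y) \<and> (h y < h x \<longrightarrow> v \<noteq> x)) \<longleftrightarrow>
      local_min v (nbrs E v) (\<lambda>a. (a, v) \<in> set es) h"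
    (is "?L \<longleftrightarrow> ?R")
  proof
    assume L: ?L
    show ?R unfolding local_min_def
    proof
      fix a assume "a \<in> nbrs E v"
      hence "(a, v) \<in> set es \<or> (v, a) \<in> set es" by (simp add: mem)
      thus "if (a, v) \<in> set es then h v < h a else h v \<le> h a"
        using bspec[OF L, of "(a, v)"] bspec[OF L, of "(v, a)"] by auto
    qed
  next
    assume R: ?R
    show ?L
    proof (clarify, intro conjI impI notI)
      fix x y assume xy: "(x, y) \<in> set es"
      {
        assume "h x \<le> h y" "v = y"
        hence "h y < h x" using R xy mem[of x] by (auto simp: local_min_def)
        thus False using \<open>h x \<le> h y\<close> by simp
      }
      {
        assume "h y < h x" "v = x"
        hence "h x \<le> h y" using R xy mem[of y] by (auto simp: local_min_def split: if_splits)
        thus False using \<open>h y < h x\<close> by simp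
      }
    qed
  qed
  thus ?thesis by (simp add: reported_cwei1)
qed

section \<open>The choice of the degree of independence\<close>

lemma power4_le_two_power: "16 \<le> r \<Longrightarrow> real r ^ 4 \<le> 2 ^ r"
proof (induction r rule: nat_induct_at_least)
  case (Suc r)
  have "real (Suc r) ^ 4 \<le> (17 / 16 * real r) ^ 4"
    using Suc by (intro power_mono) auto
  also have "\<dots> \<le> 2 * real r ^ 4" by (simp add: power_mult_distrib power_divide)
  also have "\<dots> \<le> 2 * 2 ^ r" using Suc by simp
  finally show ?case by simp
qed simp

lemma one_le_log_two_div: "0 < \<epsilon> \<Longrightarrow> \<epsilon> < 1 \<Longrightarrow> 1 \<le> log 2 (2 / \<epsilon>)"
  by (simp add: le_log_iff field_simps)

text \<open>The squares of both sides are compared. The left one contains \<open>(1 / 2) ^ r\<close>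
  twice: one copy absorbs \<open>r ^ 4\<close>, the other is at most
  \<open>\<epsilon> ^ 4 / 2 ^ 60\<close>, which beats the numerical constants. This is the reason
  for the factor 60.\<close>

lemma hash_error_small:
  assumes "0 < \<epsilon>" "\<epsilon> < 1" "60 * log 2 (2 / \<epsilon>) \<le> real r"
  shows "2 * (1 / 2) ^ r * (48 * real r)\<^sup>2 \<le> \<epsilon>\<^sup>2 / 1000"
proof -
  have "16 \<le> r" using assms one_le_log_two_div[of \<epsilon>] by linarith
  hence r4: "real r ^ 4 \<le> 2 ^ r" by (rule power4_le_two_power)
  have "(2 / \<epsilon>) ^ 60 = 2 powr (60 * log 2 (2 / \<epsilon>))"
    using assms by (simp add: mult.commute[of 60] powr_powr[symmetric])
  also have "\<dots> \<le> 2 powr real r" using assms by (intro powr_mono) auto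
  finally have "(2 / \<epsilon>) ^ 60 \<le> 2 ^ r" by (simp add: powr_realpow)
  hence "(1 / 2) ^ r \<le> (\<epsilon> / 2) ^ 60"
    using assms by (simp add: power_divide field_simps)
  also have "\<dots> = \<epsilon> ^ 60 / 2 ^ 60" by (simp add: power_divide)
  also have "\<dots> \<le> \<epsilon> ^ 4 / 2 ^ 60"
    using assms by (intro divide_right_mono power_decreasing) auto
  finally have small: "(1 / 2) ^ r \<le> \<epsilon> ^ 4 / 2 ^ 60" .
  have "(2 * (1 / 2) ^ r * (48 * real r)\<^sup>2)\<^sup>2 = 4 * 48 ^ 4 * (real r ^ 4 * (1 / 2) ^ r) * (1 / 2) ^ r"
    by (simp add: power_mult_distrib power2_eq_square power4_eq_xxxx)
  also have "\<dots> \<le> 4 * 48 ^ 4 * 1 * (\<epsilon> ^ 4 / 2 ^ 60)"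
  proof (intro mult_mono)
    show "real r ^ 4 * (1 / 2) ^ r \<le> 1" using r4 by (simp add: power_divide)
  qed (use small assms in auto)
  also have "\<dots> \<le> (\<epsilon>\<^sup>2 / 1000)\<^sup>2"
    using assms by (simp add: power_divide field_simps flip: power_mult)
  finally show ?thesis by (rule power2_le_imp_le) simp
qed

section \<open>From laws on functions back to seeds\<close>

lemma prob_eq_expect: "measure_pmf.prob p {x. P x} = expect p (\<lambda>x. of_bool (P x))"
proof -
  have "(\<lambda>x. of_bool (P x) :: real) = indicator {x. P x}" by (auto simp: indicator_def)
  thus ?thesis by simp
qed

lemma local_min_cong:
  "(\<And>a. a \<in> insert x A \<Longrightarrow> h a = h' a) \<Longrightarrow> local_min x A st h \<longleftrightarrow> local_min x A st h'"
  unfolding local_min_def by (intro ball_cong) auto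

lemma hash_family_hash_law:
  assumes kw: "kwise_independent k n m S h"
  shows "hash_family n m k (hash_law n S h)"
proof -
  have m: "0 < m" and S: "finite S" "S \<noteq> {}"
    and law: "\<And>x. x < n \<Longrightarrow> map_pmf (\<lambda>s. h s x) (pmf_of_set S) = pmf_of_set {..<m}"
    using kw by (auto simp: kwise_independent_def)
  have range: "h s x < m" if "s \<in> S" "x < n" for s x
  proof -
    have "h s x \<in> set_pmf (map_pmf (\<lambda>s. h s x) (pmf_of_set S))" using that S by simp
    thus ?thesis using law[OF that(2)] m by (simp add: lessThan_empty_iff)
  qed
  show ?thesis
    unfolding hash_family_def hash_family_axioms_def
    using kwise_agree_hash_law[OF kw] m range S by (auto simp: hash_law_def)
qed

lemma kwise_range:
  assumes "kwise_independent k n m S h" "s \<in> S" "x < n"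
  shows "h s x < m"
proof -
  interpret hash_family n m k "hash_law n S h" by (rule hash_family_hash_law[OF assms(1)])
  have "finite S" "S \<noteq> {}" using assms(1) by (auto simp: kwise_independent_def)
  hence "(\<lambda>x. if x < n then h s x else 0) \<in> set_pmf (hash_law n S h)"
    using assms(2) by (auto simp: hash_law_def)
  from q_range[OF this assms(3)] show ?thesis using assms(3) by simp
qed

context
  fixes \<epsilon> :: real and n k m :: nat and S :: "'s set" and h
  assumes eps: "0 < \<epsilon>" "\<epsilon> < 1" and n: "1 \<le> n" and k: "2000 * log 2 (2 / \<epsilon>) \<le> real k"
    and m: "n\<^sup>2 \<le> m" "m \<le> n ^ 3" and kw: "kwise_independent k n m S h"
begin

text \<open>Origin of the constant 2000: with \<open>r\<close> the ceiling of 60 times the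
  logarithm, \<open>32 * r + 2\<close> is at most 1920 times the logarithm plus 34, and the
  logarithm is at least 1.\<close>

lemma truncation_order_exists:
  obtains r where "4 \<le> r" "32 * r + 2 \<le> k" "2 * (1 / 2) ^ r * (48 * real r)\<^sup>2 \<le> \<epsilon>\<^sup>2 / 1000"
proof
  define r where "r = nat \<lceil>60 * log 2 (2 / \<epsilon>)\<rceil>"
  have l: "1 \<le> log 2 (2 / \<epsilon>)" using eps by (rule one_le_log_two_div)
  have r: "60 * log 2 (2 / \<epsilon>) \<le> real r" "real r \<le> 60 * log 2 (2 / \<epsilon>) + 1"
    using l unfolding r_def by linarith+
  show "4 \<le> r" using r l by linarith
  have "32 * real r + 2 \<le> real k" using r l k by linarith
  thus "32 * r + 2 \<le> k" by linarith
  show "2 * (1 / 2) ^ r * (48 * real r)\<^sup>2 \<le> \<epsilon>\<^sup>2 / 1000"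
    by (rule hash_error_small[OF eps r(1)])
qed

lemma eps_min_wise_hash:
  assumes large: "3 \<le> \<epsilon>\<^sup>2 * real n"
  shows "eps_min_wise \<epsilon> n S h"
proof -
  interpret hash_family n m k "hash_law n S h" by (rule hash_family_hash_law[OF kw])
  have S: "finite S" "S \<noteq> {}" using kw by (auto simp: kwise_independent_def)
  have range: "h s x < n ^ 3" if "s \<in> S" "x < n" for s x
    using kwise_range[OF kw that] m by linarith
  have "measure_pmf.prob (pmf_of_set S) {s. \<forall>a\<in>A. h s x < h s a}
      \<in> {(1 - \<epsilon>) / (real (card A) + 1) .. (1 + \<epsilon>) / (real (card A) + 1)}"
    if A: "A \<subseteq> {..<n}" "x < n" "x \<notin> A" for A x
  proof (cases "A = {}")
    case True
    thus ?thesis using eps by simp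
  next
    case False
    obtain r where r: "4 \<le> r" "32 * r + 2 \<le> k" "2 * (1 / 2) ^ r * (48 * real r)\<^sup>2 \<le> \<epsilon>\<^sup>2 / 1000"
      by (rule truncation_order_exists)
    define p where "p = measure_pmf.prob (pmf_of_set S) {s. \<forall>a\<in>A. h s x < h s a}"
    define c where "c = 1 / (real (card A) + 1)"
    define e where "e = expect (uniform_hash n m) (\<lambda>g. of_bool (local_min x A (\<lambda>_. True) g))"
    have c: "0 < c" by (simp add: c_def)
    have "(\<forall>a\<in>A. h s x < h s a) \<longleftrightarrow>
        local_min x A (\<lambda>_. True) (\<lambda>x. if x < n then h s x else 0)" for s
      using A by (auto simp: local_min_def subset_iff)
    hence "p = expect (hash_law n S h) (\<lambda>g. of_bool (local_min x A (\<lambda>_. True) g))"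
      by (simp add: p_def prob_eq_expect hash_law_def)
    moreover have "\<dots> \<le> e + 2 * (1 / 2) ^ r * (48 * real r / (real (card A) + 1))"
      "e - 2 * (1 / 2) ^ r * (48 * real r / (real (card A) + 1)) \<le> \<dots>"
      using local_min_error[OF A(2,3,1) False _ r(1,2), of "\<lambda>_. True"]
        power2_nat_le_imp_le[OF m(1)] unfolding e_def by linarith+
    moreover have "2 * (1 / 2) ^ r * (48 * real r / (real (card A) + 1)) \<le> \<epsilon> / 1000 * c"
    proof -
      have "2 * (1 / 2) ^ r * (48 * real r) \<le> 2 * (1 / 2) ^ r * (48 * real r)\<^sup>2"
        using r by (intro mult_left_mono self_le_power) auto
      also have "\<dots> \<le> \<epsilon> / 1000"
      proof -
        have "\<epsilon> * \<epsilon> \<le> \<epsilon>" using eps by (intro mult_left_le) auto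
        thus ?thesis using r(3) by (simp only: power2_eq_square)
      qed
      finally have "2 * (1 / 2) ^ r * (48 * real r) * c \<le> \<epsilon> / 1000 * c"
        using c by (intro mult_right_mono) auto
      thus ?thesis by (simp add: c_def)
    qed
    moreover have "\<bar>e - c\<bar> \<le> 1 / real m"
      unfolding e_def c_def using A by (intro uniform_local_min)
    \<comment> \<open>One factor \<open>1 / n\<close> is below \<open>c\<close>, since
      \<open>A\<close> misses a vertex; the other is at most \<open>\<epsilon> / 3\<close>, by the
      lower bound on \<open>n\<close>.\<close>
    moreover have "1 / real m \<le> \<epsilon> / 3 * c"
    proof -
      have "card A < n"
        using A psubset_card_mono[of "{..<n}" A] by auto
      hence "1 / real n \<le> c" unfolding c_def by (intro divide_left_mono) auto
      moreover have "1 / real n \<le> \<epsilon> / 3"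
      proof -
        have "\<epsilon>\<^sup>2 \<le> \<epsilon>" using eps by (simp add: power2_eq_square mult_left_le)
        hence "\<epsilon>\<^sup>2 * real n \<le> \<epsilon> * real n" by (intro mult_right_mono) auto
        hence "3 \<le> \<epsilon> * real n" using large by linarith
        thus ?thesis using n by (simp add: field_simps)
      qed
      ultimately have "1 / real n * (1 / real n) \<le> \<epsilon> / 3 * c"
        using eps c by (intro mult_mono) auto
      moreover have "1 / real m \<le> 1 / real (n\<^sup>2)"
        using m(1) n m_pos by (intro divide_left_mono mult_pos_pos) (auto simp del: of_nat_power)
      ultimately show ?thesis by (simp add: power2_eq_square)
    qed
    ultimately have "\<bar>p - c\<bar> \<le> \<epsilon> * c" using c eps by (simp add: abs_le_iff)
    thus ?thesis unfolding p_def[symmetric] by (simp add: c_def abs_le_iff diff_divide_distrib add_divide_distrib)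
  qed
  thus ?thesis using S range unfolding eps_min_wise_def by blast
qed

lemma reported_size_concentration:
  assumes E: "simple_graph n E" and es: "edge_stream E es"
    and deg: "real (max_degree n E) \<le> \<epsilon>\<^sup>2 * real n / (3 * (avg_degree n E + 1) ^ 3)"
  shows "measure_pmf.prob (pmf_of_set S)
    {s. real (card (reported (cwei1 (h s) n es)))
      \<in> {(1 - \<epsilon>) * caro_wei n E .. (1 + \<epsilon>) * caro_wei n E}} \<ge> 2 / 3"
\<comment> \<open>Without edges the degree hypothesis does not bound \<open>n\<close> from below;
  then every vertex is reported and the Caro-Wei sum is exactly \<open>n\<close>.\<close>
proof (cases "E = {}")
  case True
  hence "es = []" using es by (simp add: edge_stream_def edges_of_def)
  hence "reported (cwei1 (h s) n es) = {..<n}" for s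
    by (auto simp: reported_cwei1)
  moreover have "caro_wei n E = real n" using True by (simp add: caro_wei_def degree_def)
  ultimately show ?thesis using eps by (simp add: algebra_simps)
next
  case False
  interpret hash_family n m k "hash_law n S h" by (rule hash_family_hash_law[OF kw])
  obtain r where r: "4 \<le> r" "32 * r + 2 \<le> k" "2 * (1 / 2) ^ r * (48 * real r)\<^sup>2 \<le> \<epsilon>\<^sup>2 / 1000"
    by (rule truncation_order_exists)
  have edges: "edges_of es = E" using es by (simp add: edge_stream_def)
  define st where "st v a \<longleftrightarrow> (a, v) \<in> set es" for v a
  have st: "(\<lambda>a. (a, v) \<in> set es) = st v" for v by (simp add: st_def fun_eq_iff)
  have size: "real (card (reported (cwei1 g n es))) = (\<Sum>v<n. of_bool (local_min v (nbrs E v) (st v) g))" for g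
  proof -
    have "reported (cwei1 g n es) = {..<n} \<inter> {v. local_min v (nbrs E v) (st v) g}"
      using mem_reported_iff_local_min[OF edges] by (auto simp: st)
    thus ?thesis by (simp add: sum_of_bool_eq)
  qed
  have "2 / 3 \<le> measure_pmf.prob (hash_law n S h)
      {g. (\<Sum>v<n. of_bool (local_min v (nbrs E v) (st v) g))
        \<in> {(1 - \<epsilon>) * caro_wei n E .. (1 + \<epsilon>) * caro_wei n E}}"
  proof (rule size_concentration[OF E False _ eps deg m(1) r])
    fix v w and g :: "nat \<Rightarrow> nat" assume vw: "{v, w} \<in> E"
    hence "v < n" "w < n" "v \<noteq> w" using edge_bounds[OF E] by blast+
    \<comment> \<open>Two adjacent local minima would both be reported, contradicting independence
      of the reported set.\<close>
    hence "\<not> (local_min v (nbrs E v) (st v) g \<and> local_min w (nbrs E w) (st w) g)"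
      using indep_reported[of g n es] vw mem_reported_iff_local_min[OF edges, of v g n]
        mem_reported_iff_local_min[OF edges, of w g n]
      by (auto simp: indep_def edges st)
    thus "of_bool (local_min v (nbrs E v) (st v) g) * of_bool (local_min w (nbrs E w) (st w) g) = (0::real)"
      by auto
  qed
  also have "\<dots> = measure_pmf.prob (pmf_of_set S)
      {s. (\<Sum>v<n. of_bool (local_min v (nbrs E v) (st v) (\<lambda>x. if x < n then h s x else 0)))
        \<in> {(1 - \<epsilon>) * caro_wei n E .. (1 + \<epsilon>) * caro_wei n E}}"
    by (simp add: hash_law_def vimage_def)
  also have "(\<lambda>s. (\<Sum>v<n. of_bool (local_min v (nbrs E v) (st v) (\<lambda>x. if x < n then h s x else 0)) :: real)) =
      (\<lambda>s. real (card (reported (cwei1 (h s) n es))))"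
    unfolding size
  proof (intro ext sum.cong refl)
    fix s v assume "v \<in> {..<n}"
    thus "(of_bool (local_min v (nbrs E v) (st v) (\<lambda>x. if x < n then h s x else 0)) :: real) =
        of_bool (local_min v (nbrs E v) (st v) (h s))"
      using nbrs_subset[OF E, of v]
      by (subst local_min_cong[of v "nbrs E v" "\<lambda>x. if x < n then h s x else 0" "h s"])
        (auto simp: subset_iff)
  qed
  finally show ?thesis .
qed

end

subsection \<open>The theorem\<close>

text \<open>If \<open>b\<close> bits hold \<open>n\<close>, then \<open>8 * b\<close> bits hold the
  eighth power of \<open>n + 1\<close>, with ample room for the Horner products and the addresses.
  Rounding at most doubles the logarithm, because \<open>n\<close> is at least 2.\<close>

lemma word_length_exists:
  assumes "2 \<le> n"
  obtains w where "(n + 1) ^ 8 \<le> 2 ^ w" "real w \<le> 16 * log 2 (real n)"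
proof
  define b where "b = nat \<lfloor>log 2 (real n)\<rfloor> + 1"
  have l: "1 \<le> log 2 (real n)" using assms by (simp add: le_log_iff)
  hence b: "real b \<le> log 2 (real n) + 1" "log 2 (real n) < real b"
    unfolding b_def by linarith+
  have "real n = 2 powr log 2 (real n)" using assms by simp
  also have "\<dots> < 2 powr real b" using b(2) by (intro powr_less_mono) auto
  also have "\<dots> = real (2 ^ b)" by (simp add: powr_realpow)
  finally have "n < 2 ^ b" by (simp only: of_nat_less_iff)
  hence "(n + 1) ^ 8 \<le> (2 ^ b) ^ 8" by (intro power_mono) auto
  thus "(n + 1) ^ 8 \<le> 2 ^ (8 * b)" by (simp flip: power_mult add: mult.commute)
  show "real (8 * b) \<le> 16 * log 2 (real n)" using b l by simp
qed

lemma cwei1_implementation: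
  assumes eps: "0 < \<epsilon>" "\<epsilon> < 1" and n: "2 \<le> n"
  shows "\<exists>(S :: nat list set) h k m w cells T.
    2000 * log 2 (2 / \<epsilon>) \<le> real k \<and> real k \<le> 40000 * log 2 (2 / \<epsilon>) \<and>
    n ^ 2 \<le> m \<and> m \<le> n ^ 3 \<and> kwise_independent k n m S h \<and>
    implements_cwei1 cwei1_program w cells T n S h \<and>
    real w \<le> 40000 * log 2 (real n) \<and>
    real (cells * w) \<le> 40000 * log 2 (2 / \<epsilon>) * log 2 (real n) \<and>
    real T \<le> 40000 * log 2 (2 / \<epsilon>)"
proof -
  define l where "l = log 2 (2 / \<epsilon>)"
  have l: "1 \<le> l" unfolding l_def using eps by (rule one_le_log_two_div)
  define k where "k = nat \<lceil>2000 * l\<rceil>"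
  have k: "2000 * l \<le> real k" "real k \<le> 2001 * l" using l unfolding k_def by linarith+
  define K where "K = min k n"
  have "1 \<le> real k" using k l by linarith
  hence K: "1 \<le> K" "K \<le> n" "K \<le> k" using n by (auto simp: K_def)
  have K': "real K \<le> 2001 * l" using K k by linarith
  obtain p where p: "prime p" "n\<^sup>2 \<le> p" "p \<le> n ^ 3"
    using prime_between_square_and_cube[OF n] by blast
  have np: "n \<le> p" using p(2) by (rule power2_nat_le_imp_le)
  have p0: "0 < p" using p(1) by (rule prime_gt_0_nat)
  obtain w where w: "(n + 1) ^ 8 \<le> 2 ^ w" "real w \<le> 16 * log 2 (real n)"
    using word_length_exists[OF n] by blast
  have logn: "1 \<le> log 2 (real n)" using n by (simp add: le_log_iff)
  let ?S = "(@) (seed_header p K) ` {cs. set cs \<subseteq> {..<p} \<and> length cs = K}"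
  let ?h = "\<lambda>s. horner_mod p (drop (length (seed_header p K)) s)"
  have kw: "kwise_independent k n p ?S ?h"
    by (rule kwise_independent_horner_mod[OF p(1) np K_def K(1)])
  have impl: "implements_cwei1 cwei1_program w (10 + K) (10 * K + 10) n ?S ?h"
  proof (rule implements_program[OF p0])
    have p_le: "p \<le> (n + 1) ^ 3"
      by (rule order_trans[OF p(3) power_mono]) auto
    have "p * n + p = p * (n + 1)" by simp
    also have "\<dots> \<le> (n + 1) ^ 3 * (n + 1)"
      by (intro mult_right_mono p_le) auto
    also have "\<dots> = (n + 1) ^ 4" by (simp add: eval_nat_numeral)
    also have "\<dots> \<le> (n + 1) ^ 8" by (intro power_increasing) auto
    finally show "p * n + p \<le> 2 ^ w" using w(1) by linarith
    have "3 ^ 7 * (n + 1) \<le> (n + 1) ^ 7 * (n + 1)"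
      using n by (intro mult_right_mono power_mono) auto
    also have "\<dots> = (n + 1) ^ 8" by (simp add: eval_nat_numeral)
    finally have large: "2187 * (n + 1) \<le> 2 ^ w" using w(1) by simp
    show "n < 2 ^ w" by (rule less_le_trans[OF _ large]) simp
    show "10 + K < 2 ^ w" by (rule less_le_trans[OF _ large]) (use K(2) in simp)
  qed (use n in simp)
  \<comment> \<open>Origin of the constant 40000: 2001 for the rounded number of coefficients and 10
    for the header, times 16 for the word length.\<close>
  have "real (10 + K) * real w \<le> (2011 * l) * (16 * log 2 (real n))"
    using K' l w(2) by (intro mult_mono) auto
  also have "\<dots> \<le> 40000 * (l * log 2 (real n))"
    using l logn by simp
  finally have cells: "real ((10 + K) * w) \<le> 40000 * l * log 2 (real n)" by simp
  have T: "real (10 * K + 10) \<le> 40000 * l" using K' l by simp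
  have "2000 * l \<le> real k \<and> real k \<le> 40000 * l \<and> n ^ 2 \<le> p \<and> p \<le> n ^ 3 \<and>
      kwise_independent k n p ?S ?h \<and>
      implements_cwei1 cwei1_program w (10 + K) (10 * K + 10) n ?S ?h \<and>
      real w \<le> 40000 * log 2 (real n) \<and>
      real ((10 + K) * w) \<le> 40000 * l * log 2 (real n) \<and>
      real (10 * K + 10) \<le> 40000 * l"
    using k l p kw impl w(2) logn cells T by simp
  thus ?thesis unfolding l_def by blast
qed

text \<open>
  For a single vertex the word length is \<open>0\<close>, because \<open>log 2 1 = 0\<close>; the only stream is empty.
\<close>

lemma cwei1_implementation_single:
  assumes eps: "0 < \<epsilon>" "\<epsilon> < 1"
  shows "\<exists>(S :: nat list set) h k m w cells T.
    2000 * log 2 (2 / \<epsilon>) \<le> real k \<and> real k \<le> 40000 * log 2 (2 / \<epsilon>) \<and>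
    1 ^ 2 \<le> m \<and> m \<le> 1 ^ 3 \<and> kwise_independent k 1 m S h \<and>
    implements_cwei1 P w cells T 1 S h \<and>
    real w \<le> 40000 * log 2 (real 1) \<and>
    real (cells * w) \<le> 40000 * log 2 (2 / \<epsilon>) * log 2 (real 1) \<and>
    real T \<le> 40000 * log 2 (2 / \<epsilon>)"
proof -
  have l: "1 \<le> log 2 (2 / \<epsilon>)" using eps by (rule one_le_log_two_div)
  define k where "k = nat \<lceil>2000 * log 2 (2 / \<epsilon>)\<rceil>"
  have k: "2000 * log 2 (2 / \<epsilon>) \<le> real k" "real k \<le> 40000 * log 2 (2 / \<epsilon>)"
    using l unfolding k_def by linarith+
  \<comment> \<open>For \<open>n = 1\<close> the range is forced to \<open>m = 1\<close>, so the
    constant 0 is the uniform hash function and an empty seed suffices.\<close>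
  let ?h = "\<lambda>_ _. 0 :: nat"
  have "prob_space.indep_vars (measure_pmf (pmf_of_set {[] :: nat list}))
      (\<lambda>_. count_space UNIV) (\<lambda>x s. ?h s x) X" if "X \<subseteq> {..<1}" for X :: "nat set"
  proof -
    have finX: "finite X" using that finite_subset by blast
    have "map_pmf (\<lambda>_ _. 0) (pmf_of_set {[] :: nat list}) = Pi_pmf X 0 (\<lambda>_. return_pmf (0 :: nat))"
      using finX by (simp add: pmf_of_set_singleton)
    from indep_vars_map_pmf[OF indep_vars_Pi_pmf[OF finX, of "0 :: nat" "\<lambda>_. return_pmf 0", folded this]]
    show ?thesis by simp
  qed
  moreover have "{..<1} = {0::nat}" by auto
  ultimately have "kwise_independent k 1 1 {[] :: nat list} ?h"
    by (auto simp: kwise_independent_def pmf_of_set_singleton)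
  moreover have "implements_cwei1 P 0 0 0 1 {[]} ?h"
    unfolding implements_cwei1_def
  proof (intro conjI ballI allI impI)
    fix E es and s :: "nat list" assume E: "simple_graph 1 E \<and> edge_stream E es"
    have "E = {}" using edge_bounds[of 1 E] nbrs_nonempty[of 1 E] E by (fastforce simp: nbrs_def)
    hence "es = []" using E by (simp add: edge_stream_def edges_of_def)
    thus "\<exists>mem'. ram_stream 0 P 0 es (s, replicate 1 True) (mem', cwei1 (?h s) 1 es)"
      by (simp add: cwei1_def)
  qed auto
  ultimately show ?thesis using k l
    by (intro exI[of _ "{[]}"] exI[of _ ?h] exI[of _ k] exI[of _ 1] exI[of _ 0]) auto
qed

theorem theorem7:
  shows "\<exists>(P :: instr list) (c :: real) (C :: real). 0 < c \<and> 0 < C \<and>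
    (\<forall>(\<epsilon> :: real) (n :: nat). 0 < \<epsilon> \<and> \<epsilon> < 1 \<and> 1 \<le> n \<longrightarrow>
      (\<forall>(S :: nat list set) (h :: nat list \<Rightarrow> nat \<Rightarrow> nat) (k :: nat) (m :: nat) E es.
         c * log 2 (2 / \<epsilon>) \<le> real k \<and> n ^ 2 \<le> m \<and> m \<le> n ^ 3 \<and> kwise_independent k n m S h \<and>
         simple_graph n E \<and> edge_stream E es \<and>
         real (max_degree n E) \<le> \<epsilon>\<^sup>2 * real n / (3 * (avg_degree n E + 1) ^ 3) \<longrightarrow>
           (E \<noteq> {} \<longrightarrow> eps_min_wise \<epsilon> n S h) \<and>
           (\<forall>s\<in>S. \<forall>i\<le>length es.
              indep (reported (cwei1 (h s) n (take i es))) (edges_of (take i es))) \<and>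
           measure_pmf.prob (pmf_of_set S)
             {s. real (card (reported (cwei1 (h s) n es)))
                   \<in> {(1 - \<epsilon>) * caro_wei n E .. (1 + \<epsilon>) * caro_wei n E}} \<ge> 2 / 3) \<and>
      (\<exists>(S :: nat list set) (h :: nat list \<Rightarrow> nat \<Rightarrow> nat) (k :: nat) (m :: nat)
         (w :: nat) (cells :: nat) (T :: nat).
         c * log 2 (2 / \<epsilon>) \<le> real k \<and> real k \<le> C * log 2 (2 / \<epsilon>) \<and>
         n ^ 2 \<le> m \<and> m \<le> n ^ 3 \<and> kwise_independent k n m S h \<and>
         implements_cwei1 P w cells T n S h \<and>
         real w \<le> C * log 2 (real n) \<and>
         real (cells * w) \<le> C * log 2 (2 / \<epsilon>) * log 2 (real n) \<and>
         real T \<le> C * log 2 (2 / \<epsilon>)))"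
proof (rule exI[of _ cwei1_program], rule exI[of _ "2000 :: real"], rule exI[of _ "40000 :: real"],
    intro conjI allI impI ballI)
  fix \<epsilon> :: real and n :: nat assume "0 < \<epsilon> \<and> \<epsilon> < 1 \<and> 1 \<le> n"
  hence eps: "0 < \<epsilon>" "\<epsilon> < 1" and n: "1 \<le> n" by auto
  {
    fix S :: "nat list set" and h :: "nat list \<Rightarrow> nat \<Rightarrow> nat" and k m E es
    assume asm: "2000 * log 2 (2 / \<epsilon>) \<le> real k \<and> n ^ 2 \<le> m \<and> m \<le> n ^ 3 \<and>
      kwise_independent k n m S h \<and> simple_graph n E \<and> edge_stream E es \<and>
      real (max_degree n E) \<le> \<epsilon>\<^sup>2 * real n / (3 * (avg_degree n E + 1) ^ 3)"
    hence k: "2000 * log 2 (2 / \<epsilon>) \<le> real k" and m: "n\<^sup>2 \<le> m" "m \<le> n ^ 3"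
      and kw: "kwise_independent k n m S h" and E: "simple_graph n E" and es: "edge_stream E es"
      and deg: "real (max_degree n E) \<le> \<epsilon>\<^sup>2 * real n / (3 * (avg_degree n E + 1) ^ 3)"
      by auto
    show "eps_min_wise \<epsilon> n S h" if "E \<noteq> {}"
      using eps_min_wise_hash[OF eps n k m kw vertex_count_ge[OF E that deg]] .
    show "indep (reported (cwei1 (h s) n (take i es))) (edges_of (take i es))" if "s \<in> S" "i \<le> length es" for s i
      by (rule indep_reported)
    show "measure_pmf.prob (pmf_of_set S)
        {s. real (card (reported (cwei1 (h s) n es)))
          \<in> {(1 - \<epsilon>) * caro_wei n E .. (1 + \<epsilon>) * caro_wei n E}} \<ge> 2 / 3"
      by (rule reported_size_concentration[OF eps n k m kw E es deg])
  }
  show "\<exists>(S :: nat list set) (h :: nat list \<Rightarrow> nat \<Rightarrow> nat) (k :: nat) (m :: nat)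
      (w :: nat) (cells :: nat) (T :: nat).
      2000 * log 2 (2 / \<epsilon>) \<le> real k \<and> real k \<le> 40000 * log 2 (2 / \<epsilon>) \<and>
      n ^ 2 \<le> m \<and> m \<le> n ^ 3 \<and> kwise_independent k n m S h \<and>
      implements_cwei1 cwei1_program w cells T n S h \<and>
      real w \<le> 40000 * log 2 (real n) \<and>
      real (cells * w) \<le> 40000 * log 2 (2 / \<epsilon>) * log 2 (real n) \<and>
      real T \<le> 40000 * log 2 (2 / \<epsilon>)"
  proof (cases "n = 1")
    case True
    show ?thesis unfolding True by (rule cwei1_implementation_single[OF eps])
  next
    case False
    thus ?thesis using n by (intro cwei1_implementation[OF eps]) auto
  qed
qed auto

end
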